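(* Let $A$ be a $C^*$-algebra. The canonical linear map $\mathrm{Ped}(A)_{\mathrm{sa}} \to T_{\mathbb R}(A)^*$, $a \mapsto \hat a$, where $\hat a(\tau) = \tau(a)$ for $\tau \in T_{\mathbb R}(A)$, is a quotient map of locally convex spaces (it is continuous, surjective, and the topology of $T_{\mathbb R}(A)^*$ is the quotient topology), where $\mathrm{Ped}(A)_{\mathrm{sa}}$ carries the locally convex direct limit topology and $T_{\mathbb R}(A)^*$ carries the compact-open topology. Consequently, for every $f \in T_{\mathbb R}(A)^*$ and every $\epsilon > 0$ there is an $a \in \mathrm{Ped}(A)_{\mathrm{sa}}$ such that $f(\tau) = \tau(a)$ for all $\tau \in T_{\mathbb R}(A)$ and $\|a\| \leq \sup_{\tau \in T_{\leq 1}(A)} |f(\tau)| + \epsilon$.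
   Context: For a $C^*$-algebra $A$, $\mathrm{Ped}(A)$ denotes the Pedersen ideal of $A$ (the unique minimal norm-dense two-sided ideal of $A$), and $\mathrm{Ped}(A)_{\mathrm{sa}}$, $\mathrm{Ped}(A)_+=\mathrm{Ped}(A)\cap A_+$ denote its self-adjoint and positive elements. A $C^*$-subalgebra $D\subseteq \mathrm{Ped}(A)$ means a $C^*$-subalgebra $D$ of $A$ contained in $\mathrm{Ped}(A)$. $\mathrm{Ped}(A)$ is the directed union of such $D$ and is equipped with the corresponding locally convex direct limit topology: a linear map from $\mathrm{Ped}(A)$ to a locally convex space is continuous iff its restriction to every $C^*$-subalgebra $D\subseteq\mathrm{Ped}(A)$ is norm-continuous. A linear functional $\tau\colon \mathrm{Ped}(A)\to\mathbb C$ is tracial (a trace) if $\tau(xy)=\tau(yx)$ for all $x,y\in \mathrm{Ped}(A)$, self-adjoint if $\tau(x^* )=\overline{\tau(x)}$, and positive if $\tau(a)\ge 0$ for $a\in \mathrm{Ped}(A)_+$ (positive functionals are automatically continuous). $T_{\mathbb R}(A)$ is the real vector space of continuous self-adjoint traces on $\mathrm{Ped}(A)$ with the weak$^*$-topology (pointwise convergence on $\mathrm{Ped}(A)$). $T_{\leq 1}(A)\subseteq T_{\mathbb R}(A)$ is the set of positive traces that are norm-bounded with norm at most $1$. $T_{\mathbb R}(A)^*$ is the space of weak$^*$-continuous linear functionals $T_{\mathbb R}(A)\to\mathbb R$, with the compact-open topology (uniform convergence on weak$^*$-compact subsets of $T_{\mathbb R}(A)$). *)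

theory Defs
  imports "HOL-Analysis.Analysis"
begin

lemma istopology_neighbourhoods:
  assumes Int: "\<And>x i j. P i \<Longrightarrow> P j \<Longrightarrow> \<exists>k. P k \<and> B x k \<subseteq> B x i \<inter> B x j"
  shows "istopology (\<lambda>W. W \<subseteq> X \<and> (\<forall>x\<in>W. \<exists>i. P i \<and> B x i \<subseteq> W))"
  unfolding istopology_def
proof (rule conjI; intro allI impI)
  fix S T
  assume S: "S \<subseteq> X \<and> (\<forall>x\<in>S. \<exists>i. P i \<and> B x i \<subseteq> S)"
    and T: "T \<subseteq> X \<and> (\<forall>x\<in>T. \<exists>i. P i \<and> B x i \<subseteq> T)"
  show "S \<inter> T \<subseteq> X \<and> (\<forall>x\<in>S \<inter> T. \<exists>i. P i \<and> B x i \<subseteq> S \<inter> T)"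
  proof (intro conjI ballI)
    show "S \<inter> T \<subseteq> X" using S by (simp add: le_infI1)
    fix x assume "x \<in> S \<inter> T"
    then have "x \<in> S" "x \<in> T" by simp_all
    obtain i where i: "P i" "B x i \<subseteq> S" using S \<open>x \<in> S\<close> by meson
    obtain j where j: "P j" "B x j \<subseteq> T" using T \<open>x \<in> T\<close> by meson
    obtain k where k: "P k" "B x k \<subseteq> B x i \<inter> B x j"
      using Int[OF i(1) j(1)] by meson
    have "B x k \<subseteq> S \<inter> T"
      using k(2) Int_mono[OF i(2) j(2)] by (rule order_trans)
    with k(1) show "\<exists>i. P i \<and> B x i \<subseteq> S \<inter> T" by (intro exI conjI)
  qed
next
  fix \<K>
  assume K: "\<forall>K\<in>\<K>. K \<subseteq> X \<and> (\<forall>x\<in>K. \<exists>i. P i \<and> B x i \<subseteq> K)"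
  show "\<Union>\<K> \<subseteq> X \<and> (\<forall>x\<in>\<Union>\<K>. \<exists>i. P i \<and> B x i \<subseteq> \<Union>\<K>)"
  proof (intro conjI ballI)
    show "\<Union>\<K> \<subseteq> X" using K by (simp add: Sup_le_iff)
    fix x assume "x \<in> \<Union>\<K>"
    then obtain S where S: "S \<in> \<K>" "x \<in> S" by (rule UnionE)
    then obtain i where i: "P i" "B x i \<subseteq> S" using K by meson
    have "B x i \<subseteq> \<Union>\<K>" using i(2) Union_upper[OF S(1)] by (rule order_trans)
    with i(1) show "\<exists>i. P i \<and> B x i \<subseteq> \<Union>\<K>" by (intro exI conjI)
  qed
qed


section \<open>C*-algebras\<close>

text \<open>No unit is assumed, and the zero algebra is allowed.\<close>

class cstar_algebra = real_normed_algebra + banach +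
  fixes scaleC :: "complex \<Rightarrow> 'a \<Rightarrow> 'a" (infixr "*\<^sub>C" 75)
    and adj :: "'a \<Rightarrow> 'a"
  assumes scaleC_add_right: "c *\<^sub>C (x + y) = c *\<^sub>C x + c *\<^sub>C y"
    and scaleC_add_left: "(c + d) *\<^sub>C x = c *\<^sub>C x + d *\<^sub>C x"
    and scaleC_scaleC: "c *\<^sub>C d *\<^sub>C x = (c * d) *\<^sub>C x"
    and scaleC_of_real: "complex_of_real r *\<^sub>C x = r *\<^sub>R x"
    and mult_scaleC_left: "(c *\<^sub>C x) * y = c *\<^sub>C (x * y)"
    and mult_scaleC_right: "x * (c *\<^sub>C y) = c *\<^sub>C (x * y)"
    and norm_scaleC: "norm (c *\<^sub>C x) = cmod c * norm x"
    and adj_adj: "adj (adj x) = x"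
    and adj_add: "adj (x + y) = adj x + adj y"
    and adj_scaleC: "adj (c *\<^sub>C x) = cnj c *\<^sub>C adj x"
    and adj_mult: "adj (x * y) = adj y * adj x"
    and cstar_identity: "norm (adj x * x) = (norm x)\<^sup>2"

definition complex_subspace :: "'a::cstar_algebra set \<Rightarrow> bool" where
  "complex_subspace S \<longleftrightarrow>
     0 \<in> S \<and> (\<forall>x\<in>S. \<forall>y\<in>S. x + y \<in> S) \<and> (\<forall>c. \<forall>x\<in>S. c *\<^sub>C x \<in> S)"

definition cstar_subalgebra :: "'a::cstar_algebra set \<Rightarrow> bool" where
  "cstar_subalgebra D \<longleftrightarrow>
     complex_subspace D \<and> (\<forall>x\<in>D. \<forall>y\<in>D. x * y \<in> D) \<and> (\<forall>x\<in>D. adj x \<in> D) \<and> closed D"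

definition two_sided_ideal :: "'a::cstar_algebra set \<Rightarrow> bool" where
  "two_sided_ideal I \<longleftrightarrow>
     complex_subspace I \<and> (\<forall>x\<in>I. \<forall>a. a * x \<in> I \<and> x * a \<in> I)"

definition self_adjoint_elements :: "'a::cstar_algebra set" where
  "self_adjoint_elements = {a. adj a = a}"

definition positive_elements :: "'a::cstar_algebra set" where
  "positive_elements = {a. \<exists>b. a = adj b * b}"


section \<open>The Pedersen ideal\<close>

definition dense_ideal :: "'a::cstar_algebra set \<Rightarrow> bool" where
  "dense_ideal I \<longleftrightarrow> two_sided_ideal I \<and> closure I = UNIV"

definition pedersen_ideal :: "'a::cstar_algebra set" where
  "pedersen_ideal =
     (THE I. dense_ideal I \<and> (\<forall>J. dense_ideal J \<and> J \<subseteq> I \<longrightarrow> J = I))"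

definition pedersen_sa :: "'a::cstar_algebra set" where
  "pedersen_sa = pedersen_ideal \<inter> self_adjoint_elements"

definition pedersen_pos :: "'a::cstar_algebra set" where
  "pedersen_pos = pedersen_ideal \<inter> positive_elements"

text \<open>The finest locally convex topology on the Pedersen ideal for which the inclusions of all
  C*-subalgebras contained in it are continuous. Its basic neighbourhoods of zero are the
  absolutely convex sets meeting every such subalgebra in a norm neighbourhood of zero.\<close>

definition pedersen_nbhd :: "'a::cstar_algebra set \<Rightarrow> bool" where
  "pedersen_nbhd U \<longleftrightarrow>
     U \<subseteq> pedersen_ideal \<and> convex U \<and> (\<forall>x\<in>U. \<forall>c. cmod c \<le> 1 \<longrightarrow> c *\<^sub>C x \<in> U) \<and>
     (\<forall>D. cstar_subalgebra D \<and> D \<subseteq> pedersen_ideal \<longrightarrow> (\<exists>r>0. ball 0 r \<inter> D \<subseteq> U))"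

definition pedersen_topology :: "'a::cstar_algebra topology" where
  "pedersen_topology = topology (\<lambda>W.
     W \<subseteq> pedersen_ideal \<and> (\<forall>x\<in>W. \<exists>U. pedersen_nbhd U \<and> (+) x ` U \<subseteq> W))"

lemma pedersen_nbhd_Int:
  assumes "pedersen_nbhd U" "pedersen_nbhd V"
  shows "pedersen_nbhd (U \<inter> V)"
proof -
  have "\<exists>r>0. ball 0 r \<inter> D \<subseteq> U \<inter> V"
    if D: "cstar_subalgebra D \<and> D \<subseteq> pedersen_ideal" for D
  proof -
    obtain r s where "r > 0" "ball 0 r \<inter> D \<subseteq> U" "s > 0" "ball 0 s \<inter> D \<subseteq> V"
      using assms D unfolding pedersen_nbhd_def by meson
    then show ?thesis by (intro exI[of _ "min r s"]) auto
  qed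
  then show ?thesis
    using assms by (auto simp: pedersen_nbhd_def convex_Int)
qed

lemma openin_pedersen_topology:
  "openin pedersen_topology W \<longleftrightarrow>
     W \<subseteq> pedersen_ideal \<and> (\<forall>x\<in>W. \<exists>U. pedersen_nbhd U \<and> (+) x ` U \<subseteq> W)"
proof -
  have "\<exists>W. pedersen_nbhd W \<and> (+) x ` W \<subseteq> (+) x ` U \<inter> (+) x ` V"
    if "pedersen_nbhd U" "pedersen_nbhd V" for U V and x :: 'a
    using that by (intro exI[of _ "U \<inter> V"]) (auto intro: pedersen_nbhd_Int)
  from istopology_neighbourhoods[of pedersen_nbhd "\<lambda>x U. (+) x ` U", OF this]
  show ?thesis
    unfolding pedersen_topology_def by simp
qed


section \<open>Traces\<close>

text \<open>Functions on a set \<open>X\<close> are represented by elements of \<open>extensional X\<close>.\<close>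

definition lincomb_on ::
    "'x set \<Rightarrow> real \<Rightarrow> ('x \<Rightarrow> 'b::real_vector) \<Rightarrow> real \<Rightarrow> ('x \<Rightarrow> 'b) \<Rightarrow> 'x \<Rightarrow> 'b" where
  "lincomb_on X s f t g = (\<lambda>x\<in>X. s *\<^sub>R f x + t *\<^sub>R g x)"

definition pedersen_trace :: "('a::cstar_algebra \<Rightarrow> complex) \<Rightarrow> bool" where
  "pedersen_trace \<tau> \<longleftrightarrow>
     \<tau> \<in> extensional pedersen_ideal \<and>
     (\<forall>x\<in>pedersen_ideal. \<forall>y\<in>pedersen_ideal. \<tau> (x + y) = \<tau> x + \<tau> y) \<and>
     (\<forall>c. \<forall>x\<in>pedersen_ideal. \<tau> (c *\<^sub>C x) = c * \<tau> x) \<and>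
     (\<forall>x\<in>pedersen_ideal. \<forall>y\<in>pedersen_ideal. \<tau> (x * y) = \<tau> (y * x))"

definition real_traces :: "('a::cstar_algebra \<Rightarrow> complex) set" where
  "real_traces = {\<tau>. pedersen_trace \<tau> \<and> (\<forall>x\<in>pedersen_ideal. \<tau> (adj x) = cnj (\<tau> x)) \<and>
     continuous_map pedersen_topology euclidean \<tau>}"

definition contractive_positive_traces :: "('a::cstar_algebra \<Rightarrow> complex) set" where
  "contractive_positive_traces = {\<tau> \<in> real_traces.
     (\<forall>a\<in>pedersen_pos. \<tau> a \<in> \<real>\<^sub>\<ge>\<^sub>0) \<and>
     (\<forall>x\<in>pedersen_ideal. cmod (\<tau> x) \<le> norm x)}"

definition weak_star_topology :: "('a::cstar_algebra \<Rightarrow> complex) topology" where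
  "weak_star_topology =
     subtopology (product_topology (\<lambda>_. euclidean) pedersen_ideal) real_traces"


section \<open>The dual of the space of traces\<close>

definition traces_dual :: "(('a::cstar_algebra \<Rightarrow> complex) \<Rightarrow> real) set" where
  "traces_dual = {f \<in> extensional real_traces.
     (\<forall>\<sigma>\<in>real_traces. \<forall>\<tau>\<in>real_traces. \<forall>s t.
        f (lincomb_on pedersen_ideal s \<sigma> t \<tau>) = s * f \<sigma> + t * f \<tau>) \<and>
     continuous_map weak_star_topology euclideanreal f}"

text \<open>The compact-open topology, described as uniform convergence on compact sets.\<close>

definition traces_dual_topology :: "(('a::cstar_algebra \<Rightarrow> complex) \<Rightarrow> real) topology" where
  "traces_dual_topology = topology (\<lambda>W.
     W \<subseteq> traces_dual \<and>
     (\<forall>f\<in>W. \<exists>K \<epsilon>. compactin weak_star_topology K \<and> \<epsilon> > 0 \<and>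
        {g \<in> traces_dual. \<forall>\<tau>\<in>K. \<bar>g \<tau> - f \<tau>\<bar> < \<epsilon>} \<subseteq> W))"

lemma openin_traces_dual_topology:
  "openin traces_dual_topology W \<longleftrightarrow>
     W \<subseteq> traces_dual \<and>
     (\<forall>f\<in>W. \<exists>K \<epsilon>. compactin weak_star_topology K \<and> \<epsilon> > 0 \<and>
        {g \<in> traces_dual. \<forall>\<tau>\<in>K. \<bar>g \<tau> - f \<tau>\<bar> < \<epsilon>} \<subseteq> W)"
proof -
  define P where "P = (\<lambda>(K :: ('a \<Rightarrow> complex) set, \<epsilon> :: real).
    compactin weak_star_topology K \<and> \<epsilon> > 0)"
  define B where "B = (\<lambda>(f :: ('a \<Rightarrow> complex) \<Rightarrow> real) (K, \<epsilon>).
    {g \<in> traces_dual. \<forall>\<tau>\<in>K. \<bar>g \<tau> - f \<tau>\<bar> < \<epsilon>})"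
  have "\<exists>k. P k \<and> B f k \<subseteq> B f i \<inter> B f j" if "P i" "P j" for f i j
  proof -
    obtain K \<epsilon> L \<delta> where ij: "i = (K, \<epsilon>)" "j = (L, \<delta>)" by (metis surj_pair)
    then have "P (K \<union> L, min \<epsilon> \<delta>)"
      using that by (simp add: P_def compactin_Un)
    moreover have "B f (K \<union> L, min \<epsilon> \<delta>) \<subseteq> B f i \<inter> B f j"
      unfolding ij B_def by auto
    ultimately show ?thesis by blast
  qed
  from istopology_neighbourhoods[of P B, OF this]
  have "istopology (\<lambda>W. W \<subseteq> traces_dual \<and> (\<forall>f\<in>W. \<exists>i. P i \<and> B f i \<subseteq> W))" .
  moreover have "(\<exists>i. P i \<and> B f i \<subseteq> W) \<longleftrightarrow>
      (\<exists>K \<epsilon>. compactin weak_star_topology K \<and> \<epsilon> > 0 \<and>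
        {g \<in> traces_dual. \<forall>\<tau>\<in>K. \<bar>g \<tau> - f \<tau>\<bar> < \<epsilon>} \<subseteq> W)" for f W
    unfolding split_paired_Ex P_def B_def prod.case conj_assoc ..
  ultimately show ?thesis
    unfolding traces_dual_topology_def by (simp only: topology_inverse')
qed

text \<open>Self-adjoint traces are real on self-adjoint elements, so taking the real part loses
  nothing.\<close>

definition trace_evaluation ::
    "'a::cstar_algebra \<Rightarrow> ('a \<Rightarrow> complex) \<Rightarrow> real" where
  "trace_evaluation a = (\<lambda>\<tau>\<in>real_traces. Re (\<tau> a))"

end

theory Submission
  imports Defs "HOL-Complex_Analysis.Complex_Analysis"
begin

text \<open>
  A self-adjoint real functional on the Pedersen ideal is a trace as soon as it vanishes on the
  self-adjoint elements killed by all traces, because these include the real and imaginary parts of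
  commutators. Hence Hahn--Banach separation within \<open>pedersen_sa\<close> always produces traces: applied to
  the gauge of a neighbourhood of zero \<open>U\<close> it shows that the image of \<open>U\<close> contains the polar of the
  weak*-compact set \<open>U\<^sup>\<circ>\<close> of traces, so that the canonical map is open. Its continuity is the uniform
  boundedness principle on each C*-subalgebra, and surjectivity holds because weak*-continuous
  functionals are evaluations. For the norm estimate the separation takes place in the whole algebra and
  gives a bounded self-adjoint trace \<open>\<rho>\<close>. It has a Jordan decomposition into positive traces: the
  functional \<open>x \<mapsto> sup {\<rho> c | 0 \<le> c \<le> x}\<close> is additive and tracial by the Riesz decomposition property up
  to trace equivalence, and the norms of the two parts add up.

  The C*-theory this needs is derived from the isometric action of \<open>a + i (1 - a\<^sup>2)\<^sup>1\<^sup>/\<^sup>2\<close> on the algebra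
  by left multiplication, which bounds \<open>p(a)\<close> for polynomials \<open>p\<close> without recourse to spectra or to a
  unitisation.
\<close>

text \<open>Two obstacles shape the argument. Without a unit or a spectrum, positivity of a
  self-adjoint \<open>a\<close> is tested by the multiplier inequality
  \<open>norm (R *\<^sub>R z - a * z) \<le> R * norm z\<close>; unlike being a square, this
  condition is visibly additive, which makes the positive elements a cone. In the norm estimate,
  separation yields only a self-adjoint trace \<open>\<rho>\<close> of norm at most 1, while the
  supremum runs over positive traces. A splitting into two positive traces of norm up to 1 each
  would lose a factor 2; because the norms add up, \<open>\<rho>\<close> is essentially
  \<open>c\<close> times one contractive positive trace minus \<open>1 - c\<close> times another,
  and its value at \<open>a\<close> stays below the supremum. The splitting cannot rest on Riesz
  decomposition in the algebra itself, where an element below \<open>x + y\<close> need not be a sum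
  of elements below \<open>x\<close> and \<open>y\<close>; traces do not distinguish
  \<open>adj z * z\<close> from \<open>z * adj z\<close>, and this freedom repairs it. The summand
  \<open>\<epsilon>\<close> remains because the infimum defining a distance is only
  approximated.\<close>

section \<open>Elementary algebra of scalars and the involution\<close>

lemma scaleC_zero_left [simp]: "(0::complex) *\<^sub>C (x::'a::cstar_algebra) = 0"
  using scaleC_of_real[of 0 x] by simp

lemma scaleC_one [simp]: "(1::complex) *\<^sub>C (x::'a::cstar_algebra) = x"
  using scaleC_of_real[of 1 x] by simp

lemma scaleC_zero_right [simp]: "c *\<^sub>C (0::'a::cstar_algebra) = 0"
  using norm_scaleC[of c "0::'a"] by simp

lemma scaleC_minus_left: "(- c) *\<^sub>C (x::'a::cstar_algebra) = - (c *\<^sub>C x)"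
  using scaleC_add_left[of c "-c" x] by (simp add: eq_neg_iff_add_eq_0 add.commute)

lemma scaleC_minus_right: "c *\<^sub>C (- x::'a::cstar_algebra) = - (c *\<^sub>C x)"
  using scaleC_add_right[of c x "-x"] by (simp add: eq_neg_iff_add_eq_0 add.commute)

lemma scaleC_diff_right: "c *\<^sub>C (x - y::'a::cstar_algebra) = c *\<^sub>C x - c *\<^sub>C y"
  using scaleC_add_right[of c x "-y"] by (simp add: scaleC_minus_right)

lemma scaleC_sum_right: "c *\<^sub>C (\<Sum>i\<in>I. f i :: 'a::cstar_algebra) = (\<Sum>i\<in>I. c *\<^sub>C f i)"
  by (induction I rule: infinite_finite_induct) (auto simp: scaleC_add_right)

lemma scaleR_scaleC: "r *\<^sub>R (c *\<^sub>C x) = (of_real r * c) *\<^sub>C (x::'a::cstar_algebra)"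
  by (simp add: scaleC_scaleC flip: scaleC_of_real)

lemma scaleC_scaleR: "c *\<^sub>C (r *\<^sub>R x) = r *\<^sub>R (c *\<^sub>C (x::'a::cstar_algebra))"
  by (simp add: scaleC_scaleC mult.commute flip: scaleC_of_real)

lemma scaleC_ii_ii [simp]: "\<i> *\<^sub>C \<i> *\<^sub>C (x::'a::cstar_algebra) = - x"
  by (simp add: scaleC_scaleC scaleC_minus_left)

lemma adj_scaleR [simp]: "adj (r *\<^sub>R x) = r *\<^sub>R adj (x::'a::cstar_algebra)"
  by (simp add: adj_scaleC flip: scaleC_of_real)

lemma adj_zero [simp]: "adj (0::'a::cstar_algebra) = 0"
  using adj_scaleR[of 0 "0::'a"] by simp

lemma adj_minus [simp]: "adj (- x) = - adj (x::'a::cstar_algebra)"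
  using adj_scaleR[of "-1" x] by simp

lemma adj_diff: "adj (x - y) = adj x - adj (y::'a::cstar_algebra)"
  using adj_add[of x "-y"] by simp

declare adj_adj [simp]

lemma norm_adj [simp]: "norm (adj (x::'a::cstar_algebra)) = norm x"
proof -
  have *: "norm y \<le> norm (adj y)" for y :: 'a
  proof (cases "y = 0")
    case False
    have "norm y * norm y \<le> norm (adj y) * norm y"
      using cstar_identity[of y] norm_mult_ineq[of "adj y" y] by (simp add: power2_eq_square)
    then show ?thesis using False by simp
  qed simp
  show ?thesis using *[of x] *[of "adj x"] by simp
qed

lemma norm_mult_adj: "norm (x * adj (x::'a::cstar_algebra)) = (norm x)\<^sup>2"
  using cstar_identity[of "adj x"] by simp

lemma norm_sa_square: "adj a = a \<Longrightarrow> norm (a * a) = (norm (a::'a::cstar_algebra))\<^sup>2"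
  using cstar_identity[of a] by simp

lemma bounded_linear_adj: "bounded_linear (adj :: 'a \<Rightarrow> 'a::cstar_algebra)"
  by (rule bounded_linear_intro[where K=1]) (auto simp: adj_add)

lemmas continuous_on_adj [continuous_intros] = bounded_linear.continuous_on[OF bounded_linear_adj]
lemmas tendsto_adj [tendsto_intros] = bounded_linear.tendsto[OF bounded_linear_adj]
section \<open>Polynomials in an operator\<close>

text \<open>The variable is an operator on the algebra, not an element: in the absence of a unit the
  unitary needed below is available only as a map.\<close>

definition poly_op :: "('a \<Rightarrow> 'a) \<Rightarrow> complex poly \<Rightarrow> 'a::cstar_algebra \<Rightarrow> 'a" where
  "poly_op U P x = (\<Sum>k\<le>degree P. coeff P k *\<^sub>C (U ^^ k) x)"

definition clinear_op :: "('a::cstar_algebra \<Rightarrow> 'a) \<Rightarrow> bool" where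
  "clinear_op U \<longleftrightarrow> (\<forall>x y. U (x + y) = U x + U y) \<and> (\<forall>c x. U (c *\<^sub>C x) = c *\<^sub>C U x)"

lemma poly_op_altdef: "degree P \<le> n \<Longrightarrow> poly_op U P x = (\<Sum>k\<le>n. coeff P k *\<^sub>C (U ^^ k) x)"
  unfolding poly_op_def
  by (rule sum.mono_neutral_left) (auto simp: coeff_eq_0)

lemma clinear_op_add: "clinear_op U \<Longrightarrow> U (x + y) = U x + U y"
  and clinear_op_scaleC: "clinear_op U \<Longrightarrow> U (c *\<^sub>C x) = c *\<^sub>C U x"
  by (simp_all add: clinear_op_def)

lemma clinear_op_zero: "clinear_op U \<Longrightarrow> U 0 = 0"
  using clinear_op_scaleC[of U 0 0] by simp

lemma clinear_op_sum: "clinear_op U \<Longrightarrow> U (\<Sum>i\<in>I. f i) = (\<Sum>i\<in>I. U (f i))"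
  by (induction I rule: infinite_finite_induct) (auto simp: clinear_op_zero clinear_op_add)

lemma clinear_op_mult [simp]: "clinear_op ((*) (a::'a::cstar_algebra))"
  by (auto simp: clinear_op_def distrib_left mult_scaleC_right)

lemma clinear_op_funpow: "clinear_op U \<Longrightarrow> clinear_op (U ^^ k)"
  by (induction k) (auto simp: clinear_op_def)

lemma poly_op_0 [simp]: "poly_op U 0 x = 0"
  by (simp add: poly_op_def)

lemma poly_op_pCons:
  assumes "clinear_op U"
  shows "poly_op U (pCons c P) x = c *\<^sub>C x + U (poly_op U P x)"
proof -
  have "degree (pCons c P) \<le> Suc (degree P)" by (simp add: degree_pCons_le)
  then have "poly_op U (pCons c P) x = (\<Sum>k\<le>Suc (degree P). coeff (pCons c P) k *\<^sub>C (U ^^ k) x)"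
    by (rule poly_op_altdef)
  also have "\<dots> = c *\<^sub>C x + (\<Sum>k\<le>degree P. coeff P k *\<^sub>C U ((U ^^ k) x))"
    by (subst sum.atMost_Suc_shift) simp
  finally show ?thesis
    by (simp add: poly_op_def clinear_op_sum[OF assms] clinear_op_scaleC[OF assms])
qed

lemma poly_op_1 [simp]: "clinear_op U \<Longrightarrow> poly_op U 1 x = x"
  by (simp add: one_pCons poly_op_pCons clinear_op_zero)

lemma poly_op_add: "poly_op U (P + Q) x = poly_op U P x + poly_op U Q x"
proof -
  define n where "n = max (degree P) (degree Q)"
  have "degree P \<le> n" "degree Q \<le> n" "degree (P + Q) \<le> n"
    by (auto simp: n_def degree_add_le_max)
  then show ?thesis
    by (simp add: poly_op_altdef[of _ n] scaleC_add_left sum.distrib)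
qed

lemma poly_op_smult: "poly_op U (smult c P) x = c *\<^sub>C poly_op U P x"
proof -
  have "degree (smult c P) \<le> degree P" by (rule degree_smult_le)
  then show ?thesis
    by (simp add: poly_op_altdef[of _ "degree P"] scaleC_scaleC scaleC_sum_right)
qed

lemma poly_op_sum: "poly_op U (\<Sum>i\<in>I. P i) x = (\<Sum>i\<in>I. poly_op U (P i) x)"
  by (induction I rule: infinite_finite_induct) (auto simp: poly_op_add)

lemma poly_op_mult:
  assumes "clinear_op U"
  shows "poly_op U (P * Q) x = poly_op U P (poly_op U Q x)"
proof (induction P)
  case (pCons c P)
  then show ?case
    by (simp add: poly_op_add poly_op_smult poly_op_pCons assms)
qed simp

lemma poly_op_power:
  assumes "clinear_op U"
  shows "poly_op U (P ^ k) x = (poly_op U P ^^ k) x"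
  by (induction k arbitrary: x) (simp_all add: assms poly_op_mult)

lemma poly_op_monom:
  assumes "clinear_op U"
  shows "poly_op U (monom c k) x = c *\<^sub>C (U ^^ k) x"
  by (induction k) (simp_all add: monom_0 monom_Suc poly_op_pCons assms clinear_op_zero clinear_op_scaleC)

lemma norm_poly_op_isometry:
  assumes iso: "\<And>x. norm (U x) = norm x" and c: "\<And>k. cmod (coeff P k) \<le> M"
  and deg: "degree P \<le> n"
  shows "norm (poly_op U P x) \<le> (real n + 1) * M * norm x"
proof -
  have isok: "norm ((U ^^ k) x) = norm x" for k by (induction k) (auto simp: iso)
  have "norm (poly_op U P x) \<le> (\<Sum>k\<le>n. norm (coeff P k *\<^sub>C (U ^^ k) x))"
    unfolding poly_op_altdef[OF deg] by (rule norm_sum)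
  also have "\<dots> \<le> (\<Sum>k\<le>n. M * norm x)"
    by (intro sum_mono) (simp add: norm_scaleC isok c mult_right_mono)
  finally show ?thesis by (simp add: algebra_simps)
qed

lemma higher_deriv_poly: "(deriv ^^ k) (poly P) = poly ((pderiv ^^ k) (P :: complex poly))"
proof (induction k)
  case (Suc k)
  have "deriv (poly Q) = poly (pderiv Q)" for Q :: "complex poly"
    by (rule ext) (rule DERIV_imp_deriv, rule poly_DERIV)
  with Suc show ?case by simp
qed simp

text \<open>Cauchy's inequality for the derivatives at 0, taken on the unit circle.\<close>

lemma cmod_coeff_le:
  fixes P :: "complex poly"
  assumes "\<And>z. cmod z = 1 \<Longrightarrow> cmod (poly P z) \<le> M"
  shows "cmod (coeff P k) \<le> M"
proof -
  have "cmod ((deriv ^^ k) (poly P) 0) \<le> fact k * M / 1 ^ k"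
    by (rule Cauchy_inequality) (auto intro!: holomorphic_intros continuous_intros assms)
  moreover have "(deriv ^^ k) (poly P) 0 = fact k * coeff P k"
    by (simp add: higher_deriv_poly poly_0_coeff_0 coeff_higher_pderiv pochhammer_fact)
  ultimately show ?thesis by (simp add: norm_mult)
qed

section \<open>Polynomials in a self-adjoint element\<close>

text \<open>The equation \<open>2 *\<^sub>R s = a * a + s * s\<close> is
  \<open>(1 - s)^2 = 1 - a^2\<close> with the unit cancelled. It is solved as a fixed point of
  \<open>F\<close>, which contracts by the factor \<open>norm a\<close>; the closed invariant set
  \<open>S\<close> carries self-adjointness and commutation with \<open>a\<close> over to the
  solution.\<close>

lemma ex_sqrt_one_minus_square:
  fixes a :: "'a::cstar_algebra"
  assumes sa: "adj a = a" and n1: "norm a < 1"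
  shows "\<exists>s. adj s = s \<and> a * s = s * a \<and> 2 *\<^sub>R s = a * a + s * s"
proof -
  define S where "S = {s. adj s = s \<and> a * s = s * a \<and> norm s \<le> norm a}"
  define F where "F = (\<lambda>s. (1/2) *\<^sub>R (a * a + s * s))"
  have "closed S"
    unfolding S_def by (intro closed_Collect_conj closed_Collect_eq closed_Collect_le continuous_intros)
  moreover have "0 \<in> S" by (simp add: S_def)
  moreover have "F ` S \<subseteq> S"
  proof safe
    fix s assume s: "s \<in> S"
    have "norm (a * a + s * s) \<le> norm a * norm a + norm s * norm s"
      by (intro norm_triangle_le add_mono norm_mult_ineq)
    also have "\<dots> \<le> norm a * 1 + norm a * 1"
      using s n1 by (intro add_mono mult_mono) (auto simp: S_def)
    finally have "norm (F s) \<le> norm a" by (simp add: F_def)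
    moreover have "a * (s * s) = s * s * a"
      using s unfolding S_def by (metis (mono_tags, lifting) mem_Collect_eq mult.assoc)
    ultimately show "F s \<in> S"
      using s sa by (simp add: S_def F_def adj_add adj_mult algebra_simps)
  qed
  moreover have "\<forall>s\<in>S. \<forall>t\<in>S. dist (F s) (F t) \<le> norm a * dist s t"
  proof safe
    fix s t assume s: "s \<in> S" and t: "t \<in> S"
    have "F s - F t = (1/2) *\<^sub>R (s * (s - t) + (s - t) * t)"
      by (simp add: F_def algebra_simps)
    then have "2 * norm (F s - F t) \<le> norm s * norm (s - t) + norm (s - t) * norm t"
      by (simp add: norm_triangle_le add_mono norm_mult_ineq)
    also have "\<dots> \<le> norm a * norm (s - t) + norm (s - t) * norm a"
      using s t by (intro add_mono mult_mono) (auto simp: S_def)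
    finally show "dist (F s) (F t) \<le> norm a * dist s t" by (simp add: dist_norm)
  qed
  ultimately have "\<exists>!s\<in>S. F s = s"
    using n1 by (intro Banach_fix) (auto simp: complete_eq_closed)
  then obtain s where s: "s \<in> S" "F s = s" by blast
  have "2 *\<^sub>R F s = a * a + s * s" by (simp add: F_def)
  with s show ?thesis by (auto simp: S_def)
qed

text \<open>With \<open>s\<close> as above \<open>1 - s\<close> is a square root of \<open>1 - a\<^sup>2\<close>, so that \<open>a + i (1 - s)\<close> acts as
  a unitary whose real part is \<open>a\<close>.\<close>

lemma ex_unitary_dilation:
  fixes a :: "'a::cstar_algebra"
  assumes sa: "adj a = a" and n1: "norm a < 1"
  obtains U where "clinear_op U" "\<And>x. norm (U x) = norm x"
    "\<And>x. U (U x) + x = 2 *\<^sub>R U (a * x)" "\<And>x. U (a * x) = a * U x"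
proof -
  obtain s where s: "adj s = s" "a * s = s * a" "2 *\<^sub>R s = a * a + s * s"
    using ex_sqrt_one_minus_square[OF assms] by blast
  define U where "U = (\<lambda>x. a * x + \<i> *\<^sub>C (x - s * x))"
  have U: "clinear_op U"
    by (auto simp: clinear_op_def U_def algebra_simps scaleC_add_right scaleC_diff_right
        mult_scaleC_right scaleC_scaleC)
  have sx: "a * (a * x) + s * (s * x) = s * x + s * x" for x
  proof -
    have "(2 *\<^sub>R s) * x = (a * a + s * s) * x" using s by simp
    then show ?thesis by (simp add: algebra_simps scaleR_2)
  qed
  have as: "a * (s * x) = s * (a * x)" for x
    using s(2) by (metis mult.assoc)
  have "norm (U x) = norm x" for x
  proof -
    have "adj (U x) = adj x * a + (- \<i>) *\<^sub>C (adj x - adj x * s)"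
      by (simp add: U_def adj_add adj_mult sa s adj_diff adj_scaleC)
    then have "adj (U x) * U x = (adj x * a - \<i> *\<^sub>C (adj x - adj x * s)) * (a * x + \<i> *\<^sub>C (x - s * x))"
      by (simp add: U_def scaleC_minus_left)
    also have "\<dots> = adj x * (a * (a * x) + s * (s * x) - s * x - s * x) + adj x * x"
      by (simp add: algebra_simps mult_scaleC_right mult_scaleC_left scaleC_diff_right scaleC_add_right as)
    also have "\<dots> = adj x * x" by (simp add: sx)
    finally have "(norm (U x))\<^sup>2 = (norm x)\<^sup>2" by (metis cstar_identity)
    then show ?thesis by simp
  qed
  moreover have "U (U x) + x = 2 *\<^sub>R U (a * x)" for x
  proof -
    have "U (U x) + x - 2 *\<^sub>R U (a * x) = s * x + s * x - (a * (a * x) + s * (s * x))"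
      by (simp add: U_def algebra_simps mult_scaleC_right mult_scaleC_left scaleC_diff_right
          scaleC_add_right as scaleR_2)
    then show ?thesis by (simp add: sx)
  qed
  moreover have "U (a * x) = a * U x" for x
    by (simp add: U_def algebra_simps mult_scaleC_right as)
  ultimately show ?thesis using that[OF U] by blast
qed

text \<open>The relation between \<open>U\<close> and \<open>a\<close> reads
  \<open>(1 + U^2) / 2 = U a\<close>. Hence inserting \<open>U\<close> into
  \<open>z^n P((z + 1/z) / 2)\<close>, a genuine polynomial thanks to the factor \<open>z^n\<close>,
  gives \<open>U^n P(a)\<close>.\<close>

lemma poly_op_dilation:
  fixes U :: "'a::cstar_algebra \<Rightarrow> 'a"
  assumes U: "clinear_op U" "\<And>x. U (U x) + x = 2 *\<^sub>R U (a * x)" "\<And>x. U (a * x) = a * U x"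
    and n: "degree P \<le> n"
  shows "poly_op U (\<Sum>j\<le>n. smult (coeff P j) (monom 1 (n - j) * [:1/2, 0, 1/2:] ^ j)) x =
    (U ^^ n) (poly_op ((*) a) P x)"
proof -
  have half: "poly_op U [:1/2, 0, 1/2:] x = U (a * x)" for x
  proof -
    have "poly_op U [:1/2, 0, 1/2:] x = (1/2) *\<^sub>C (U (U x) + x)"
      using U(1) by (simp add: poly_op_pCons clinear_op_zero clinear_op_scaleC clinear_op_add scaleC_add_right)
    also have "\<dots> = complex_of_real (1/2) *\<^sub>C (2 *\<^sub>R U (a * x))"
      by (simp add: U(2))
    also have "\<dots> = U (a * x)" by (simp only: scaleC_of_real) simp
    finally show ?thesis .
  qed
  have comm: "(U ^^ j) (a * x) = a * (U ^^ j) x" for j x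
    by (induction j) (auto simp: U(3))
  have pow: "poly_op U ([:1/2, 0, 1/2:] ^ j) x = (U ^^ j) (((*) a ^^ j) x)" for j x
    unfolding poly_op_power[OF U(1)]
  proof (induction j)
    case (Suc j)
    have "(poly_op U [:1/2, 0, 1/2:] ^^ Suc j) x = U (a * (poly_op U [:1/2, 0, 1/2:] ^^ j) x)"
      by (simp only: half funpow.simps comp_apply)
    also have "\<dots> = (U ^^ Suc j) (((*) a ^^ Suc j) x)" by (simp only: Suc.IH) (simp add: comm)
    finally show ?case .
  qed simp
  have "poly_op U (monom 1 (n - j) * [:1/2, 0, 1/2:] ^ j) x = (U ^^ n) (((*) a ^^ j) x)" if "j \<le> n" for j
  proof -
    have "(U ^^ (n - j)) ((U ^^ j) y) = (U ^^ n) y" for y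
      using that funpow_add[of "n - j" j U] by (simp add: fun_eq_iff)
    then show ?thesis
      by (simp add: poly_op_mult U(1) pow poly_op_monom)
  qed
  then show ?thesis
    by (simp add: poly_op_sum poly_op_smult poly_op_altdef[OF n]
        clinear_op_sum[OF clinear_op_funpow[OF U(1)]] clinear_op_scaleC[OF clinear_op_funpow[OF U(1)]])
qed

section \<open>Real polynomials of a self-adjoint element, acting by left multiplication\<close>

text \<open>\<open>poly_act p a x\<close> is the product \<open>p(a) x\<close>, meaningful for
  constant terms although \<open>p(a)\<close> itself need not be an element. In particular
  \<open>poly_act q a a\<close> is the element \<open>a q(a)\<close>, the general polynomial in
  \<open>a\<close> without constant term.\<close>

definition poly_act :: "real poly \<Rightarrow> 'a::cstar_algebra \<Rightarrow> 'a \<Rightarrow> 'a" where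
  "poly_act p a x = poly_op ((*) a) (map_poly complex_of_real p) x"

lemma poly_act_0 [simp]: "poly_act 0 a x = 0"
  by (simp add: poly_act_def)

lemma poly_act_pCons: "poly_act (pCons c p) a x = c *\<^sub>R x + a * poly_act p a x"
  by (simp add: poly_act_def map_poly_pCons poly_op_pCons scaleC_of_real)

lemma poly_act_add: "poly_act (p + q) a x = poly_act p a x + poly_act q a x"
  by (induction p q rule: poly_induct2) (auto simp: poly_act_pCons algebra_simps)

lemma poly_act_smult: "poly_act (smult c p) a x = c *\<^sub>R poly_act p a x"
  by (induction p) (auto simp: poly_act_pCons algebra_simps)

lemma poly_act_diff: "poly_act (p - q) a x = poly_act p a x - poly_act q a x"
  using poly_act_add[of "p - q" q a x] by simp

lemma poly_act_mult: "poly_act (p * q) a x = poly_act p a (poly_act q a x)"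
  by (induction p) (auto simp: poly_act_pCons poly_act_add poly_act_smult)

lemma poly_act_mult_right: "poly_act p a (x * y) = poly_act p a x * y"
  by (induction p) (auto simp: poly_act_pCons algebra_simps)

lemma poly_act_intertwine: "x * a = b * x \<Longrightarrow> x * poly_act p a y = poly_act p b (x * y)"
proof (induction p)
  case (pCons c p)
  then have "x * (a * poly_act p a y) = b * (x * poly_act p a y)" by (metis mult.assoc)
  with pCons show ?case by (simp add: poly_act_pCons algebra_simps)
qed simp

lemma poly_act_commute: "poly_act p a (a * y) = a * poly_act p a y"
  using poly_act_intertwine[of a a a p y] by simp

lemma adj_poly_act_mult: "adj a = a \<Longrightarrow> adj (poly_act p a x) * y = adj x * poly_act p a y"
proof (induction p arbitrary: y)
  case (pCons c p)
  have "adj (poly_act p a x) * (a * y) = adj x * poly_act p a (a * y)" using pCons by simp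
  then have "adj (poly_act p a x) * (a * y) = adj x * (a * poly_act p a y)"
    by (simp only: poly_act_commute)
  with pCons.prems show ?case
    by (simp add: poly_act_pCons adj_add adj_mult distrib_left distrib_right mult.assoc)
qed simp

lemma adj_poly_act: "adj a = a \<Longrightarrow> adj (poly_act p a a) = poly_act p a a"
proof (induction p)
  case (pCons c p)
  have "poly_act p a a * a = a * poly_act p a a"
    using poly_act_mult_right[of p a a a] poly_act_commute[of p a a] by simp
  with pCons show ?case
    by (simp add: poly_act_pCons adj_add adj_mult)
qed simp

text \<open>Since \<open>U\<close> is isometric, \<open>p(a) x\<close> has the norm of
  \<open>U^n p(a) x\<close>, which is \<open>H(U) x\<close> for a polynomial \<open>H\<close> of
  degree at most \<open>2 n\<close>. On the unit circle \<open>H(z) = z^n p(Re z)\<close>, so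
  Cauchy's inequality bounds all coefficients of \<open>H\<close> by \<open>M\<close>.\<close>

lemma norm_poly_act_growth:
  fixes a :: "'a::cstar_algebra"
  assumes "adj a = a" "norm a < 1" and M: "\<And>t. \<bar>t\<bar> \<le> 1 \<Longrightarrow> \<bar>poly p t\<bar> \<le> M"
  shows "norm (poly_act p a x) \<le> (2 * real (degree p) + 1) * M * norm x"
proof -
  obtain U :: "'a \<Rightarrow> 'a" where U: "clinear_op U" "\<And>x. norm (U x) = norm x"
    "\<And>x. U (U x) + x = 2 *\<^sub>R U (a * x)" "\<And>x. U (a * x) = a * U x"
    using ex_unitary_dilation[OF assms(1,2)] by blast
  define n where "n = degree p"
  define P where "P = map_poly complex_of_real p"
  define H where "H = (\<Sum>j\<le>n. smult (coeff P j) (monom 1 (n - j) * [:1/2, 0, 1/2:] ^ j))"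
  have degP: "degree P \<le> n" by (simp add: P_def n_def map_poly_degree_leq)
  have "degree (smult (coeff P j) (monom 1 (n - j) * [:1/2, 0, 1/2:] ^ j)) \<le> 2 * n" if "j \<le> n" for j
  proof -
    have "degree ([:1/2, 0, 1/2:] ^ j :: complex poly) \<le> 2 * j"
      using degree_power_le[of "[:1/2, 0, 1/2:] :: complex poly" j] by simp
    moreover have "degree (monom 1 (n - j) :: complex poly) \<le> n - j" by (rule degree_monom_le)
    ultimately have "degree (monom 1 (n - j) * [:1/2, 0, 1/2:] ^ j :: complex poly) \<le> (n - j) + 2 * j"
      by (intro order_trans[OF degree_mult_le] add_mono)
    then show ?thesis using that order_trans[OF degree_smult_le] by fastforce
  qed
  then have degH: "degree H \<le> 2 * n"
    unfolding H_def by (intro degree_sum_le) auto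
  have "cmod (poly H z) \<le> M" if z: "cmod z = 1" for z
  proof -
    have "z * cnj z = 1" using complex_norm_square[of z] z by simp
    have "complex_of_real (Re z) = (z + cnj z) / 2" by (simp add: complex_add_cnj)
    with \<open>z * cnj z = 1\<close> have zz: "1/2 + z * z / 2 = z * complex_of_real (Re z)"
      by (simp add: distrib_left add_divide_distrib add.commute)
    have "poly H z = (\<Sum>j\<le>n. coeff P j * (z ^ (n - j) * (1/2 + z * z / 2) ^ j))"
      by (simp add: H_def poly_sum poly_monom algebra_simps)
    also have "\<dots> = (\<Sum>j\<le>n. z ^ n * complex_of_real (coeff p j * Re z ^ j))"
    proof (intro sum.cong refl)
      fix j assume "j \<in> {..n}"
      then have "z ^ (n - j) * z ^ j = z ^ n" by (simp flip: power_add)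
      then have "z ^ (n - j) * (1/2 + z * z / 2) ^ j = z ^ n * complex_of_real (Re z) ^ j"
        by (simp add: zz power_mult_distrib flip: mult.assoc)
      then show "coeff P j * (z ^ (n - j) * (1/2 + z * z / 2) ^ j) =
          z ^ n * complex_of_real (coeff p j * Re z ^ j)"
        by (simp add: P_def coeff_map_poly)
    qed
    also have "\<dots> = z ^ n * complex_of_real (poly p (Re z))"
      by (simp add: poly_altdef n_def sum_distrib_left)
    finally have "cmod (poly H z) = \<bar>poly p (Re z)\<bar>" by (simp add: norm_mult norm_power z)
    also have "\<dots> \<le> M" using M abs_Re_le_cmod[of z] z by simp
    finally show ?thesis .
  qed
  then have "cmod (coeff H k) \<le> M" for k by (rule cmod_coeff_le)
  then have "norm (poly_op U H x) \<le> (real (2 * n) + 1) * M * norm x"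
    using degH U(2) by (intro norm_poly_op_isometry) auto
  moreover have "poly_op U H x = (U ^^ n) (poly_op ((*) a) P x)"
    unfolding H_def by (rule poly_op_dilation[OF U(1,3,4) degP])
  moreover have "norm ((U ^^ k) y) = norm y" for k y
    by (induction k) (auto simp: U(2))
  ultimately show ?thesis by (simp add: poly_act_def P_def n_def)
qed

text \<open>The multiplier norm \<open>N\<close> satisfies \<open>N(q)\<^sup>2 \<le> N(q\<^sup>2)\<close> by the C*-identity, so that passing to high powers
  removes the factor growing linearly with the degree in \<open>norm_poly_act_growth\<close>.\<close>

lemma norm_poly_act_le_if_power_bound:
  fixes a :: "'a::cstar_algebra"
  assumes sa: "adj a = a"
  shows "\<lbrakk>0 \<le> C; \<And>x. norm (poly_act (q ^ (2 ^ k)) a x) \<le> C ^ (2 ^ k) * norm x\<rbrakk>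
    \<Longrightarrow> norm (poly_act q a x) \<le> C * norm x"
proof (induction k arbitrary: q C x)
  case (Suc k)
  have "norm (poly_act (q\<^sup>2) a y) \<le> C\<^sup>2 * norm y" for y
  proof (rule Suc.IH)
    show "norm (poly_act ((q\<^sup>2) ^ 2 ^ k) a x) \<le> (C\<^sup>2) ^ 2 ^ k * norm x" for x
      using Suc.prems(2)[of x] by (simp flip: power_mult)
  qed simp
  then have *: "norm (poly_act (q\<^sup>2) a x) \<le> C\<^sup>2 * norm x" .
  have "(norm (poly_act q a x))\<^sup>2 = norm (adj (poly_act q a x) * poly_act q a x)"
    by (rule cstar_identity[symmetric])
  also have "\<dots> = norm (adj x * poly_act (q\<^sup>2) a x)"
    by (simp only: adj_poly_act_mult[OF sa] poly_act_mult power2_eq_square)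
  also have "\<dots> \<le> norm x * (C\<^sup>2 * norm x)"
    by (rule order_trans[OF norm_mult_ineq]) (auto intro: mult_left_mono *)
  also have "\<dots> = (C * norm x)\<^sup>2" by (simp add: power2_eq_square)
  finally show ?case using Suc.prems(1) by (simp add: power2_le_iff_abs_le)
qed simp

lemma le_mult_right_if_greater:
  fixes u v M :: real
  assumes "\<And>C. C > M \<Longrightarrow> u \<le> C * v" "0 \<le> v"
  shows "u \<le> M * v"
proof (cases "v = 0")
  case False
  then have "u / v \<le> C" if "C > M" for C using assms(1)[OF that] assms(2) by (simp add: divide_le_eq)
  then have "u / v \<le> M" by (rule dense_ge)
  then show ?thesis using False assms(2) by (simp add: divide_le_eq)
qed (use assms(1)[of "M + 1"] in simp)

lemma norm_poly_act_le_unit: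
  fixes a :: "'a::cstar_algebra"
  assumes sa: "adj a = a" "norm a < 1" and M: "\<And>t. \<bar>t\<bar> \<le> 1 \<Longrightarrow> \<bar>poly p t\<bar> \<le> M"
  shows "norm (poly_act p a x) \<le> M * norm x"
proof -
  have M0: "0 \<le> M" using M[of 0] by simp
  have "norm (poly_act p a x) \<le> C * norm x" if C: "C > M" for C
  proof -
    define y where "y = M / C"
    have y: "0 \<le> y" "y < 1" using C M0 by (auto simp: y_def)
    define n where "n = degree p"
    \<comment> \<open>For the \<open>N\<close>-th power of \<open>p\<close> the growth factor is at
      most \<open>(2 n + 1) N\<close>, while the gap between \<open>M\<close> and \<open>C\<close>
      gains \<open>(M / C)^N\<close>; the product falls below 1.\<close>
    have "(\<lambda>N. of_nat N * y ^ N) \<longlonglongrightarrow> 0" by (rule powser_times_n_limit_0) (use y in auto)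
    then have "(\<lambda>N. (2 * real n + 1) * (of_nat N * y ^ N)) \<longlonglongrightarrow> (2 * real n + 1) * 0"
      by (intro tendsto_intros)
    then have "\<forall>\<^sub>F N in sequentially. (2 * real n + 1) * (of_nat N * y ^ N) < 1"
      by (rule order_tendstoD) simp
    then obtain N0 where N0: "\<And>N. N \<ge> N0 \<Longrightarrow> (2 * real n + 1) * (of_nat N * y ^ N) < 1"
      by (auto simp: eventually_sequentially)
    \<comment> \<open>A power of two, because the passage from \<open>p ^ N\<close> back to
      \<open>p\<close> is by repeated squaring; it also dominates \<open>N0\<close>.\<close>
    define N where "N = (2::nat) ^ N0"
    have N: "N \<ge> N0" "N \<ge> 1" by (auto simp: N_def less_imp_le)
    have "norm (poly_act (p ^ N) a x) \<le> C ^ N * norm x" for x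
    proof -
      have "\<bar>poly (p ^ N) t\<bar> \<le> M ^ N" if "\<bar>t\<bar> \<le> 1" for t
        using M[OF that] by (simp add: poly_power power_abs power_mono)
      then have "norm (poly_act (p ^ N) a x) \<le> (2 * real (degree (p ^ N)) + 1) * M ^ N * norm x"
        by (rule norm_poly_act_growth[OF sa])
      also have "\<dots> \<le> C ^ N * norm x"
      proof (rule mult_right_mono)
        have "degree (p ^ N) \<le> n * N" unfolding n_def by (rule degree_power_le)
        then have "real (degree (p ^ N)) \<le> real n * real N" by (metis of_nat_le_iff of_nat_mult)
        then have "2 * real (degree (p ^ N)) + 1 \<le> (2 * real n + 1) * real N"
          using N by (simp add: algebra_simps)
        then have "(2 * real (degree (p ^ N)) + 1) * M ^ N \<le> ((2 * real n + 1) * real N) * M ^ N"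
          using M0 by (intro mult_right_mono) auto
        also have "\<dots> = ((2 * real n + 1) * (real N * y ^ N)) * C ^ N"
          using C M0 by (simp add: y_def power_divide)
        also have "\<dots> \<le> 1 * C ^ N"
          using N0[OF N(1)] C M0 by (intro mult_right_mono) auto
        finally show "(2 * real (degree (p ^ N)) + 1) * M ^ N \<le> C ^ N" by simp
      qed simp
      finally show ?thesis .
    qed
    then show ?thesis
      using C M0 unfolding N_def by (rule_tac norm_poly_act_le_if_power_bound[OF sa(1), of C p N0 x]) linarith
  qed
  then show ?thesis by (rule le_mult_right_if_greater) auto
qed

lemma poly_act_pcompose:
  "poly_act (pcompose p [:0, c:]) a x = poly_act p (c *\<^sub>R a) x"
  by (induction p)
     (simp_all add: pcompose_pCons poly_act_add poly_act_pCons poly_act_mult poly_act_smult algebra_simps)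

text \<open>Rescaling reduces to an element of norm strictly below 1. Strictness requires an
  interval slightly larger than \<open>[-norm a, norm a]\<close>, and uniform continuity of
  \<open>p\<close> makes the cost of the enlargement an arbitrarily small \<open>e\<close>.\<close>

lemma norm_poly_act_le:
  fixes a :: "'a::cstar_algebra"
  assumes sa: "adj a = a" and M: "\<And>t. \<bar>t\<bar> \<le> norm a \<Longrightarrow> \<bar>poly p t\<bar> \<le> M"
  shows "norm (poly_act p a x) \<le> M * norm x"
proof -
  have "norm (poly_act p a x) \<le> (M + e) * norm x" if e: "e > 0" for e
  proof -
    have "uniformly_continuous_on {- (norm a + 1)..norm a + 1} (poly p)"
      by (intro compact_uniformly_continuous continuous_intros) auto
    then obtain d where d: "d > 0" "\<And>s t. \<lbrakk>\<bar>s\<bar> \<le> norm a + 1; \<bar>t\<bar> \<le> norm a + 1; \<bar>s - t\<bar> < d\<rbrakk>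
        \<Longrightarrow> \<bar>poly p s - poly p t\<bar> < e"
      using e unfolding uniformly_continuous_on_def dist_real_def by (metis abs_le_iff atLeastAtMost_iff minus_le_iff)
    define R where "R = norm a + min 1 (d/2)"
    have R: "R > norm a" "R > 0" "R \<le> norm a + 1" "R \<le> norm a + d/2"
      using d(1) by (auto simp: R_def add_nonneg_pos)
    have "\<bar>poly p t\<bar> \<le> M + e" if t: "\<bar>t\<bar> \<le> R" for t
    proof -
      define s where "s = max (- norm a) (min (norm a) t)"
      have "\<bar>s\<bar> \<le> norm a" "\<bar>t - s\<bar> < d" using t R d(1) norm_ge_zero[of a] unfolding s_def by linarith+
      then have "\<bar>poly p t - poly p s\<bar> < e" "\<bar>poly p s\<bar> \<le> M" using d(2)[of t s] M t R by auto
      then show ?thesis by linarith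
    qed
    then have "\<bar>poly (pcompose p [:0, R:]) t\<bar> \<le> M + e" if "\<bar>t\<bar> \<le> 1" for t
      using that R by (simp add: poly_pcompose abs_mult mult.commute mult_left_le)
    moreover have "poly_act p a x = poly_act (pcompose p [:0, R:]) ((1/R) *\<^sub>R a) x"
      using R by (simp add: poly_act_pcompose)
    ultimately show ?thesis
      using R sa by (simp add: norm_poly_act_le_unit)
  qed
  then have "norm (poly_act p a x) \<le> C * norm x" if "C > M" for C
    by (metis add.commute diff_add_cancel diff_gt_0_iff_gt that)
  then show ?thesis by (rule le_mult_right_if_greater) auto
qed

text \<open>The element \<open>y = a p(a)\<close> satisfies \<open>y * y = q(a) y\<close> for
  \<open>q(t) = t p(t)\<close>; applying the multiplier bound for \<open>q\<close> to
  \<open>y\<close> itself gives \<open>(norm y)^2 \<le> M * norm y\<close>. Thus the factor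
  \<open>t\<close> is taken into the supremum instead of being estimated by
  \<open>norm a\<close>.\<close>

lemma norm_poly_act_self_le:
  fixes a :: "'a::cstar_algebra"
  assumes sa: "adj a = a" and M: "\<And>t. \<bar>t\<bar> \<le> norm a \<Longrightarrow> \<bar>t * poly p t\<bar> \<le> M"
  shows "norm (poly_act p a a) \<le> M"
proof -
  define y where "y = poly_act p a a"
  have "y * y = poly_act (pCons 0 p) a y"
    by (simp add: y_def poly_act_pCons poly_act_mult_right[symmetric] poly_act_commute)
  then have "(norm y)\<^sup>2 = norm (poly_act (pCons 0 p) a y)"
    using norm_sa_square[of y] adj_poly_act[OF sa, of p] by (simp add: y_def)
  also have "\<dots> \<le> M * norm y" by (rule norm_poly_act_le[OF sa]) (use M in auto)
  finally have "norm y * norm y \<le> M * norm y" by (simp add: power2_eq_square)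
  moreover have "0 \<le> M" using M[of 0] by simp
  ultimately show ?thesis unfolding y_def[symmetric] by (cases "y = 0") auto
qed

section \<open>Continuous functional calculus for one self-adjoint element\<close>

text \<open>Without a unit, \<open>f(a)\<close> is in general an element of the algebra only if
  \<open>f\<close> vanishes at 0. Continuity on the whole line stands in for continuity on the
  spectrum.\<close>

definition null_continuous :: "(real \<Rightarrow> real) \<Rightarrow> bool" where
  "null_continuous f \<longleftrightarrow> continuous_on UNIV f \<and> f 0 = 0"

text \<open>Approximants of the form \<open>t q(t)\<close> vanish at 0. The sequence depends on
  \<open>f\<close> and \<open>R\<close> only, so one sequence can serve several elements of norm at
  most \<open>R\<close>; the fixed rate gives the Cauchy property at once.\<close>

definition poly_approx :: "(real \<Rightarrow> real) \<Rightarrow> real \<Rightarrow> (nat \<Rightarrow> real poly) \<Rightarrow> bool" where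
  "poly_approx f R Q \<longleftrightarrow> (\<forall>n t. \<bar>t\<bar> \<le> R \<longrightarrow> \<bar>t * poly (Q n) t - f t\<bar> \<le> 1 / (real n + 1))"

definition fun_calc :: "(real \<Rightarrow> real) \<Rightarrow> 'a::cstar_algebra \<Rightarrow> 'a" where
  "fun_calc f a = lim (\<lambda>n. poly_act ((SOME Q. poly_approx f (norm a) Q) n) a a)"

lemma null_continuous_poly: "null_continuous (\<lambda>t. t * poly q t)"
  by (auto simp: null_continuous_def intro!: continuous_intros)

lemma ex_poly_approx:
  assumes "null_continuous f"
  shows "\<exists>Q. poly_approx f R Q"
proof -
  have "\<exists>q. \<forall>t. \<bar>t\<bar> \<le> R \<longrightarrow> \<bar>t * poly q t - f t\<bar> \<le> 1 / (real n + 1)" for n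
  proof -
    define S where "S = {-\<bar>R\<bar>..\<bar>R\<bar>}"
    \<comment> \<open>Half of the target accuracy: discarding the constant term \<open>b\<close> of
      the Weierstrass approximant, which is within \<open>e\<close> of \<open>f 0 = 0\<close>, costs
      as much as the approximation itself.\<close>
    define e where "e = 1 / (2 * (real n + 1))"
    have e: "e > 0" "2 * e = 1 / (real n + 1)" by (simp_all add: e_def field_simps)
    have "continuous_on S f" using assms by (auto simp: null_continuous_def intro: continuous_on_subset)
    moreover have "compact S" by (simp add: S_def)
    ultimately obtain g where g: "real_polynomial_function g" "\<And>x. x \<in> S \<Longrightarrow> \<bar>f x - g x\<bar> < e"
      using Stone_Weierstrass_real_polynomial_function[of S f e] e by metis
    obtain c N where cN: "g = (\<lambda>x. \<Sum>i\<le>N. c i * x ^ i)"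
      using g(1) by (auto simp: real_polynomial_function_iff_sum)
    define p where "p = (\<Sum>i\<le>N. monom (c i) i)"
    have gp: "g x = poly p x" for x by (simp add: cN p_def poly_sum poly_monom)
    obtain b q where bq: "p = pCons b q" by (cases p) auto
    have "\<bar>t * poly q t - f t\<bar> \<le> 1 / (real n + 1)" if "\<bar>t\<bar> \<le> R" for t
    proof -
      have "t \<in> S" "0 \<in> S" using that by (auto simp: S_def)
      then have "\<bar>f t - (b + t * poly q t)\<bar> < e" "\<bar>f 0 - b\<bar> < e"
        using g(2)[of t] g(2)[of 0] by (simp_all add: gp bq)
      then have "\<bar>t * poly q t - f t\<bar> \<le> 2 * e"
        using assms by (simp add: null_continuous_def)
      then show ?thesis using e by simp
    qed
    then show ?thesis by blast
  qed
  then show ?thesis unfolding poly_approx_def by metis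
qed

lemma norm_poly_act_diff_le:
  fixes a :: "'a::cstar_algebra"
  assumes sa: "adj a = a"
    and "\<And>t. \<bar>t\<bar> \<le> norm a \<Longrightarrow> \<bar>t * poly p t - f t\<bar> \<le> d" "\<And>t. \<bar>t\<bar> \<le> norm a \<Longrightarrow> \<bar>t * poly q t - f t\<bar> \<le> e"
  shows "norm (poly_act p a a - poly_act q a a) \<le> d + e"
  unfolding poly_act_diff[symmetric]
proof (rule norm_poly_act_self_le[OF sa])
  fix t assume "\<bar>t\<bar> \<le> norm a"
  from assms(2,3)[OF this] show "\<bar>t * poly (p - q) t\<bar> \<le> d + e"
    by (simp add: right_diff_distrib)
qed

lemma poly_approx_mono: "poly_approx f R Q \<Longrightarrow> r \<le> R \<Longrightarrow> poly_approx f r Q"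
  by (auto simp: poly_approx_def)

lemma inverse_Suc_tendsto: "(\<lambda>n. c / (real n + 1)) \<longlonglongrightarrow> 0"
  using tendsto_mult[OF tendsto_const[of c] LIMSEQ_inverse_real_of_nat]
  by (simp add: inverse_eq_divide add.commute)

lemma norm_le_inverse_Suc_tendsto:
  fixes X :: "nat \<Rightarrow> 'a::real_normed_vector"
  assumes "\<And>n. norm (X n) \<le> c / (real n + 1)"
  shows "X \<longlonglongrightarrow> 0"
  by (rule Lim_null_comparison[OF _ inverse_Suc_tendsto[of c]]) (simp add: assms)

lemma eq_if_diff_tendsto_0:
  fixes X :: "nat \<Rightarrow> 'a::real_normed_vector"
  assumes "X \<longlonglongrightarrow> 0" "X \<longlonglongrightarrow> u - v"
  shows "u = v"
  using LIMSEQ_unique[OF assms] by simp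

text \<open>Two approximating sequences differ by functions that are uniformly small on
  \<open>[-norm a, norm a]\<close>, and the norm bound for polynomials transfers this to
  \<open>a\<close>. Hence the choice inside \<open>fun_calc\<close> is immaterial.\<close>

lemma poly_approx_tendsto:
  fixes a :: "'a::cstar_algebra"
  assumes sa: "adj a = a" and Q: "poly_approx f R Q" and R: "norm a \<le> R"
  shows "(\<lambda>n. poly_act (Q n) a a) \<longlonglongrightarrow> fun_calc f a"
proof -
  define Q' where "Q' = (SOME Q. poly_approx f (norm a) Q)"
  have QR: "poly_approx f (norm a) Q" using Q R by (rule poly_approx_mono)
  then have Q': "poly_approx f (norm a) Q'" unfolding Q'_def by (rule someI[of "poly_approx f (norm a)"])
  have *: "norm (poly_act (P n) a a - poly_act (P' m) a a) \<le> 1 / (real n + 1) + 1 / (real m + 1)"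
    if "poly_approx f (norm a) P" "poly_approx f (norm a) P'" for P P' n m
    using that by (intro norm_poly_act_diff_le[OF sa, where f=f]) (auto simp: poly_approx_def)
  have "Cauchy (\<lambda>n. poly_act (Q' n) a a)"
  proof (rule metric_CauchyI)
    fix e :: real assume e: "e > 0"
    obtain N where N: "\<And>n. n \<ge> N \<Longrightarrow> 1 / (real n + 1) < e / 2"
      using order_tendstoD(2)[OF inverse_Suc_tendsto[of 1], of "e/2"] e
      by (auto simp: eventually_sequentially)
    have "dist (poly_act (Q' m) a a) (poly_act (Q' n) a a) < e" if "m \<ge> N" "n \<ge> N" for m n
      using *[OF Q' Q', of m n] N[OF that(1)] N[OF that(2)] by (simp add: dist_norm)
    then show "\<exists>M. \<forall>m\<ge>M. \<forall>n\<ge>M. dist (poly_act (Q' m) a a) (poly_act (Q' n) a a) < e" by blast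
  qed
  then have lim: "(\<lambda>n. poly_act (Q' n) a a) \<longlonglongrightarrow> fun_calc f a"
    unfolding fun_calc_def Q'_def[symmetric] by (meson Cauchy_convergent convergent_LIMSEQ_iff)
  have "norm (poly_act (Q n) a a - poly_act (Q' n) a a) \<le> 2 / (real n + 1)" for n
    using *[OF QR Q', of n n] by simp
  then have "(\<lambda>n. poly_act (Q n) a a - poly_act (Q' n) a a) \<longlonglongrightarrow> 0"
    by (rule norm_le_inverse_Suc_tendsto)
  from tendsto_add[OF this lim] show ?thesis by simp
qed

lemma fun_calc_tendsto:
  assumes "null_continuous f"
  obtains Q where "poly_approx f R Q"
    "\<And>a::'a::cstar_algebra. adj a = a \<Longrightarrow> norm a \<le> R \<Longrightarrow> (\<lambda>n. poly_act (Q n) a a) \<longlonglongrightarrow> fun_calc f a"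
  using ex_poly_approx[OF assms, of R] poly_approx_tendsto by metis

lemma fun_calc_poly:
  fixes a :: "'a::cstar_algebra"
  assumes "adj a = a"
  shows "fun_calc (\<lambda>t. t * poly q t) a = poly_act q a a"
proof -
  have "(\<lambda>n. poly_act q a a) \<longlonglongrightarrow> fun_calc (\<lambda>t. t * poly q t) a"
    by (rule poly_approx_tendsto[OF assms, where Q="\<lambda>_. q" and R="norm a"]) (auto simp: poly_approx_def)
  then show ?thesis by (simp add: LIMSEQ_const_iff)
qed

lemma fun_calc_id: "adj a = a \<Longrightarrow> fun_calc (\<lambda>t. t) a = a"
  using fun_calc_poly[of a 1] by (simp add: one_pCons poly_act_pCons)

lemma adj_fun_calc:
  assumes "adj a = a" "null_continuous f"
  shows "adj (fun_calc f a) = fun_calc f a"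
proof -
  obtain Q where "(\<lambda>n. poly_act (Q n) a a) \<longlonglongrightarrow> fun_calc f a"
    using fun_calc_tendsto[OF assms(2), of "norm a"] assms(1) by blast
  from tendsto_adj[OF this] this show ?thesis
    by (simp add: adj_poly_act assms LIMSEQ_unique)
qed

lemma norm_fun_calc_le:
  fixes a :: "'a::cstar_algebra"
  assumes sa: "adj a = a" and f: "null_continuous f" and M: "\<And>t. \<bar>t\<bar> \<le> norm a \<Longrightarrow> \<bar>f t\<bar> \<le> M"
  shows "norm (fun_calc f a) \<le> M"
proof -
  obtain Q where Q: "poly_approx f (norm a) Q" "(\<lambda>n. poly_act (Q n) a a) \<longlonglongrightarrow> fun_calc f a"
    using fun_calc_tendsto[OF f, of "norm a"] sa by blast
  have "norm (poly_act (Q n) a a) \<le> M + 1 / (real n + 1)" for n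
  proof (rule norm_poly_act_self_le[OF sa])
    fix t assume t: "\<bar>t\<bar> \<le> norm a"
    then have "\<bar>t * poly (Q n) t - f t\<bar> \<le> 1 / (real n + 1)"
      using Q(1) unfolding poly_approx_def by blast
    with M[OF t] show "\<bar>t * poly (Q n) t\<bar> \<le> M + 1 / (real n + 1)" by linarith
  qed
  moreover have "(\<lambda>n. M + 1 / (real n + 1)) \<longlonglongrightarrow> M + 0"
    by (intro tendsto_intros inverse_Suc_tendsto)
  ultimately show ?thesis
    using tendsto_norm[OF Q(2)] by (auto intro: LIMSEQ_le)
qed

lemma null_continuous_add: "null_continuous f \<Longrightarrow> null_continuous g \<Longrightarrow> null_continuous (\<lambda>t. f t + g t)"
  by (auto simp: null_continuous_def intro!: continuous_intros)

lemma null_continuous_diff: "null_continuous f \<Longrightarrow> null_continuous g \<Longrightarrow> null_continuous (\<lambda>t. f t - g t)"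
  by (auto simp: null_continuous_def intro!: continuous_intros)

lemma null_continuous_scale: "null_continuous f \<Longrightarrow> null_continuous (\<lambda>t. c * f t)"
  by (auto simp: null_continuous_def intro!: continuous_intros)

lemma null_continuous_mult: "null_continuous f \<Longrightarrow> null_continuous g \<Longrightarrow> null_continuous (\<lambda>t. f t * g t)"
  by (auto simp: null_continuous_def intro!: continuous_intros)

lemma null_continuous_comp: "null_continuous f \<Longrightarrow> null_continuous g \<Longrightarrow> null_continuous (\<lambda>t. f (g t))"
  by (auto simp: null_continuous_def intro: continuous_on_compose2[of UNIV])

lemma null_continuous_id: "null_continuous (\<lambda>t. t)"
  by (simp add: null_continuous_def)

lemma fun_calc_lincomb:
  fixes a :: "'a::cstar_algebra"
  assumes sa: "adj a = a" and f: "null_continuous f" and g: "null_continuous g"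
  shows "fun_calc (\<lambda>t. c * f t + g t) a = c *\<^sub>R fun_calc f a + fun_calc g a"
proof -
  let ?h = "\<lambda>t. c * f t + g t"
  have h: "null_continuous ?h" by (rule null_continuous_add[OF null_continuous_scale[OF f] g])
  obtain P where P: "poly_approx f (norm a) P" "(\<lambda>n. poly_act (P n) a a) \<longlonglongrightarrow> fun_calc f a"
    using fun_calc_tendsto[OF f, of "norm a"] sa by blast
  obtain Q where Q: "poly_approx g (norm a) Q" "(\<lambda>n. poly_act (Q n) a a) \<longlonglongrightarrow> fun_calc g a"
    using fun_calc_tendsto[OF g, of "norm a"] sa by blast
  obtain S where S: "poly_approx ?h (norm a) S" "(\<lambda>n. poly_act (S n) a a) \<longlonglongrightarrow> fun_calc ?h a"
    using fun_calc_tendsto[OF h, of "norm a"] sa by blast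
  have "norm (c *\<^sub>R poly_act (P n) a a + poly_act (Q n) a a - poly_act (S n) a a) \<le> (\<bar>c\<bar> + 2) / (real n + 1)" for n
    unfolding poly_act_diff[symmetric] poly_act_add[symmetric] poly_act_smult[symmetric]
  proof (rule norm_poly_act_self_le[OF sa])
    fix t assume t: "\<bar>t\<bar> \<le> norm a"
    have *: "\<bar>t * poly (P n) t - f t\<bar> \<le> 1 / (real n + 1)" "\<bar>t * poly (Q n) t - g t\<bar> \<le> 1 / (real n + 1)"
      "\<bar>t * poly (S n) t - ?h t\<bar> \<le> 1 / (real n + 1)"
      using P(1) Q(1) S(1) t unfolding poly_approx_def by blast+
    have "\<bar>c * (t * poly (P n) t - f t)\<bar> \<le> \<bar>c\<bar> * (1 / (real n + 1))"
      unfolding abs_mult by (intro mult_left_mono *(1)) simp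
    moreover have "t * poly (smult c (P n) + Q n - S n) t =
        c * (t * poly (P n) t - f t) + (t * poly (Q n) t - g t) - (t * poly (S n) t - ?h t)"
      by (simp add: algebra_simps)
    moreover have "(\<bar>c\<bar> + 2) / (real n + 1) = \<bar>c\<bar> * (1 / (real n + 1)) + 2 * (1 / (real n + 1))"
      by (simp add: add_divide_distrib)
    ultimately show "\<bar>t * poly (smult c (P n) + Q n - S n) t\<bar> \<le> (\<bar>c\<bar> + 2) / (real n + 1)"
      using *(2,3) by linarith
  qed
  then have "(\<lambda>n. c *\<^sub>R poly_act (P n) a a + poly_act (Q n) a a - poly_act (S n) a a) \<longlonglongrightarrow> 0"
    by (rule norm_le_inverse_Suc_tendsto)
  moreover have "(\<lambda>n. c *\<^sub>R poly_act (P n) a a + poly_act (Q n) a a - poly_act (S n) a a) \<longlonglongrightarrow>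
      c *\<^sub>R fun_calc f a + fun_calc g a - fun_calc ?h a"
    by (intro tendsto_intros P Q S)
  ultimately show ?thesis by (rule eq_if_diff_tendsto_0[THEN sym])
qed

lemma fun_calc_zero: "adj a = a \<Longrightarrow> fun_calc (\<lambda>t. 0) a = 0"
  using fun_calc_poly[of a 0] by simp

lemma fun_calc_add:
  "adj a = a \<Longrightarrow> null_continuous f \<Longrightarrow> null_continuous g \<Longrightarrow>
    fun_calc (\<lambda>t. f t + g t) a = fun_calc f a + fun_calc g a"
  using fun_calc_lincomb[of a f g 1] by simp

lemma fun_calc_scale:
  "adj a = a \<Longrightarrow> null_continuous f \<Longrightarrow> fun_calc (\<lambda>t. c * f t) a = c *\<^sub>R fun_calc f a"
  using fun_calc_lincomb[of a f "\<lambda>t. 0" c] by (simp add: fun_calc_zero null_continuous_def)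

lemma fun_calc_diff:
  assumes sa: "adj a = a" and f: "null_continuous f" and g: "null_continuous g"
  shows "fun_calc (\<lambda>t. f t - g t) a = fun_calc f a - fun_calc g a"
proof -
  have "fun_calc (\<lambda>t. f t + (- 1) * g t) a = fun_calc f a + (- 1) *\<^sub>R fun_calc g a"
    by (simp only: fun_calc_add[OF sa f null_continuous_scale[OF g]] fun_calc_scale[OF sa g])
  then show ?thesis by simp
qed

lemma fun_calc_cong:
  fixes a :: "'a::cstar_algebra"
  assumes sa: "adj a = a" and f: "null_continuous f" "null_continuous g"
    and eq: "\<And>t. \<bar>t\<bar> \<le> norm a \<Longrightarrow> f t = g t"
  shows "fun_calc f a = fun_calc g a"
proof -
  have "norm (fun_calc (\<lambda>t. f t - g t) a) \<le> 0"
    by (rule norm_fun_calc_le[OF sa null_continuous_diff[OF f]]) (simp add: eq)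
  then show ?thesis by (simp add: fun_calc_diff[OF sa f])
qed

lemma fun_calc_tendsto_uniform:
  fixes a :: "'a::cstar_algebra"
  assumes sa: "adj a = a" and f: "null_continuous f" and g: "\<And>n. null_continuous (g n)"
    and le: "\<And>n t. \<bar>t\<bar> \<le> norm a \<Longrightarrow> \<bar>g n t - f t\<bar> \<le> e n" and e: "e \<longlonglongrightarrow> 0"
  shows "(\<lambda>n. fun_calc (g n) a) \<longlonglongrightarrow> fun_calc f a"
proof -
  have "norm (fun_calc (g n) a - fun_calc f a) \<le> e n" for n
    unfolding fun_calc_diff[OF sa g f, symmetric]
    by (rule norm_fun_calc_le[OF sa null_continuous_diff[OF g f]]) (rule le)
  then have "(\<lambda>n. fun_calc (g n) a - fun_calc f a) \<longlonglongrightarrow> 0"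
    by (intro Lim_null_comparison[OF _ e] always_eventually allI)
  then show ?thesis by (rule LIM_zero_cancel)
qed

text \<open>One polynomial sequence, chosen on an interval large enough for both \<open>a\<close>
  and \<open>b\<close>, intertwines exactly at each stage.\<close>

lemma fun_calc_intertwine:
  fixes a b x :: "'a::cstar_algebra"
  assumes "adj a = a" "adj b = b" and x: "x * a = b * x" and f: "null_continuous f"
  shows "x * fun_calc f a = fun_calc f b * x"
proof -
  obtain Q where Q0: "poly_approx f (max (norm a) (norm b)) Q"
    using ex_poly_approx[OF f] by blast
  have Q: "(\<lambda>n. poly_act (Q n) a a) \<longlonglongrightarrow> fun_calc f a" "(\<lambda>n. poly_act (Q n) b b) \<longlonglongrightarrow> fun_calc f b"
    by (rule poly_approx_tendsto[OF _ Q0]; simp add: assms)+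
  have "x * poly_act q a a = poly_act q b b * x" for q
    using poly_act_intertwine[OF x, of q a] by (simp only: x poly_act_mult_right)
  then have "(\<lambda>n. x * poly_act (Q n) a a) \<longlonglongrightarrow> fun_calc f b * x"
    using tendsto_mult_right[OF Q(2), of x] by simp
  with tendsto_mult_left[OF Q(1), of x] show ?thesis by (rule LIMSEQ_unique)
qed

lemma null_continuous_bounded:
  assumes "null_continuous g"
  obtains B where "\<And>t. \<bar>t\<bar> \<le> R \<Longrightarrow> \<bar>g t\<bar> \<le> B"
proof -
  have "bounded (g ` {-R..R})"
    using assms by (intro compact_imp_bounded compact_continuous_image)
      (auto simp: null_continuous_def intro: continuous_on_subset)
  then obtain B where "\<forall>x\<in>g ` {-R..R}. \<bar>x\<bar> \<le> B" unfolding bounded_real by blast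
  then show ?thesis using that[of B] by (auto simp: abs_le_iff)
qed

text \<open>The case \<open>f(t) = t\<close> is a limit of polynomial identities; induction on the
  coefficients extends it to \<open>f(t) = t q(t)\<close> with arbitrary \<open>g\<close>, and
  uniform approximation gives general \<open>f\<close>. Boundedness of \<open>g\<close> on the
  interval keeps the error small after multiplication.\<close>

lemma fun_calc_mult:
  fixes a :: "'a::cstar_algebra"
  assumes sa: "adj a = a" and f: "null_continuous f" and g: "null_continuous g"
  shows "fun_calc (\<lambda>t. f t * g t) a = fun_calc f a * fun_calc g a"
proof -
  have id: "fun_calc (\<lambda>t. t * h t) a = a * fun_calc h a" if h: "null_continuous h" for h
  proof -
    obtain Q where Q: "poly_approx h (norm a) Q" "(\<lambda>n. poly_act (Q n) a a) \<longlonglongrightarrow> fun_calc h a"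
      using fun_calc_tendsto[OF h, of "norm a"] sa by blast
    have "(\<lambda>n. fun_calc (\<lambda>t. t * poly (pCons 0 (Q n)) t) a) \<longlonglongrightarrow> fun_calc (\<lambda>t. t * h t) a"
    proof (rule fun_calc_tendsto_uniform[OF sa _ null_continuous_poly])
      show "null_continuous (\<lambda>t. t * h t)" by (intro null_continuous_mult null_continuous_id h)
      show "\<bar>t * poly (pCons 0 (Q n)) t - t * h t\<bar> \<le> norm a / (real n + 1)" if t: "\<bar>t\<bar> \<le> norm a" for n t
      proof -
        have "\<bar>t * poly (Q n) t - h t\<bar> \<le> 1 / (real n + 1)" using Q(1) t unfolding poly_approx_def by blast
        then have "\<bar>t\<bar> * \<bar>t * poly (Q n) t - h t\<bar> \<le> norm a * (1 / (real n + 1))"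
          using t by (intro mult_mono) auto
        then show ?thesis by (simp add: algebra_simps flip: abs_mult)
      qed
    qed (rule inverse_Suc_tendsto)
    moreover have "(\<lambda>n. fun_calc (\<lambda>t. t * poly (pCons 0 (Q n)) t) a) \<longlonglongrightarrow> a * fun_calc h a"
      unfolding fun_calc_poly[OF sa] poly_act_pCons using tendsto_mult_left[OF Q(2)] by simp
    ultimately show ?thesis by (rule LIMSEQ_unique)
  qed
  have poly: "fun_calc (\<lambda>t. t * poly q t * g t) a = poly_act q a (a * fun_calc g a)" for q
  proof (induction q)
    case 0
    show ?case by (simp add: fun_calc_zero sa)
  next
    case (pCons c q)
    have n: "null_continuous (\<lambda>t. t * g t)" "null_continuous (\<lambda>t. t * poly q t * g t)"
      by (intro null_continuous_mult null_continuous_id null_continuous_poly g)+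
    have "fun_calc (\<lambda>t. t * poly (pCons c q) t * g t) a =
        fun_calc (\<lambda>t. c * (t * g t) + t * (t * poly q t * g t)) a"
      by (simp add: algebra_simps)
    also have "\<dots> = c *\<^sub>R fun_calc (\<lambda>t. t * g t) a + fun_calc (\<lambda>t. t * (t * poly q t * g t)) a"
      using n by (subst fun_calc_add[OF sa])
        (auto intro: null_continuous_scale null_continuous_mult null_continuous_id simp: fun_calc_scale[OF sa])
    finally show ?case by (simp only: id n g pCons poly_act_pCons)
  qed
  obtain Q where Q: "poly_approx f (norm a) Q" "(\<lambda>n. poly_act (Q n) a a) \<longlonglongrightarrow> fun_calc f a"
    using fun_calc_tendsto[OF f, of "norm a"] sa by blast
  obtain B where B: "\<And>t. \<bar>t\<bar> \<le> norm a \<Longrightarrow> \<bar>g t\<bar> \<le> B" by (rule null_continuous_bounded[OF g]) (rule that)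
  have "(\<lambda>n. fun_calc (\<lambda>t. t * poly (Q n) t * g t) a) \<longlonglongrightarrow> fun_calc (\<lambda>t. f t * g t) a"
  proof (rule fun_calc_tendsto_uniform[OF sa])
    show "\<bar>t * poly (Q n) t * g t - f t * g t\<bar> \<le> B / (real n + 1)" if t: "\<bar>t\<bar> \<le> norm a" for n t
    proof -
      have "\<bar>t * poly (Q n) t - f t\<bar> \<le> 1 / (real n + 1)" using Q(1) t unfolding poly_approx_def by blast
      then have "\<bar>t * poly (Q n) t - f t\<bar> * \<bar>g t\<bar> \<le> (1 / (real n + 1)) * B"
        using B[OF t] by (intro mult_mono) auto
      then show ?thesis by (simp add: algebra_simps flip: abs_mult)
    qed
  qed (intro null_continuous_mult null_continuous_poly f g inverse_Suc_tendsto)+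
  moreover have "(\<lambda>n. fun_calc (\<lambda>t. t * poly (Q n) t * g t) a) \<longlonglongrightarrow> fun_calc f a * fun_calc g a"
    unfolding poly poly_act_mult_right by (intro tendsto_mult Q tendsto_const)
  ultimately show ?thesis by (rule LIMSEQ_unique)
qed

lemma fun_calc_comp:
  fixes a :: "'a::cstar_algebra"
  assumes sa: "adj a = a" and f: "null_continuous f" and g: "null_continuous g"
  shows "fun_calc f (fun_calc g a) = fun_calc (\<lambda>t. f (g t)) a"
proof -
  define b where "b = fun_calc g a"
  have sb: "adj b = b" unfolding b_def by (rule adj_fun_calc[OF sa g])
  have poly: "poly_act q b b = fun_calc (\<lambda>t. g t * poly q (g t)) a" for q
  proof (induction q)
    case 0
    show ?case by (simp add: fun_calc_zero sa)
  next
    case (pCons c q)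
    have n: "null_continuous (\<lambda>t. g t * poly q (g t))"
      using null_continuous_comp[OF null_continuous_poly g] .
    have "fun_calc (\<lambda>t. g t * poly (pCons c q) (g t)) a =
        fun_calc (\<lambda>t. c * g t + g t * (g t * poly q (g t))) a"
      by (simp add: algebra_simps)
    also have "\<dots> = c *\<^sub>R fun_calc g a + fun_calc g a * fun_calc (\<lambda>t. g t * poly q (g t)) a"
      by (simp only: fun_calc_add[OF sa null_continuous_scale[OF g] null_continuous_mult[OF g n]]
          fun_calc_scale[OF sa g] fun_calc_mult[OF sa g n])
    finally show ?case by (simp add: poly_act_pCons pCons.IH flip: b_def)
  qed
  obtain B where B: "\<And>t. \<bar>t\<bar> \<le> norm a \<Longrightarrow> \<bar>g t\<bar> \<le> B" by (rule null_continuous_bounded[OF g]) (rule that)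
  \<comment> \<open>The interval must contain the values of \<open>g\<close> for the convergence as
    functions of \<open>a\<close>, and \<open>[-norm b, norm b]\<close> for the convergence at
    \<open>b\<close>.\<close>
  obtain Q where Q: "poly_approx f (max B (norm b)) Q"
    using ex_poly_approx[OF f] by blast
  have lim: "(\<lambda>n. poly_act (Q n) b b) \<longlonglongrightarrow> fun_calc f b"
    by (rule poly_approx_tendsto[OF sb Q]) simp
  have "(\<lambda>n. fun_calc (\<lambda>t. g t * poly (Q n) (g t)) a) \<longlonglongrightarrow> fun_calc (\<lambda>t. f (g t)) a"
  proof (rule fun_calc_tendsto_uniform[OF sa])
    show "\<bar>g t * poly (Q n) (g t) - f (g t)\<bar> \<le> 1 / (real n + 1)" if t: "\<bar>t\<bar> \<le> norm a" for n t
      using Q B[OF t] unfolding poly_approx_def by (simp add: le_max_iff_disj)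
  qed (rule null_continuous_comp[OF f g] null_continuous_comp[OF null_continuous_poly g] inverse_Suc_tendsto)+
  then have "(\<lambda>n. poly_act (Q n) b b) \<longlonglongrightarrow> fun_calc (\<lambda>t. f (g t)) a" by (simp only: poly)
  with lim show ?thesis unfolding b_def by (rule LIMSEQ_unique)
qed

section \<open>Positive elements\<close>

definition excess :: "real \<Rightarrow> real \<Rightarrow> real" where "excess r t = max 0 (t - r)"

lemma null_continuous_excess: "0 \<le> r \<Longrightarrow> null_continuous (excess r)"
  unfolding null_continuous_def excess_def[abs_def] by (auto intro!: continuous_intros)

lemma null_continuous_uminus: "null_continuous (\<lambda>t. - t)"
  by (auto simp: null_continuous_def intro!: continuous_intros)

lemma fun_calc_uminus: "adj a = a \<Longrightarrow> fun_calc (\<lambda>t. - t) a = - a"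
  using fun_calc_scale[of a "\<lambda>t. t" "-1"] by (simp add: null_continuous_id fun_calc_id)

lemma fun_calc_minus_arg:
  "adj a = a \<Longrightarrow> null_continuous f \<Longrightarrow> fun_calc f (- a) = fun_calc (\<lambda>t. f (- t)) a"
  using fun_calc_comp[of a f "\<lambda>t. - t"] by (simp add: null_continuous_uminus fun_calc_uminus)

text \<open>The hypothesis says that \<open>Q + y\<close> has multiplier norm at most \<open>R\<close>; dividing \<open>f\<close> by powers of
  \<open>Q + t\<close>, which exceeds \<open>R + d\<close> on the support of \<open>f\<close>, shrinks the norm geometrically.\<close>

lemma fun_calc_eq_0_if_multiplier_bound:
  fixes y :: "'a::cstar_algebra"
  assumes sa: "adj y = y" and le: "\<And>z. norm (Q *\<^sub>R z + y * z) \<le> R * norm z"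
    and R: "0 \<le> R" and d: "0 < d" and f: "null_continuous f" and f0: "\<And>t. t \<le> R - Q + d \<Longrightarrow> f t = 0"
  shows "fun_calc f y = 0"
proof -
  define g where "g = (\<lambda>n t. f t / max (Q + t) (R + d) ^ n)"
  have pos: "0 < max (Q + t) (R + d)" for t using R d by linarith
  have g: "null_continuous (g n)" for n
  proof -
    have "max (Q + t) (R + d) ^ n \<noteq> 0" for t using pos[of t] by simp
    then show ?thesis
      using f unfolding null_continuous_def g_def by (auto intro!: continuous_intros)
  qed
  have step: "norm (fun_calc (g n) y) \<le> R * norm (fun_calc (g (Suc n)) y)" for n
  proof -
    have "Q * g (Suc n) t + t * g (Suc n) t = g n t" for t
    proof (cases "t \<le> R - Q + d")
      case False
      then have "max (Q + t) (R + d) = Q + t" by simp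
      moreover have "(Q + t) * (f t / (Q + t) ^ Suc n) = f t / (Q + t) ^ n"
        using False R d by simp
      ultimately show ?thesis by (simp only: g_def distrib_right)
    qed (simp add: g_def f0)
    then have "fun_calc (g n) y = fun_calc (\<lambda>t. Q * g (Suc n) t + t * g (Suc n) t) y" by simp
    also have "\<dots> = Q *\<^sub>R fun_calc (g (Suc n)) y + y * fun_calc (g (Suc n)) y"
      by (simp only: fun_calc_add[OF sa null_continuous_scale[OF g] null_continuous_mult[OF null_continuous_id g]]
          fun_calc_scale[OF sa g] fun_calc_mult[OF sa null_continuous_id g] fun_calc_id[OF sa])
    finally show ?thesis using le by simp
  qed
  obtain M where M: "\<And>t. \<bar>t\<bar> \<le> norm y \<Longrightarrow> \<bar>f t\<bar> \<le> M" by (rule null_continuous_bounded[OF f]) (rule that)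
  have gn: "norm (fun_calc (g n) y) \<le> M / (R + d) ^ n" for n
  proof (rule norm_fun_calc_le[OF sa g])
    fix t assume t: "\<bar>t\<bar> \<le> norm y"
    have "(R + d) ^ n \<le> max (Q + t) (R + d) ^ n" using R d by (intro power_mono) auto
    moreover have "\<bar>max (Q + t) (R + d) ^ n\<bar> = max (Q + t) (R + d) ^ n" using pos[of t] by simp
    ultimately show "\<bar>g n t\<bar> \<le> M / (R + d) ^ n"
      using M[OF t] R d unfolding g_def abs_divide by (intro frac_le) auto
  qed
  have "norm (fun_calc (g 0) y) \<le> R ^ n * norm (fun_calc (g n) y)" for n
  proof (induction n)
    case (Suc n)
    have "R ^ n * norm (fun_calc (g n) y) \<le> R ^ n * (R * norm (fun_calc (g (Suc n)) y))"
      using R by (intro mult_left_mono step) auto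
    with Suc show ?case by (simp add: mult_ac)
  qed simp
  then have bound: "norm (fun_calc f y) \<le> M * (R / (R + d)) ^ n" for n
  proof -
    have "norm (fun_calc f y) \<le> R ^ n * norm (fun_calc (g n) y)"
      using \<open>\<And>n. norm (fun_calc (g 0) y) \<le> R ^ n * norm (fun_calc (g n) y)\<close> by (simp add: g_def)
    also have "\<dots> \<le> R ^ n * (M / (R + d) ^ n)" using R by (intro mult_left_mono gn) auto
    finally show ?thesis by (simp add: power_divide mult_ac)
  qed
  have "(\<lambda>n. M * (R / (R + d)) ^ n) \<longlonglongrightarrow> M * 0"
    using R d by (intro tendsto_intros LIMSEQ_power_zero) auto
  then have "norm (fun_calc f y) \<le> 0"
    using bound by (intro LIMSEQ_le_const[of _ 0]) auto
  then show ?thesis by simp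
qed

text \<open>The first bound excludes any part of \<open>y\<close> above \<open>\<rho>\<close>, the
  second any part below \<open>-\<rho>\<close>: both \<open>excess\<close> parts at level
  \<open>\<rho> + d\<close> vanish, hence \<open>y\<close> equals its own truncation to
  \<open>[-\<rho> - d, \<rho> + d]\<close>.\<close>

lemma norm_le_if_multiplier_bounds:
  fixes y :: "'a::cstar_algebra"
  assumes sa: "adj y = y" and \<rho>: "0 \<le> \<rho>" and Q: "0 \<le> Q" "0 \<le> Q'"
    and le: "\<And>z. norm (Q *\<^sub>R z + y * z) \<le> (Q + \<rho>) * norm z"
      "\<And>z. norm (Q' *\<^sub>R z - y * z) \<le> (Q' + \<rho>) * norm z"
  shows "norm y \<le> \<rho>"
proof (rule field_le_epsilon)
  fix d :: real assume d: "d > 0"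
  have r: "0 \<le> \<rho> + d" using d \<rho> by simp
  note n = null_continuous_excess[OF r] null_continuous_comp[OF null_continuous_excess[OF r] null_continuous_uminus]
  have 1: "fun_calc (excess (\<rho> + d)) y = 0"
    using \<rho> Q d n
    by (intro fun_calc_eq_0_if_multiplier_bound[OF sa le(1), where d=d]) (auto simp: excess_def)
  have "fun_calc (excess (\<rho> + d)) (- y) = 0"
    using \<rho> Q d n le(2) sa
    by (intro fun_calc_eq_0_if_multiplier_bound[where Q=Q' and R="Q' + \<rho>" and d=d]) (auto simp: excess_def)
  then have 2: "fun_calc (\<lambda>t. excess (\<rho> + d) (- t)) y = 0"
    by (simp add: fun_calc_minus_arg sa n)
  define f where "f = (\<lambda>t. t - (excess (\<rho> + d) t - excess (\<rho> + d) (- t)))"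
  have "fun_calc f y = y"
    unfolding f_def
    by (simp only: fun_calc_diff[OF sa null_continuous_id null_continuous_diff[OF n]] fun_calc_diff[OF sa n]
        fun_calc_id[OF sa] 1 2) simp
  moreover have "norm (fun_calc f y) \<le> \<rho> + d"
  proof (rule norm_fun_calc_le[OF sa])
    show "null_continuous f" unfolding f_def
      by (rule null_continuous_diff[OF null_continuous_id null_continuous_diff[OF n]])
    show "\<bar>f t\<bar> \<le> \<rho> + d" for t using r by (auto simp: f_def excess_def)
  qed
  ultimately show "norm y \<le> \<rho> + d" by simp
qed

section \<open>The cone of squares of self-adjoint elements\<close>

text \<open>The working notion of positivity. Squares of self-adjoint elements are accessible to the
  functional calculus; that every \<open>adj b * b\<close> is one of them is the hard part and is
  postponed to \<open>sa_square_adj_mult\<close>.\<close>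

definition sa_square :: "'a::cstar_algebra \<Rightarrow> bool" where
  "sa_square a \<longleftrightarrow> (\<exists>c. adj c = c \<and> a = c * c)"

lemma sa_square_sa: "sa_square a \<Longrightarrow> adj a = a"
  by (auto simp: sa_square_def adj_mult)

text \<open>With \<open>k\<close> a square root of \<open>2 R a - a^2\<close>, formally
  \<open>(R - a)^2 + k^2 = R^2\<close>. So the multipliers \<open>R - a + i k\<close> and
  \<open>R - a - i k\<close> are \<open>R\<close> times isometries, and \<open>R - a\<close> is
  their mean.\<close>

lemma sa_square_multiplier_bound:
  fixes a :: "'a::cstar_algebra"
  assumes a: "sa_square a" and R: "norm a \<le> R"
  shows "norm (R *\<^sub>R z - a * z) \<le> R * norm z"
proof -
  obtain c where c: "adj c = c" "a = c * c" using a by (auto simp: sa_square_def)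
  have sa: "adj a = a" using a by (rule sa_square_sa)
  have R0: "0 \<le> R" using R norm_ge_zero[of a] by linarith
  \<comment> \<open>A function of the root \<open>c\<close>, not of \<open>a\<close>: positivity of
    \<open>t * t\<close> is manifest, whereas for functions of \<open>a\<close> negative arguments
    cannot be excluded at this stage.\<close>
  define f where "f = (\<lambda>t. sqrt (max 0 (2 * R * (t * t) - (t * t) * (t * t))))"
  have f: "null_continuous f" by (auto simp: f_def null_continuous_def intro!: continuous_intros)
  define k where "k = fun_calc f c"
  have k: "adj k = k" unfolding k_def by (rule adj_fun_calc[OF c(1) f])
  have ak: "a * k = k * a"
    unfolding k_def by (rule fun_calc_intertwine[OF c(1) c(1) _ f]) (simp add: c(2) mult.assoc)
  have n2: "null_continuous (\<lambda>t. t * t)" by (rule null_continuous_mult[OF null_continuous_id null_continuous_id])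
  have f2: "fun_calc (\<lambda>t. t * t) c = a"
    by (simp only: fun_calc_mult[OF c(1) null_continuous_id null_continuous_id] fun_calc_id[OF c(1)] c(2))
  have "k * k = fun_calc (\<lambda>t. f t * f t) c" unfolding k_def by (rule fun_calc_mult[OF c(1) f f, symmetric])
  also have "\<dots> = fun_calc (\<lambda>t. (2 * R) * (t * t) - (t * t) * (t * t)) c"
  proof (rule fun_calc_cong[OF c(1) null_continuous_mult[OF f f] null_continuous_diff[OF null_continuous_scale[OF n2] null_continuous_mult[OF n2 n2]]])
    fix t assume t: "\<bar>t\<bar> \<le> norm c"
    have "t * t \<le> norm c * norm c" using t by (metis abs_ge_zero abs_mult_self_eq mult_mono norm_ge_zero)
    also have "\<dots> = norm a" using norm_sa_square[OF c(1)] by (simp add: c(2) power2_eq_square)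
    also have "\<dots> \<le> 2 * R" using R R0 by linarith
    finally have "0 \<le> (t * t) * (2 * R - t * t)" by (intro mult_nonneg_nonneg[OF zero_le_square]) simp
    then show "f t * f t = (2 * R) * (t * t) - (t * t) * (t * t)"
      by (simp add: f_def algebra_simps)
  qed
  also have "\<dots> = (2 * R) *\<^sub>R a - a * a"
    by (simp only: fun_calc_diff[OF c(1) null_continuous_scale[OF n2] null_continuous_mult[OF n2 n2]]
        fun_calc_scale[OF c(1) n2] fun_calc_mult[OF c(1) n2 n2] f2)
  finally have kk: "k * k = (2 * R) *\<^sub>R a - a * a" .
  have kkz: "k * (k * z) = R *\<^sub>R (a * z) + R *\<^sub>R (a * z) - a * (a * z)"
    using arg_cong[OF kk, of "\<lambda>y. y * z"]
    by (simp add: left_diff_distrib mult.assoc flip: scaleR_left_distrib)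
  have akz: "a * (k * z) = k * (a * z)" using ak by (metis mult.assoc)
  have iso: "norm (R *\<^sub>R z - a * z + c *\<^sub>C (k * z)) = R * norm z" if "c = \<i> \<or> c = - \<i>" for c
  proof -
    define W where "W = R *\<^sub>R z - a * z + c *\<^sub>C (k * z)"
    have aW: "adj W = R *\<^sub>R adj z - adj z * a - c *\<^sub>C (adj z * k)"
      using that by (auto simp: W_def adj_add adj_diff adj_mult adj_scaleC sa k scaleC_minus_left)
    have cc: "c *\<^sub>C c *\<^sub>C y = - y" for y :: 'a
      using that by (auto simp: scaleC_scaleC scaleC_minus_left)
    have "adj W * W = (R *\<^sub>R adj z - adj z * a - c *\<^sub>C (adj z * k)) * (R *\<^sub>R z - a * z + c *\<^sub>C (k * z))"
      unfolding aW by (simp only: W_def)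
    also have "\<dots> = (R * R) *\<^sub>R (adj z * z)"
      by (simp add: cc algebra_simps mult_scaleC_right mult_scaleC_left scaleC_diff_right
          scaleC_add_right akz kkz scaleC_scaleR)
    finally have "(norm W)\<^sup>2 = (R * norm z)\<^sup>2"
      using cstar_identity[of W] cstar_identity[of z] by (simp add: power2_eq_square mult_ac)
    then show ?thesis using R0 by (simp add: W_def)
  qed
  have "2 *\<^sub>R (R *\<^sub>R z - a * z) =
      (R *\<^sub>R z - a * z + \<i> *\<^sub>C (k * z)) + (R *\<^sub>R z - a * z + (- \<i>) *\<^sub>C (k * z))"
    by (simp only: scaleC_minus_left scaleR_2) simp
  then have "norm (2 *\<^sub>R (R *\<^sub>R z - a * z)) \<le>
      norm (R *\<^sub>R z - a * z + \<i> *\<^sub>C (k * z)) + norm (R *\<^sub>R z - a * z + (- \<i>) *\<^sub>C (k * z))"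
    by (simp only: norm_triangle_ineq)
  also have "\<dots> = R * norm z + R * norm z"
    by (simp only: iso[OF disjI1[OF refl]] iso[OF disjI2[OF refl]])
  finally show ?thesis by simp
qed

lemma null_continuous_pos: "null_continuous (\<lambda>t. max 0 t)"
  and null_continuous_neg: "null_continuous (\<lambda>t. max 0 (- t))"
  by (auto simp: null_continuous_def intro!: continuous_intros)

lemma fun_calc_pos_neg:
  fixes x :: "'a::cstar_algebra"
  assumes sa: "adj x = x"
  shows "fun_calc (\<lambda>t. max 0 t) x - fun_calc (\<lambda>t. max 0 (- t)) x = x"
proof -
  have "fun_calc (\<lambda>t. max 0 t - max 0 (- t)) x = fun_calc (\<lambda>t. max 0 t) x - fun_calc (\<lambda>t. max 0 (- t)) x"
    by (rule fun_calc_diff[OF sa null_continuous_pos null_continuous_neg])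
  moreover have "(\<lambda>t::real. max 0 t - max 0 (- t)) = (\<lambda>t. t)" by (auto simp: max_def)
  ultimately show ?thesis by (simp add: fun_calc_id sa)
qed

text \<open>With \<open>Q = R\<close> the multiplier bound annihilates \<open>excess\<close> of
  \<open>- a\<close> at every positive level; these functions converge uniformly to the negative
  part, which is therefore 0 at \<open>a\<close>.\<close>

lemma fun_calc_pos_if_multiplier_bound:
  fixes a :: "'a::cstar_algebra"
  assumes sa: "adj a = a" and R: "0 \<le> R" and le: "\<And>z. norm (R *\<^sub>R z - a * z) \<le> R * norm z"
  shows "fun_calc (\<lambda>t. max 0 t) a = a"
proof -
  define n where "n = (\<lambda>t::real. max 0 (- t))"
  have nn: "null_continuous n"
    unfolding n_def by (rule null_continuous_neg)
  define e where "e = (\<lambda>k t. excess (1 / (real k + 1)) (- t))"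
  have en: "null_continuous (e k)" for k
    unfolding e_def by (rule null_continuous_comp[OF null_continuous_excess null_continuous_uminus]) simp
  have "fun_calc (excess (1 / (real k + 1))) (- a) = 0" for k
    using R le sa
    by (intro fun_calc_eq_0_if_multiplier_bound[where Q=R and R=R and d="1 / (real k + 1)"] null_continuous_excess)
       (auto simp: excess_def)
  then have e0: "fun_calc (e k) a = 0" for k
    by (simp add: fun_calc_minus_arg sa null_continuous_excess e_def)
  have "(\<lambda>k. fun_calc (e k) a) \<longlonglongrightarrow> fun_calc n a"
  proof (rule fun_calc_tendsto_uniform[OF sa nn en _ inverse_Suc_tendsto[of 1]])
    fix k :: nat and t :: real
    have "0 < 1 / (real k + 1)" by simp
    then show "\<bar>e k t - n t\<bar> \<le> 1 / (real k + 1)"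
      unfolding e_def n_def excess_def by linarith
  qed
  then have "fun_calc n a = 0" by (simp add: e0 LIMSEQ_const_iff)
  then show ?thesis using fun_calc_pos_neg[OF sa] by (simp add: n_def)
qed

lemma fun_calc_pos: "sa_square a \<Longrightarrow> fun_calc (\<lambda>t. max 0 t) a = (a::'a::cstar_algebra)"
  using sa_square_multiplier_bound[of a "norm a"]
  by (intro fun_calc_pos_if_multiplier_bound[of a "norm a"]) (auto intro: sa_square_sa)

text \<open>Since \<open>a\<close> is its own positive part, \<open>h(a)\<close> does not change
  when \<open>h\<close> is precomposed with \<open>max 0\<close>. This replaces the nonnegativity of
  the spectrum.\<close>

lemma fun_calc_cong_pos:
  fixes a :: "'a::cstar_algebra"
  assumes a: "sa_square a" and f: "null_continuous f" and g: "null_continuous g" and "\<And>t. 0 \<le> t \<Longrightarrow> f t = g t"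
  shows "fun_calc f a = fun_calc g a"
proof -
  have sa: "adj a = a" using a by (rule sa_square_sa)
  have "fun_calc h a = fun_calc (\<lambda>t. h (max 0 t)) a" if "null_continuous h" for h
    using fun_calc_comp[OF sa that null_continuous_pos] by (simp add: fun_calc_pos[OF a])
  from this[OF f] this[OF g] assms(4) show ?thesis by simp
qed

lemma sa_square_fun_calc:
  fixes a :: "'a::cstar_algebra"
  assumes sa: "adj a = a" and f: "null_continuous f" and pos: "\<And>t. \<bar>t\<bar> \<le> norm a \<Longrightarrow> 0 \<le> f t"
  shows "sa_square (fun_calc f a)"
proof -
  define s where "s = (\<lambda>t. sqrt (max 0 (f t)))"
  have s: "null_continuous s" using f by (auto simp: null_continuous_def s_def intro!: continuous_intros)
  have "fun_calc s a * fun_calc s a = fun_calc (\<lambda>t. s t * s t) a"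
    by (rule fun_calc_mult[OF sa s s, symmetric])
  also have "\<dots> = fun_calc f a"
    by (rule fun_calc_cong[OF sa null_continuous_mult[OF s s] f]) (simp add: s_def pos)
  finally show ?thesis
    unfolding sa_square_def using adj_fun_calc[OF sa s] by metis
qed

lemma sa_pos_neg_decomposition:
  fixes x :: "'a::cstar_algebra"
  assumes sa: "adj x = x"
  obtains u v where "sa_square u" "sa_square v" "x = u - v" "norm u \<le> norm x" "norm v \<le> norm x"
proof
  note n = null_continuous_pos null_continuous_neg
  show "x = fun_calc (\<lambda>t. max 0 t) x - fun_calc (\<lambda>t. max 0 (- t)) x" by (simp add: fun_calc_pos_neg sa)
  show "sa_square (fun_calc (\<lambda>t. max 0 t) x)" "sa_square (fun_calc (\<lambda>t. max 0 (- t)) x)"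
    by (rule sa_square_fun_calc[OF sa n(1)] sa_square_fun_calc[OF sa n(2)]; simp)+
  show "norm (fun_calc (\<lambda>t. max 0 t) x) \<le> norm x" "norm (fun_calc (\<lambda>t. max 0 (- t)) x) \<le> norm x"
    by (rule norm_fun_calc_le[OF sa n(1)] norm_fun_calc_le[OF sa n(2)]; simp)+
qed

lemma sa_square_if_multiplier_bound:
  fixes a :: "'a::cstar_algebra"
  assumes "adj a = a" "0 \<le> R" "\<And>z. norm (R *\<^sub>R z - a * z) \<le> R * norm z"
  shows "sa_square a"
  using fun_calc_pos_if_multiplier_bound[OF assms] sa_square_fun_calc[OF assms(1) null_continuous_pos]
  by simp

lemma sa_square_add:
  fixes a b :: "'a::cstar_algebra"
  assumes a: "sa_square a" and b: "sa_square b"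
  shows "sa_square (a + b)"
proof (rule sa_square_if_multiplier_bound)
  show "adj (a + b) = a + b" using a b by (simp add: adj_add sa_square_sa)
  show "norm ((norm a + norm b) *\<^sub>R z - (a + b) * z) \<le> (norm a + norm b) * norm z" for z
  proof -
    have "(norm a + norm b) *\<^sub>R z - (a + b) * z = (norm a *\<^sub>R z - a * z) + (norm b *\<^sub>R z - b * z)"
      by (simp add: algebra_simps)
    then show ?thesis
      using norm_triangle_le[OF add_mono[OF sa_square_multiplier_bound[OF a order_refl] sa_square_multiplier_bound[OF b order_refl]], of z z]
      by (simp add: algebra_simps)
  qed
qed simp

lemma sa_square_scaleR: "sa_square a \<Longrightarrow> 0 \<le> r \<Longrightarrow> sa_square (r *\<^sub>R a)"
  unfolding sa_square_def by (metis adj_scaleR mult_scaleR_left mult_scaleR_right real_sqrt_mult_self abs_of_nonneg scaleR_scaleR)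

lemma fun_calc_pos_uminus_eq_0:
  assumes "sa_square (c::'a::cstar_algebra)"
  shows "fun_calc (\<lambda>t. max 0 t) (- c) = 0"
proof -
  have sa: "adj c = c" using assms by (rule sa_square_sa)
  have z: "null_continuous (\<lambda>t. 0)" by (simp add: null_continuous_def)
  have "fun_calc (\<lambda>t. max 0 (- t)) c = fun_calc (\<lambda>t. 0) c"
    by (rule fun_calc_cong_pos[OF assms null_continuous_comp[OF null_continuous_pos null_continuous_uminus] z]) simp
  also have "\<dots> = 0" by (rule fun_calc_zero[OF sa])
  finally show ?thesis by (simp add: fun_calc_minus_arg sa null_continuous_pos)
qed

text \<open>Kaplansky's argument: with \<open>y = x b\<^sub>-\<close>, where \<open>b = x\<^sup>* x\<close>, both \<open>- y\<^sup>* y\<close> and \<open>y y\<^sup>*\<close> are positive,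
  and \<open>y\<close> intertwines \<open>y\<^sup>* y\<close> with \<open>y y\<^sup>*\<close>; so \<open>y = 0\<close>.\<close>

lemma sa_square_adj_mult:
  fixes x :: "'a::cstar_algebra"
  shows "sa_square (adj x * x)"
proof -
  define b where "b = adj x * x"
  have sb: "adj b = b" by (simp add: b_def adj_mult)
  define n where "n = (\<lambda>t::real. max 0 (- t))"
  have nn: "null_continuous n"
    unfolding n_def by (rule null_continuous_neg)
  define m where "m = fun_calc n b"
  have sm: "adj m = m" unfolding m_def by (rule adj_fun_calc[OF sb nn])
  define y where "y = x * m"
  have n2: "null_continuous (\<lambda>t. n t * n t)" "null_continuous (\<lambda>t. n t * n t * n t)"
    by (intro null_continuous_mult nn)+
  define c where "c = m * m * m"
  have c: "c = fun_calc (\<lambda>t. n t * n t * n t) b"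
    by (simp only: c_def m_def fun_calc_mult[OF sb n2(1) nn] fun_calc_mult[OF sb nn nn])
  have cs: "sa_square c" unfolding c by (rule sa_square_fun_calc[OF sb n2(2)]) (simp add: n_def)
  have sc: "adj c = c" using cs by (rule sa_square_sa)
  have bm: "b * m = - (m * m)"
  proof -
    have "b * m = fun_calc (\<lambda>t. t * n t) b"
      by (simp only: m_def fun_calc_mult[OF sb null_continuous_id nn] fun_calc_id[OF sb])
    also have "(\<lambda>t. t * n t) = (\<lambda>t. (-1) * (n t * n t))" by (auto simp: n_def max_def)
    also have "fun_calc \<dots> b = (-1) *\<^sub>R (m * m)"
      by (simp only: m_def fun_calc_scale[OF sb n2(1)] fun_calc_mult[OF sb nn nn])
    finally show ?thesis by simp
  qed
  have yy: "adj y * y = - c"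
  proof -
    have "adj y * y = m * (b * m)" by (simp add: y_def adj_mult sm b_def mult.assoc)
    then show ?thesis by (simp add: bm c_def mult.assoc)
  qed
  define d where "d = y * adj y"
  have sd: "adj d = d" by (simp add: d_def adj_mult)
  \<comment> \<open>The real and imaginary parts of \<open>y\<close> satisfy
    \<open>adj y * y + y * adj y = 2 (h^2 + k^2)\<close>. As \<open>adj y * y = - c\<close>, this
    writes \<open>d\<close> as a sum of positive elements.\<close>
  define h where "h = (1/2) *\<^sub>R (y + adj y)"
  define k where "k = (1/2) *\<^sub>R (\<i> *\<^sub>C (adj y - y))"
  have hk: "adj h = h" "adj k = k"
    by (simp_all add: h_def k_def adj_add adj_diff adj_scaleC add.commute scaleC_minus_left flip: scaleC_minus_right)
  have "d = 2 *\<^sub>R (h * h) + 2 *\<^sub>R (k * k) + c"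
  proof -
    have hh: "4 *\<^sub>R (h * h) = (y + adj y) * (y + adj y)" by (simp add: h_def)
    have kk: "4 *\<^sub>R (k * k) = - ((adj y - y) * (adj y - y))"
      by (simp add: k_def mult_scaleC_left mult_scaleC_right scaleC_scaleR)
    have "2 *\<^sub>R (2 *\<^sub>R (h * h) + 2 *\<^sub>R (k * k)) = 4 *\<^sub>R (h * h) + 4 *\<^sub>R (k * k)"
      by (simp add: scaleR_add_right)
    also have "\<dots> = 2 *\<^sub>R (d + adj y * y)"
      unfolding hh kk by (simp add: d_def algebra_simps scaleR_2)
    finally have "2 *\<^sub>R (h * h) + 2 *\<^sub>R (k * k) = d + adj y * y"
      by (metis scaleR_cancel_left zero_neq_numeral)
    then show ?thesis by (simp add: yy)
  qed
  moreover have "sa_square (2 *\<^sub>R (h * h) + 2 *\<^sub>R (k * k) + c)"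
    by (intro sa_square_add sa_square_scaleR cs) (use hk in \<open>auto simp: sa_square_def\<close>)
  ultimately have ds: "sa_square d" by simp
  have "y * (- c) = d * y" by (simp add: d_def mult.assoc yy)
  then have "y * fun_calc (\<lambda>t. max 0 t) (- c) = fun_calc (\<lambda>t. max 0 t) d * y"
    by (intro fun_calc_intertwine) (simp_all add: sc sd null_continuous_pos)
  then have "d * y = 0" by (simp add: fun_calc_pos_uminus_eq_0[OF cs] fun_calc_pos[OF ds])
  then have "d * d = 0" by (metis d_def mult.assoc mult_zero_left)
  then have "d = 0" using norm_sa_square[OF sd] by simp
  then have "y = 0" using norm_mult_adj[of y] by (simp add: d_def)
  then have "m * m * m = 0" using yy by (simp add: c_def)
  then have "(m * m) * (m * m) = 0" by (metis mult.assoc mult_zero_left)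
  then have "m * m = 0" using norm_sa_square[of "m * m"] sm by (simp add: adj_mult)
  then have "m = 0" using norm_sa_square[OF sm] by simp
  then have "b = fun_calc (\<lambda>t. max 0 t) b" using fun_calc_pos_neg[OF sb] by (simp add: m_def n_def)
  moreover have "sa_square (fun_calc (\<lambda>t. max 0 t) b)"
    by (rule sa_square_fun_calc[OF sb null_continuous_pos]) simp
  ultimately show ?thesis by (simp add: b_def)
qed

lemma positive_iff: "a \<in> positive_elements \<longleftrightarrow> sa_square a"
  unfolding positive_elements_def using sa_square_adj_mult[of] by (auto simp: sa_square_def) metis

text \<open>With \<open>Q = norm (x - y)\<close>, write \<open>Q + y = (Q - (x - y)) + x\<close>:
  positivity of \<open>x - y\<close> bounds the first term by \<open>Q\<close>, so the multiplier
  norm is at most \<open>Q + norm x\<close>. The same holds for \<open>- y\<close>, with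
  \<open>x + y\<close> in place of \<open>x - y\<close>.\<close>

lemma norm_le_if_between:
  fixes x y :: "'a::cstar_algebra"
  assumes "sa_square (x - y)" "sa_square (x + y)"
  shows "norm y \<le> norm x"
proof (rule norm_le_if_multiplier_bounds[where Q="norm (x - y)" and Q'="norm (x + y)"])
  have "adj (x - y) = x - y" "adj (x + y) = x + y" using assms by (auto intro: sa_square_sa)
  then have "adj ((x + y) - (x - y)) = (x + y) - (x - y)" by (simp only: adj_diff)
  then have "2 *\<^sub>R adj y = 2 *\<^sub>R y" by (simp add: scaleR_2 adj_add)
  then show "adj y = y" by simp
  show "norm (norm (x - y) *\<^sub>R z + y * z) \<le> (norm (x - y) + norm x) * norm z" for z
  proof -
    have "norm (norm (x - y) *\<^sub>R z + y * z) = norm ((norm (x - y) *\<^sub>R z - (x - y) * z) + x * z)"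
      by (simp add: algebra_simps)
    also have "\<dots> \<le> norm (x - y) * norm z + norm x * norm z"
      by (intro norm_triangle_le add_mono sa_square_multiplier_bound assms norm_mult_ineq order_refl)
    finally show ?thesis by (simp add: algebra_simps)
  qed
  show "norm (norm (x + y) *\<^sub>R z - y * z) \<le> (norm (x + y) + norm x) * norm z" for z
  proof -
    have "norm (norm (x + y) *\<^sub>R z - y * z) = norm ((norm (x + y) *\<^sub>R z - (x + y) * z) + x * z)"
      by (simp add: algebra_simps)
    also have "\<dots> \<le> norm (x + y) * norm z + norm x * norm z"
      by (intro norm_triangle_le add_mono sa_square_multiplier_bound assms norm_mult_ineq order_refl)
    finally show ?thesis by (simp add: algebra_simps)
  qed
qed auto

section \<open>The Pedersen ideal\<close>

definition re_part :: "'a::cstar_algebra \<Rightarrow> 'a" where "re_part x = (1/2) *\<^sub>R (x + adj x)"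
definition im_part :: "'a::cstar_algebra \<Rightarrow> 'a" where "im_part x = re_part (- \<i> *\<^sub>C x)"

lemma adj_re_part [simp]: "adj (re_part x) = re_part x"
  by (simp add: re_part_def adj_add add.commute)

lemma adj_im_part [simp]: "adj (im_part x) = im_part x"
  by (simp add: im_part_def)

lemma re_im_part: "re_part x + \<i> *\<^sub>C im_part x = x"
proof -
  have "\<i> *\<^sub>C im_part x = (1/2) *\<^sub>R (x - adj x)"
    by (simp add: im_part_def re_part_def adj_scaleC scaleC_scaleR scaleC_add_right
        scaleC_minus_left scaleC_minus_right scaleC_diff_right)
  then have "re_part x + \<i> *\<^sub>C im_part x = (1/2) *\<^sub>R (2 *\<^sub>R x)"
    by (simp add: re_part_def scaleR_2 flip: scaleR_add_right)
  then show ?thesis by simp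
qed

lemma re_part_sa: "adj x = x \<Longrightarrow> re_part x = x"
  by (simp add: re_part_def flip: scaleR_2)

lemma norm_re_part_le: "norm (re_part x) \<le> norm (x::'a::cstar_algebra)"
  using norm_triangle_ineq[of x "adj x"] by (simp add: re_part_def)

lemma complex_subspaceD:
  assumes "complex_subspace S"
  shows "0 \<in> S" "x \<in> S \<Longrightarrow> y \<in> S \<Longrightarrow> x + y \<in> S" "x \<in> S \<Longrightarrow> c *\<^sub>C x \<in> S"
    "x \<in> S \<Longrightarrow> r *\<^sub>R x \<in> S" "x \<in> S \<Longrightarrow> - x \<in> S" "x \<in> S \<Longrightarrow> y \<in> S \<Longrightarrow> x - y \<in> S"
proof -
  show *: "0 \<in> S" "x \<in> S \<Longrightarrow> y \<in> S \<Longrightarrow> x + y \<in> S" "x \<in> S \<Longrightarrow> c *\<^sub>C x \<in> S" for x y c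
    using assms by (auto simp: complex_subspace_def)
  show r: "x \<in> S \<Longrightarrow> r *\<^sub>R x \<in> S" for x r using *(3)[of x "of_real r"] by (simp add: scaleC_of_real)
  show m: "x \<in> S \<Longrightarrow> - x \<in> S" for x using r[of x "-1"] by simp
  show "x \<in> S \<Longrightarrow> y \<in> S \<Longrightarrow> x - y \<in> S" using *(2)[of x "-y"] m[of y] by simp
qed

text \<open>If \<open>x \<in> J\<close> is within distance \<open>< 1\<close> of \<open>h\<close>, then \<open>f = f x (1 - u)\<^sup>-\<^sup>1\<close> for \<open>u = h - x\<close>.\<close>

lemma mem_dense_ideal_if_right_unit:
  fixes f h :: "'a::cstar_algebra"
  assumes J: "dense_ideal J" and fh: "f * h = f"
  shows "f \<in> J"
proof -
  have "h \<in> closure J" using J by (simp add: dense_ideal_def)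
  then obtain x where x: "x \<in> J" "dist x h < 1" by (metis closure_approachable zero_less_one)
  define u where "u = h - x"
  have u: "norm u < 1" using x by (simp add: u_def dist_norm norm_minus_commute)
  have "\<exists>!w. u + u * w = w"
  proof (rule banach_fix_type[OF norm_ge_zero u], intro allI)
    fix v w
    have "dist (u + u * v) (u + u * w) = norm (u * (v - w))" by (simp add: dist_norm algebra_simps)
    then show "dist (u + u * v) (u + u * w) \<le> norm u * dist v w"
      by (simp add: dist_norm norm_mult_ineq)
  qed
  then obtain w where w: "u + u * w = w" by blast
  have fx: "f * x = f - f * u" by (simp add: u_def algebra_simps fh)
  have "f * w = f * u + f * (u * w)" by (subst w[symmetric]) (simp only: distrib_left)
  then have "f = f * x + f * x * w" by (simp add: fx algebra_simps)
  moreover have "f * x + f * x * w \<in> J"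
    using J x(1) unfolding dense_ideal_def two_sided_ideal_def complex_subspace_def by blast
  ultimately show ?thesis by simp
qed

section \<open>Cutoffs, local units and the least dense ideal\<close>

text \<open>Soft thresholding: zero on \<open>[-d, d]\<close> and never farther than
  \<open>d\<close> from the identity. \<open>plateau d\<close> equals 1 wherever
  \<open>cutoff d\<close> is nonzero, so it supplies a local unit.\<close>

definition cutoff :: "real \<Rightarrow> real \<Rightarrow> real" where "cutoff d t = t - max (- d) (min d t)"

definition plateau :: "real \<Rightarrow> real \<Rightarrow> real" where "plateau d t = \<bar>t\<bar> / max \<bar>t\<bar> d"

lemma null_continuous_cutoff: "0 < d \<Longrightarrow> null_continuous (cutoff d)"
  unfolding null_continuous_def cutoff_def[abs_def] by (auto intro!: continuous_intros)

lemma null_continuous_plateau: "0 < d \<Longrightarrow> null_continuous (plateau d)"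
proof -
  assume d: "0 < d"
  then have "max \<bar>t\<bar> d \<noteq> 0" for t by (metis less_max_iff_disj less_irrefl)
  then show ?thesis
    unfolding null_continuous_def plateau_def[abs_def] by (auto intro!: continuous_intros)
qed

lemma plateau_eq_1: "0 < d \<Longrightarrow> d \<le> \<bar>t\<bar> \<Longrightarrow> plateau d t = 1"
  by (auto simp: plateau_def)

lemma fun_calc_absorb:
  fixes a :: "'a::cstar_algebra"
  assumes "adj a = a" "null_continuous f" "null_continuous g" "\<And>t. f t * g t = f t"
  shows "fun_calc f a * fun_calc g a = fun_calc f a" "fun_calc g a * fun_calc f a = fun_calc f a"
proof -
  have "(\<lambda>t. f t * g t) = f" "(\<lambda>t. g t * f t) = f" using assms(4) by (auto simp: mult.commute)
  then show "fun_calc f a * fun_calc g a = fun_calc f a" "fun_calc g a * fun_calc f a = fun_calc f a"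
    using fun_calc_mult[OF assms(1-3)] fun_calc_mult[OF assms(1,3,2)] by simp_all
qed

lemma cutoff_mult_plateau: "0 < d \<Longrightarrow> cutoff d t * plateau d t = cutoff d t"
  by (cases "d \<le> \<bar>t\<bar>") (auto simp: plateau_eq_1 cutoff_def)

lemma norm_fun_calc_cutoff_diff:
  assumes "adj a = a" "0 < d"
  shows "norm (fun_calc (cutoff d) a - a) \<le> d"
proof -
  have n: "null_continuous (cutoff d)" using assms by (simp add: null_continuous_cutoff)
  have "norm (fun_calc (\<lambda>t. cutoff d t - t) a) \<le> d"
    using assms by (intro norm_fun_calc_le null_continuous_diff n null_continuous_id) (auto simp: cutoff_def)
  then show ?thesis
    by (simp only: fun_calc_diff[OF assms(1) n null_continuous_id] fun_calc_id[OF assms(1)])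
qed

lemma closure_eq_UNIV_if_cutoffs:
  fixes J :: "'a::cstar_algebra set"
  assumes J: "complex_subspace J"
    and cut: "\<And>a d. adj a = a \<Longrightarrow> 0 < d \<Longrightarrow> fun_calc (cutoff d) a \<in> J"
  shows "closure J = UNIV"
proof -
  have "x \<in> closure J" for x
    unfolding closure_approachable
  proof (intro allI impI)
    fix e :: real assume e: "e > 0"
    define c where "c = (\<lambda>a::'a. fun_calc (cutoff (e/3)) a)"
    define y where "y = c (re_part x) + \<i> *\<^sub>C c (im_part x)"
    have "y \<in> J" using e by (simp add: y_def c_def cut complex_subspaceD[OF J])
    moreover have "y - x = (c (re_part x) - re_part x) + \<i> *\<^sub>C (c (im_part x) - im_part x)"
      by (subst (2) re_im_part[symmetric]) (simp add: y_def scaleC_diff_right)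
    moreover have ca: "norm (c a - a) \<le> e/3" if "adj a = a" for a
      unfolding c_def using that e by (intro norm_fun_calc_cutoff_diff) auto
    moreover have "norm ((c (re_part x) - re_part x) + \<i> *\<^sub>C (c (im_part x) - im_part x)) \<le> e/3 + e/3"
      using ca[OF adj_re_part] ca[OF adj_im_part]
      by (intro norm_triangle_le add_mono) (auto simp: norm_scaleC)
    ultimately show "\<exists>y\<in>J. dist y x < e" using e by (intro bexI[of _ y]) (auto simp: dist_norm)
  qed
  then show ?thesis by blast
qed

text \<open>Density is the point: each \<open>cutoff d\<close> of a self-adjoint element has a right
  unit, hence lies in every dense ideal, and such cutoffs approximate all real and imaginary
  parts.\<close>

lemma dense_ideal_Inter: "dense_ideal (\<Inter>{J::'a::cstar_algebra set. dense_ideal J})"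
proof -
  let ?P = "\<Inter>{J::'a set. dense_ideal J}"
  have id: "two_sided_ideal ?P"
    unfolding two_sided_ideal_def dense_ideal_def complex_subspace_def by simp
  moreover have "closure ?P = UNIV"
  proof (rule closure_eq_UNIV_if_cutoffs)
    show "complex_subspace ?P" using id by (simp add: two_sided_ideal_def)
    fix a :: 'a and d :: real assume a: "adj a = a" and d: "0 < d"
    have "fun_calc (cutoff d) a * fun_calc (plateau d) a = fun_calc (cutoff d) a"
      using a d by (intro fun_calc_absorb null_continuous_cutoff null_continuous_plateau cutoff_mult_plateau)
    then show "fun_calc (cutoff d) a \<in> ?P" by (auto intro: mem_dense_ideal_if_right_unit)
  qed
  ultimately show ?thesis by (simp add: dense_ideal_def)
qed

lemma pedersen_ideal_eq: "(pedersen_ideal :: 'a::cstar_algebra set) = \<Inter>{J. dense_ideal J}"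
  unfolding pedersen_ideal_def
proof (rule the_equality)
  have least: "\<Inter>{J. dense_ideal J} \<subseteq> J" if "dense_ideal J" for J :: "'a set"
    using that by (intro Inter_lower) simp
  show "dense_ideal (\<Inter>{J::'a set. dense_ideal J}) \<and>
      (\<forall>J. dense_ideal J \<and> J \<subseteq> \<Inter>{J::'a set. dense_ideal J} \<longrightarrow> J = \<Inter>{J. dense_ideal J})"
  proof (intro conjI allI impI dense_ideal_Inter)
    fix J :: "'a set" assume "dense_ideal J \<and> J \<subseteq> \<Inter>{J::'a set. dense_ideal J}"
    then show "J = \<Inter>{J. dense_ideal J}" using least[of J] by (intro subset_antisym) simp_all
  qed
  show "I = \<Inter>{J. dense_ideal J}" if "dense_ideal I \<and> (\<forall>J. dense_ideal J \<and> J \<subseteq> I \<longrightarrow> J = I)" for I :: "'a set"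
  proof -
    have "dense_ideal (\<Inter>{J::'a set. dense_ideal J}) \<and> \<Inter>{J. dense_ideal J} \<subseteq> I"
      by (rule conjI[OF dense_ideal_Inter least[OF conjunct1[OF that]]])
    from conjunct2[OF that, rule_format, OF this] show ?thesis by (rule sym)
  qed
qed

lemma dense_ideal_pedersen: "dense_ideal (pedersen_ideal :: 'a::cstar_algebra set)"
  unfolding pedersen_ideal_eq by (rule dense_ideal_Inter)

lemma pedersen_ideal_subset: "dense_ideal J \<Longrightarrow> pedersen_ideal \<subseteq> J"
  unfolding pedersen_ideal_eq by (rule Inter_lower) simp

lemma complex_subspace_pedersen: "complex_subspace (pedersen_ideal :: 'a::cstar_algebra set)"
  using dense_ideal_pedersen[where 'a='a] by (simp add: dense_ideal_def two_sided_ideal_def)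

lemmas pedersen_simps [simp] = complex_subspaceD[OF complex_subspace_pedersen]

lemma pedersen_mult_left [simp]: "(x::'a::cstar_algebra) \<in> pedersen_ideal \<Longrightarrow> a * x \<in> pedersen_ideal"
  and pedersen_mult_right [simp]: "x \<in> pedersen_ideal \<Longrightarrow> x * a \<in> pedersen_ideal"
  using dense_ideal_pedersen[where 'a='a] unfolding dense_ideal_def two_sided_ideal_def by blast+

lemma closure_pedersen: "closure (pedersen_ideal :: 'a::cstar_algebra set) = UNIV"
  using dense_ideal_pedersen[where 'a='a] by (simp add: dense_ideal_def)

text \<open>The involution maps dense ideals to dense ideals, so it preserves the least one.\<close>

lemma pedersen_adj [simp]: "x \<in> pedersen_ideal \<Longrightarrow> adj x \<in> pedersen_ideal"
proof -
  have iff: "x \<in> adj ` pedersen_ideal \<longleftrightarrow> adj x \<in> pedersen_ideal" for x :: 'a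
    by (metis adj_adj image_iff)
  have "two_sided_ideal (adj ` (pedersen_ideal :: 'a set))"
    unfolding two_sided_ideal_def complex_subspace_def iff by (simp add: adj_add adj_scaleC adj_mult)
  moreover have "closure (adj ` (pedersen_ideal :: 'a set)) = UNIV"
  proof -
    have "adj x \<in> closure (adj ` (pedersen_ideal :: 'a set))" for x :: 'a
    proof -
      have "adj ` closure pedersen_ideal \<subseteq> closure (adj ` (pedersen_ideal :: 'a set))"
        by (intro image_closure_subset continuous_on_adj continuous_on_id closed_closure closure_subset)
      then show ?thesis by (auto simp: closure_pedersen)
    qed
    then show ?thesis by (metis UNIV_eq_I adj_adj)
  qed
  ultimately have "dense_ideal (adj ` (pedersen_ideal :: 'a set))" by (simp add: dense_ideal_def)
  from pedersen_ideal_subset[OF this] show "x \<in> pedersen_ideal \<Longrightarrow> adj x \<in> pedersen_ideal" by auto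
qed

lemma pedersen_re_part [simp]: "x \<in> pedersen_ideal \<Longrightarrow> re_part x \<in> pedersen_ideal"
  and pedersen_im_part [simp]: "x \<in> pedersen_ideal \<Longrightarrow> im_part x \<in> pedersen_ideal"
  by (simp_all add: re_part_def im_part_def)

lemma mem_pedersen_if_right_unit: "f * h = f \<Longrightarrow> f \<in> pedersen_ideal"
  by (rule mem_dense_ideal_if_right_unit[OF dense_ideal_pedersen])

section \<open>Corners, trace-null elements and absorption by neighbourhoods of zero\<close>

text \<open>For self-adjoint \<open>h\<close> this is a C*-subalgebra, and it lies in the Pedersen
  ideal even if \<open>h\<close> does not. These corners are the test subalgebras on which
  neighbourhoods of zero are exploited.\<close>

definition unit_corner :: "'a::cstar_algebra \<Rightarrow> 'a set" where
  "unit_corner h = {y. y * h = y \<and> h * y = y}"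

lemma cstar_subalgebra_unit_corner:
  assumes "adj h = h"
  shows "cstar_subalgebra (unit_corner h)"
  unfolding cstar_subalgebra_def complex_subspace_def
proof (intro conjI ballI allI)
  show "closed (unit_corner h)"
    unfolding unit_corner_def by (intro closed_Collect_conj closed_Collect_eq continuous_intros)
  show "adj x \<in> unit_corner h" if "x \<in> unit_corner h" for x
    using that assms unfolding unit_corner_def by (metis (mono_tags, lifting) adj_mult mem_Collect_eq)
  show "x * y \<in> unit_corner h" if "x \<in> unit_corner h" "y \<in> unit_corner h" for x y
    using that by (simp add: unit_corner_def mult.assoc) (metis mult.assoc)
qed (auto simp: unit_corner_def algebra_simps mult_scaleC_left mult_scaleC_right)

lemma unit_corner_subset_pedersen: "unit_corner h \<subseteq> pedersen_ideal"
  by (auto simp: unit_corner_def intro: mem_pedersen_if_right_unit)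

lemma pedersen_nbhd_0:
  assumes "pedersen_nbhd (U :: 'a::cstar_algebra set)"
  shows "0 \<in> U"
proof -
  have "cstar_subalgebra {0::'a}" "{0::'a} \<subseteq> pedersen_ideal"
    by (auto simp: cstar_subalgebra_def complex_subspace_def)
  then obtain r where "r > 0" "ball 0 r \<inter> {0} \<subseteq> U" using assms unfolding pedersen_nbhd_def by meson
  then show ?thesis by auto
qed

definition trace_null :: "'a::cstar_algebra set" where
  "trace_null = {x \<in> pedersen_ideal. \<forall>\<tau>. pedersen_trace \<tau> \<longrightarrow> \<tau> x = 0}"

text \<open>A substitute for the fact that the Pedersen ideal is the union of the C*-subalgebras it contains:
  modulo elements on which all traces vanish, each of its elements is absorbed by every neighbourhood
  of zero.\<close>

definition absorbed :: "'a::cstar_algebra \<Rightarrow> bool" where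
  "absorbed x \<longleftrightarrow> (\<exists>y n. x = y + n \<and> y \<in> pedersen_ideal \<and> n \<in> trace_null \<and>
     (\<forall>U. pedersen_nbhd U \<longrightarrow> (\<exists>t>0. t *\<^sub>R y \<in> U)))"

lemma trace_null_add: "(m::'a::cstar_algebra) \<in> trace_null \<Longrightarrow> n \<in> trace_null \<Longrightarrow> m + n \<in> trace_null"
  and trace_null_scaleC: "m \<in> trace_null \<Longrightarrow> c *\<^sub>C m \<in> trace_null"
  and trace_null_0: "0 \<in> (trace_null :: 'a set)"
proof -
  show "m \<in> trace_null \<Longrightarrow> n \<in> trace_null \<Longrightarrow> m + n \<in> trace_null"
    by (auto simp: trace_null_def pedersen_trace_def)
  show *: "m \<in> trace_null \<Longrightarrow> c *\<^sub>C m \<in> trace_null" for m c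
    by (auto simp: trace_null_def pedersen_trace_def)
  have "\<tau> 0 = 0" if "pedersen_trace \<tau>" for \<tau> :: "'a \<Rightarrow> complex"
    using that unfolding pedersen_trace_def by (metis pedersen_simps(1) add_cancel_right_left)
  then show "0 \<in> (trace_null :: 'a set)" by (auto simp: trace_null_def)
qed

lemma commutator_trace_null:
  assumes "p \<in> pedersen_ideal" "q \<in> pedersen_ideal"
  shows "p * q - q * p \<in> trace_null"
proof -
  have "\<tau> (p * q - q * p) = 0" if "pedersen_trace \<tau>" for \<tau>
  proof -
    have "p * q - q * p + q * p = p * q" by simp
    then have "\<tau> (p * q - q * p) + \<tau> (q * p) = \<tau> (p * q)"
      using that assms unfolding pedersen_trace_def
      by (metis pedersen_mult_left pedersen_simps(6))
    then show ?thesis using that assms by (simp add: pedersen_trace_def)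
  qed
  then show ?thesis using assms by (simp add: trace_null_def)
qed

lemma absorbed_add:
  assumes "absorbed x" "absorbed y"
  shows "absorbed (x + y)"
proof -
  obtain x' m where x: "x = x' + m" "x' \<in> pedersen_ideal" "m \<in> trace_null"
    "\<And>U. pedersen_nbhd U \<Longrightarrow> \<exists>t>0. t *\<^sub>R x' \<in> U" using assms(1) unfolding absorbed_def by metis
  obtain y' n where y: "y = y' + n" "y' \<in> pedersen_ideal" "n \<in> trace_null"
    "\<And>U. pedersen_nbhd U \<Longrightarrow> \<exists>t>0. t *\<^sub>R y' \<in> U" using assms(2) unfolding absorbed_def by metis
  have "\<exists>t>0. t *\<^sub>R (x' + y') \<in> U" if U: "pedersen_nbhd U" for U
  proof -
    obtain s t where st: "s > 0" "s *\<^sub>R x' \<in> U" "t > 0" "t *\<^sub>R y' \<in> U" using x(4)[OF U] y(4)[OF U] by blast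
    have "convex U" using U by (simp add: pedersen_nbhd_def)
    \<comment> \<open>The weights turn both multiples into the common factor
      \<open>s * t / (s + t)\<close>.\<close>
    then have "(t / (s + t)) *\<^sub>R (s *\<^sub>R x') + (s / (s + t)) *\<^sub>R (t *\<^sub>R y') \<in> U"
      using st by (intro convexD) (auto simp flip: add_divide_distrib)
    then show ?thesis using st
      by (intro exI[of _ "s * t / (s + t)"]) (auto simp: scaleR_add_right mult.commute)
  qed
  then show ?thesis
    unfolding absorbed_def using x y
    by (intro exI[of _ "x' + y'"] exI[of _ "m + n"]) (auto simp: trace_null_add)
qed

lemma absorbed_scaleC:
  assumes "absorbed x"
  shows "absorbed (c *\<^sub>C x)"
proof -
  obtain x' m where x: "x = x' + m" "x' \<in> pedersen_ideal" "m \<in> trace_null"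
    "\<And>U. pedersen_nbhd U \<Longrightarrow> \<exists>t>0. t *\<^sub>R x' \<in> U" using assms(1) unfolding absorbed_def by metis
  have "\<exists>t>0. t *\<^sub>R c *\<^sub>C x' \<in> U" if U: "pedersen_nbhd U" for U
  proof (cases "c = 0")
    case True
    then show ?thesis using pedersen_nbhd_0[OF U] by (auto intro: exI[of _ 1])
  next
    case False
    obtain t where t: "t > 0" "t *\<^sub>R x' \<in> U" using x(4)[OF U] by blast
    then have "(c / of_real (cmod c)) *\<^sub>C (t *\<^sub>R x') \<in> U"
      using U False by (auto simp: pedersen_nbhd_def norm_divide)
    moreover have "(c / of_real (cmod c)) *\<^sub>C (t *\<^sub>R x') = (t / cmod c) *\<^sub>R c *\<^sub>C x'"
      by (simp add: scaleR_scaleC scaleC_scaleR field_simps)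
    ultimately show ?thesis using t False by (intro exI[of _ "t / cmod c"]) auto
  qed
  then show ?thesis
    unfolding absorbed_def using x
    by (intro exI[of _ "c *\<^sub>C x'"] exI[of _ "c *\<^sub>C m"]) (auto simp: trace_null_scaleC scaleC_add_right)
qed

lemma absorbed_unit_corner:
  assumes "adj h = h" "y \<in> unit_corner h"
  shows "absorbed (y :: 'a::cstar_algebra)"
proof -
  have "\<exists>t>0. t *\<^sub>R y \<in> U" if U: "pedersen_nbhd U" for U
  proof -
    obtain r where r: "r > 0" "ball 0 r \<inter> unit_corner h \<subseteq> U"
      using U cstar_subalgebra_unit_corner[OF assms(1)] unit_corner_subset_pedersen[of h]
      unfolding pedersen_nbhd_def by meson
    define t where "t = r / (norm y + 1)"
    have t: "t > 0" using r by (simp add: t_def add_nonneg_pos)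
    have "norm (t *\<^sub>R y) < r"
    proof -
      have "norm (t *\<^sub>R y) = r * (norm y / (norm y + 1))" using r by (simp add: t_def)
      also have "\<dots> < r * 1" using r by (intro mult_strict_left_mono) (auto simp: add_nonneg_pos)
      finally show ?thesis by simp
    qed
    moreover have "t *\<^sub>R y \<in> unit_corner h" using assms by (simp add: unit_corner_def)
    ultimately have "t *\<^sub>R y \<in> ball 0 r \<inter> unit_corner h" by simp
    then show ?thesis using r(2) t by blast
  qed
  then show ?thesis
    unfolding absorbed_def using assms(2) unit_corner_subset_pedersen[of h]
    by (intro exI[of _ y] exI[of _ 0]) (auto simp: trace_null_0)
qed

text \<open>The two products differ by a commutator, which is moved into the trace-null
  summand.\<close>

lemma absorbed_swap:
  assumes "p \<in> pedersen_ideal" "q \<in> pedersen_ideal" "absorbed (q * p)"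
  shows "absorbed (p * q)"
proof -
  obtain y n where y: "q * p = y + n" "y \<in> pedersen_ideal" "n \<in> trace_null"
    "\<And>U. pedersen_nbhd U \<Longrightarrow> \<exists>t>0. t *\<^sub>R y \<in> U" using assms(3) unfolding absorbed_def by metis
  have "p * q = y + (n + (p * q - q * p))" using y(1) by (simp add: algebra_simps)
  then show ?thesis
    unfolding absorbed_def using y trace_null_add[OF y(3) commutator_trace_null[OF assms(1,2)]] by blast
qed

text \<open>The elements all of whose multiples are absorbed form a two-sided ideal. It contains
  every \<open>cutoff d\<close> of a self-adjoint element, hence is dense and includes the Pedersen
  ideal. For the products of a cutoff a local unit is inserted, and the factors are rotated until
  they lie in a corner.\<close>

lemma absorbed_pedersen:
  assumes "x \<in> pedersen_ideal"
  shows "absorbed (x :: 'a::cstar_algebra)"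
proof -
  \<comment> \<open>Four separate conditions, since without a unit \<open>b * x * c\<close> does not
    specialise to the other products.\<close>
  define Q where "Q = {x::'a. absorbed x \<and> (\<forall>b. absorbed (b * x)) \<and> (\<forall>c. absorbed (x * c)) \<and>
     (\<forall>b c. absorbed (b * x * c))}"
  have 0: "absorbed (0::'a)"
    using absorbed_unit_corner[of "0::'a" 0] by (simp add: unit_corner_def)
  have sub: "complex_subspace Q"
    unfolding complex_subspace_def Q_def
    by (auto simp: 0 distrib_left distrib_right mult_scaleC_left mult_scaleC_right intro: absorbed_add absorbed_scaleC)
  have "two_sided_ideal Q"
    unfolding two_sided_ideal_def
  proof (intro conjI ballI allI sub)
    fix x a assume x: "x \<in> Q"
    have "absorbed (b * (a * x))" "absorbed (b * (a * x) * c)" "absorbed (x * a * c)" "absorbed (b * (x * a) * c)" for b c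
      using x unfolding Q_def by (metis (mono_tags, lifting) mem_Collect_eq mult.assoc)+
    then show "a * x \<in> Q" "x * a \<in> Q" using x by (auto simp: Q_def mult.assoc)
  qed
  moreover have "closure Q = UNIV"
  proof (rule closure_eq_UNIV_if_cutoffs[OF sub])
    fix a :: 'a and d :: real assume a: "adj a = a" and d: "0 < d"
    define y where "y = fun_calc (cutoff d) a"
    \<comment> \<open>Nested local units: \<open>cutoff d\<close> lives on
      \<open>\<bar>t\<bar> > d\<close>, the function of \<open>h\<close> is 1 there and vanishes for
      \<open>\<bar>t\<bar> \<le> d/2\<close>, and the function of \<open>k\<close> is 1 beyond that.
      So \<open>h\<close> has the unit \<open>k\<close> and itself lies in the Pedersen ideal, as
      the exchange of factors demands.\<close>
    define h where "h = fun_calc (\<lambda>t. plateau (d/2) (cutoff (d/2) t)) a"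
    define k where "k = fun_calc (plateau (d/2)) a"
    have n: "null_continuous (cutoff d)" "null_continuous (plateau (d/2))"
      "null_continuous (\<lambda>t. plateau (d/2) (cutoff (d/2) t))"
      using d by (auto intro: null_continuous_cutoff null_continuous_plateau
          null_continuous_comp[OF null_continuous_plateau null_continuous_cutoff])
    have E1: "cutoff d t * plateau (d/2) (cutoff (d/2) t) = cutoff d t" for t
    proof (cases "d \<le> \<bar>t\<bar>")
      case True
      then have "d/2 \<le> \<bar>cutoff (d/2) t\<bar>" using d unfolding cutoff_def by linarith
      then show ?thesis using d by (simp add: plateau_eq_1)
    qed (auto simp: cutoff_def)
    have yh: "y * h = y" "h * y = y"
      unfolding y_def h_def by (rule fun_calc_absorb[OF a n(1,3) E1])+
    have E2: "plateau (d/2) (cutoff (d/2) t) * plateau (d/2) t = plateau (d/2) (cutoff (d/2) t)" for t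
    proof (cases "d/2 \<le> \<bar>t\<bar>")
      case False
      then have "cutoff (d/2) t = 0" by (auto simp: cutoff_def)
      then show ?thesis by (simp add: plateau_def)
    qed (use d in \<open>simp add: plateau_eq_1\<close>)
    have hk: "h * k = h" "k * h = h"
      unfolding h_def k_def by (rule fun_calc_absorb[OF a n(3,2) E2])+
    have k: "adj k = k" unfolding k_def by (rule adj_fun_calc[OF a n(2)])
    have y: "y \<in> pedersen_ideal" using yh(1) by (rule mem_pedersen_if_right_unit)
    have h: "h \<in> pedersen_ideal" using hk(1) by (rule mem_pedersen_if_right_unit)
    have yk: "y * k = y" "k * y = y" using yh hk by (metis mult.assoc)+
    have ky: "k * (y * z) = y * z" "k * (h * z) = h * z" for z
      using yk hk by (metis mult.assoc)+
    have "absorbed y"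
      by (rule absorbed_unit_corner[OF k]) (simp add: unit_corner_def yk)
    moreover have "absorbed (b * y)" for b
    proof -
      have "absorbed (h * (b * y))"
        by (rule absorbed_unit_corner[OF k]) (simp add: unit_corner_def ky mult.assoc yk)
      then have "absorbed (b * y * h)" by (rule absorbed_swap[OF pedersen_mult_left[OF y] h])
      then show ?thesis by (simp add: mult.assoc yh)
    qed
    moreover have "absorbed (y * c)" for c
    proof -
      have "absorbed (y * c * h)"
        by (rule absorbed_unit_corner[OF k]) (simp add: unit_corner_def ky mult.assoc hk)
      then have "absorbed (h * (y * c))" by (rule absorbed_swap[OF h pedersen_mult_right[OF y]])
      then show ?thesis using yh(2) by (metis mult.assoc)
    qed
    moreover have "absorbed (b * y * c)" for b c
    proof -
      \<comment> \<open>The rotated product begins with \<open>h\<close> and ends with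
        \<open>y\<close>, so \<open>k\<close> is a unit on both sides.\<close>
      have "absorbed (h * c * (b * y))"
        by (rule absorbed_unit_corner[OF k]) (simp add: unit_corner_def ky mult.assoc yk)
      then have "absorbed (b * y * (h * c))"
        by (rule absorbed_swap[OF pedersen_mult_left[OF y] pedersen_mult_right[OF h]])
      moreover have "b * y * (h * c) = b * y * c" by (metis mult.assoc yh(1))
      ultimately show ?thesis by simp
    qed
    ultimately show "fun_calc (cutoff d) a \<in> Q" unfolding y_def[symmetric] Q_def by blast
  qed
  ultimately have "dense_ideal Q" by (simp add: dense_ideal_def)
  from pedersen_ideal_subset[OF this] assms show ?thesis by (auto simp: Q_def)
qed

section \<open>The Hahn--Banach theorem\<close>

definition sublinear :: "('a::real_vector \<Rightarrow> real) \<Rightarrow> bool" where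
  "sublinear p \<longleftrightarrow> p 0 = 0 \<and> (\<forall>x y. p (x + y) \<le> p x + p y) \<and> (\<forall>c>0. \<forall>x. p (c *\<^sub>R x) \<le> c * p x)"

lemma sublinear_add: "sublinear p \<Longrightarrow> p (x + y) \<le> p x + p y"
  by (simp add: sublinear_def)

lemma sublinear_scale:
  assumes "sublinear p" "0 \<le> c"
  shows "p (c *\<^sub>R x) = c * p x"
proof (cases "c = 0")
  case False
  then have c: "c > 0" using assms by simp
  have "p (c *\<^sub>R x) \<le> c * p x" using assms c by (simp add: sublinear_def)
  moreover have "p ((1/c) *\<^sub>R (c *\<^sub>R x)) \<le> (1/c) * p (c *\<^sub>R x)"
    using assms c unfolding sublinear_def by (metis zero_less_divide_1_iff)
  ultimately show ?thesis using c by (simp add: field_simps)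
qed (use assms in \<open>simp add: sublinear_def\<close>)

lemma sublinear_minus: "sublinear p \<Longrightarrow> - p (- x) \<le> p x"
  using sublinear_add[of p x "- x"] by (simp add: sublinear_def)

text \<open>The standard device of lowering \<open>p\<close> along the direction \<open>a\<close>:
  at \<open>- a\<close> the new functional is at most \<open>- p a\<close>, which forces every
  linear functional below it to take the value \<open>p a\<close> at \<open>a\<close>.\<close>

definition sublinear_pull :: "'a \<Rightarrow> ('a::real_vector \<Rightarrow> real) \<Rightarrow> 'a \<Rightarrow> real" where
  "sublinear_pull a p x = (INF t\<in>{0..}. p (x + t *\<^sub>R a) - t * p a)"

lemma sublinear_pull_bound:
  assumes "sublinear p" "0 \<le> t"
  shows "- p (- x) \<le> p (x + t *\<^sub>R a) - t * p a"
  using sublinear_add[OF assms(1), of "x + t *\<^sub>R a" "- x"] sublinear_scale[OF assms, of a] by simp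

lemma sublinear_pull_le:
  assumes "sublinear p" "0 \<le> t"
  shows "sublinear_pull a p x \<le> p (x + t *\<^sub>R a) - t * p a"
  unfolding sublinear_pull_def
  by (rule cINF_lower) (use assms sublinear_pull_bound[OF assms(1)] in \<open>auto intro!: bdd_belowI2\<close>)

lemma le_sublinear_pull:
  assumes "\<And>t. 0 \<le> t \<Longrightarrow> u \<le> p (x + t *\<^sub>R a) - t * p a"
  shows "u \<le> sublinear_pull a p x"
  unfolding sublinear_pull_def by (rule cINF_greatest) (use assms in auto)

lemma sublinear_pull:
  assumes p: "sublinear p"
  shows "sublinear (sublinear_pull a p)" "sublinear_pull a p x \<le> p x" "sublinear_pull a p (- a) \<le> - p a"
proof -
  let ?q = "sublinear_pull a p"
  show "?q x \<le> p x" using sublinear_pull_le[OF p, of 0 a x] by simp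
  show "?q (- a) \<le> - p a"
    using sublinear_pull_le[OF p, of 1 a "- a"] p by (simp add: sublinear_def)
  have "?q (x + y) \<le> ?q x + ?q y" for x y
  proof -
    have *: "?q (x + y) \<le> (p (x + s *\<^sub>R a) - s * p a) + (p (y + t *\<^sub>R a) - t * p a)"
      if "0 \<le> s" "0 \<le> t" for s t
    proof -
      have "?q (x + y) \<le> p (x + y + (s + t) *\<^sub>R a) - (s + t) * p a"
        using that by (intro sublinear_pull_le[OF p]) auto
      also have "x + y + (s + t) *\<^sub>R a = (x + s *\<^sub>R a) + (y + t *\<^sub>R a)" by (simp add: algebra_simps)
      finally show ?thesis using sublinear_add[OF p, of "x + s *\<^sub>R a" "y + t *\<^sub>R a"] by (simp add: algebra_simps)
    qed
    have **: "?q (x + y) - (p (x + s *\<^sub>R a) - s * p a) \<le> ?q y" if "0 \<le> s" for s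
    proof (rule le_sublinear_pull)
      fix t :: real assume "0 \<le> t"
      from *[OF that this] show "?q (x + y) - (p (x + s *\<^sub>R a) - s * p a) \<le> p (y + t *\<^sub>R a) - t * p a"
        by linarith
    qed
    have "?q (x + y) - ?q y \<le> ?q x"
    proof (rule le_sublinear_pull)
      fix s :: real assume "0 \<le> s"
      from **[OF this] show "?q (x + y) - ?q y \<le> p (x + s *\<^sub>R a) - s * p a" by linarith
    qed
    then show ?thesis by simp
  qed
  moreover have "?q (c *\<^sub>R x) \<le> c * ?q x" if c: "c > 0" for c x
  proof -
    have "?q (c *\<^sub>R x) / c \<le> p (x + t *\<^sub>R a) - t * p a" if "0 \<le> t" for t
    proof -
      have "?q (c *\<^sub>R x) \<le> p (c *\<^sub>R x + (c * t) *\<^sub>R a) - (c * t) * p a"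
        using that c by (intro sublinear_pull_le[OF p]) auto
      also have "c *\<^sub>R x + (c * t) *\<^sub>R a = c *\<^sub>R (x + t *\<^sub>R a)" by (simp add: algebra_simps)
      also have "p \<dots> = c * p (x + t *\<^sub>R a)" using c by (intro sublinear_scale[OF p]) auto
      finally show ?thesis using c by (simp add: field_simps)
    qed
    then have "?q (c *\<^sub>R x) / c \<le> ?q x" by (rule le_sublinear_pull)
    then show ?thesis using c by (simp add: field_simps)
  qed
  moreover have "?q 0 = 0"
  proof (rule antisym)
    show "?q 0 \<le> 0" using sublinear_pull_le[OF p, of 0 a 0] p by (simp add: sublinear_def)
    show "0 \<le> ?q 0" by (rule le_sublinear_pull) (simp add: sublinear_scale[OF p])
  qed
  ultimately show "sublinear ?q" by (simp add: sublinear_def)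
qed

text \<open>Zorn's lemma for the reversed order. The pointwise infimum of a chain is finite because
  \<open>q x\<close> is at least \<open>- p (- x)\<close>, and subadditive because of two members of
  a chain the smaller one can be used for both summands.\<close>

lemma ex_minimal_sublinear:
  assumes p: "sublinear p"
  shows "\<exists>q. sublinear q \<and> q \<le> p \<and> (\<forall>r. sublinear r \<and> r \<le> q \<longrightarrow> r = q)"
proof -
  define A where "A = {q. sublinear q \<and> q \<le> p}"
  define P where "P = (\<lambda>q r :: 'a \<Rightarrow> real. r \<le> q)"
  have "partial_order_on A (relation_of P A)"
    unfolding P_def by (rule partial_order_on_relation_ofI) auto
  moreover have "\<exists>u\<in>A. \<forall>q\<in>C. P q u" if C: "C \<in> Chains (relation_of P A)" for C
  proof (cases "C = {}")
    case True
    then show ?thesis using p by (auto simp: A_def)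
  next
    case False
    have CA: "C \<subseteq> A" and tot: "\<And>q r. q \<in> C \<Longrightarrow> r \<in> C \<Longrightarrow> q \<le> r \<or> r \<le> q"
      using C by (auto simp: Chains_def relation_of_def P_def)
    define u where "u = (\<lambda>x. INF q\<in>C. q x)"
    have low: "- p (- x) \<le> q x" if "q \<in> C" for q x
    proof -
      have "sublinear q" "q (- x) \<le> p (- x)" using that CA by (auto simp: A_def le_fun_def)
      then show ?thesis using sublinear_minus[of q x] by linarith
    qed
    have ule: "u x \<le> q x" if "q \<in> C" for q x
      unfolding u_def by (rule cINF_lower) (use low that in \<open>auto intro!: bdd_belowI2\<close>)
    have uge: "c \<le> u x" if "\<And>q. q \<in> C \<Longrightarrow> c \<le> q x" for c x
      unfolding u_def by (rule cINF_greatest) (use False that in auto)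
    have sub: "sublinear q" if "q \<in> C" for q using that CA by (auto simp: A_def)
    have "u (x + y) \<le> u x + u y" for x y
    proof -
      have *: "u (x + y) \<le> q x + r y" if "q \<in> C" "r \<in> C" for q r
        using tot[OF that] ule[OF that(1), of "x + y"] ule[OF that(2), of "x + y"]
          sublinear_add[OF sub[OF that(1)], of x y] sublinear_add[OF sub[OF that(2)], of x y]
        by (smt (verit) le_funD)
      have "u (x + y) - q x \<le> u y" if "q \<in> C" for q
      proof (rule uge)
        fix r assume "r \<in> C"
        from *[OF that this] show "u (x + y) - q x \<le> r y" by linarith
      qed
      then have "u (x + y) - u y \<le> q x" if "q \<in> C" for q using that by force
      then have "u (x + y) - u y \<le> u x" by (rule uge)
      then show ?thesis by simp
    qed
    moreover have "u (c *\<^sub>R x) \<le> c * u x" if c: "c > 0" for c x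
    proof -
      have "u (c *\<^sub>R x) / c \<le> u x"
      proof (rule uge)
        fix q assume q: "q \<in> C"
        have "u (c *\<^sub>R x) \<le> c * q x"
          using ule[OF q, of "c *\<^sub>R x"] sublinear_scale[OF sub[OF q], of c x] c by simp
        then show "u (c *\<^sub>R x) / c \<le> q x" using c by (simp add: field_simps)
      qed
      then show ?thesis using c by (simp add: field_simps)
    qed
    moreover have "u 0 = 0"
    proof -
      have 0: "q 0 = 0" if "q \<in> C" for q using sub[OF that] by (simp add: sublinear_def)
      obtain q where q: "q \<in> C" using False by blast
      have "u 0 \<le> 0" using ule[OF q, of 0] 0[OF q] by simp
      moreover have "0 \<le> u 0" by (rule uge) (simp only: 0)
      ultimately show ?thesis by simp
    qed
    ultimately have "sublinear u" by (simp add: sublinear_def)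
    moreover have "u \<le> p"
    proof (rule le_funI)
      fix x
      obtain q where q: "q \<in> C" using False by blast
      then have "q \<le> p" using CA by (auto simp: A_def)
      then show "u x \<le> p x" using ule[OF q, of x] le_funD[of q p x] by simp
    qed
    ultimately have "u \<in> A" by (simp add: A_def)
    then show ?thesis using ule by (auto simp: P_def le_fun_def)
  qed
  ultimately have "\<exists>m\<in>A. \<forall>a\<in>A. P m a \<longrightarrow> a = m" by (rule predicate_Zorn)
  then obtain q where q: "q \<in> A" "\<And>r. r \<in> A \<Longrightarrow> r \<le> q \<Longrightarrow> r = q" by (auto simp: P_def)
  then have "r = q" if "sublinear r" "r \<le> q" for r
    using that order_trans[OF that(2), of p] by (auto simp: A_def)
  with q(1) show ?thesis by (auto simp: A_def)
qed

text \<open>A minimal sublinear functional is linear, and \<open>sublinear_pull\<close> forces the prescribed value.\<close>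

theorem Hahn_Banach_sublinear:
  assumes p: "sublinear (p :: 'a::real_vector \<Rightarrow> real)"
  obtains f where "linear f" "\<And>x. f x \<le> p x" "f a = p a"
proof -
  obtain f where f: "sublinear f" "f \<le> sublinear_pull a p" "\<And>r. sublinear r \<Longrightarrow> r \<le> f \<Longrightarrow> r = f"
    using ex_minimal_sublinear[OF sublinear_pull(1)[OF p]] by blast
  have neg: "f (- x) = - f x" for x
  proof -
    have "sublinear_pull x f = f"
      using sublinear_pull[OF f(1)] by (intro f(3)) (auto simp: le_fun_def)
    then have "f (- x) \<le> - f x" using sublinear_pull(3)[OF f(1), of x] by simp
    then show ?thesis using sublinear_minus[OF f(1), of x] by simp
  qed
  have add: "f (x + y) = f x + f y" for x y
    using sublinear_add[OF f(1), of x y] sublinear_add[OF f(1), of "x + y" "- y"] neg[of y] by simp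
  have "f (c *\<^sub>R x) = c * f x" for c x
  proof (cases "0 \<le> c")
    case False
    then show ?thesis using sublinear_scale[OF f(1), of "- c" x] neg[of "c *\<^sub>R x"] by simp
  qed (simp add: sublinear_scale[OF f(1)])
  then have "linear f" using add by (intro linearI) auto
  moreover have le: "f x \<le> p x" for x
    using f(2) sublinear_pull(2)[OF p, of a x] by (metis le_funD order_trans)
  moreover have "f a = p a"
    using le[of a] f(2) sublinear_pull(3)[OF p, of a] neg[of a] by (metis add.inverse_inverse antisym le_funD neg_le_iff_le order_trans)
  ultimately show ?thesis by (rule that)
qed

text \<open>A linear projection onto \<open>S\<close> turns \<open>p\<close> into a functional that
  is sublinear on the whole space. This is needed for a gauge that is controlled only on the
  self-adjoint part of the Pedersen ideal.\<close>

corollary Hahn_Banach_sublinear_on: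
  fixes p :: "'a::real_vector \<Rightarrow> real"
  assumes S: "subspace S" and a: "a \<in> S" and "p 0 = 0"
    and add: "\<And>x y. x \<in> S \<Longrightarrow> y \<in> S \<Longrightarrow> p (x + y) \<le> p x + p y"
    and scale: "\<And>c x. c > 0 \<Longrightarrow> x \<in> S \<Longrightarrow> p (c *\<^sub>R x) \<le> c * p x"
  obtains f where "linear f" "\<And>x. x \<in> S \<Longrightarrow> f x \<le> p x" "f a = p a"
proof -
  obtain \<pi> :: "'a \<Rightarrow> 'a" where \<pi>: "range \<pi> \<subseteq> S" "linear \<pi>" "\<And>x. x \<in> S \<Longrightarrow> \<pi> x = x"
    using linear_exists_left_inverse_on[of "\<lambda>x. x" S] S by (auto simp: linear_id[unfolded id_def])
  have "\<pi> x \<in> S" for x using \<pi>(1) by auto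
  then have "sublinear (\<lambda>x. p (\<pi> x))"
    using assms by (auto simp: sublinear_def linear_0[OF \<pi>(2)] linear_add[OF \<pi>(2)] linear_scale[OF \<pi>(2)])
  then obtain f where "linear f" "\<And>x. f x \<le> p (\<pi> x)" "f a = p (\<pi> a)"
    using Hahn_Banach_sublinear[of "\<lambda>x. p (\<pi> x)" a] by blast
  then show ?thesis using \<pi>(3) a that by (metis (no_types, lifting))
qed

section \<open>Traces and their topology\<close>

lemma pedersen_nbhd_scaleR:
  assumes U: "pedersen_nbhd U" and r: "0 < r"
  shows "pedersen_nbhd ((*\<^sub>R) r ` (U :: 'a::cstar_algebra set))"
  unfolding pedersen_nbhd_def
proof (intro conjI allI impI ballI)
  show "(*\<^sub>R) r ` U \<subseteq> pedersen_ideal" using U by (auto simp: pedersen_nbhd_def)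
  show "convex ((*\<^sub>R) r ` U)" using U by (auto simp: pedersen_nbhd_def intro: convex_scaling)
  show "c *\<^sub>C x \<in> (*\<^sub>R) r ` U" if "x \<in> (*\<^sub>R) r ` U" "cmod c \<le> 1" for x c
    using that U by (auto simp: pedersen_nbhd_def scaleC_scaleR)
  show "\<exists>s>0. ball 0 s \<inter> D \<subseteq> (*\<^sub>R) r ` U" if D: "cstar_subalgebra D \<and> D \<subseteq> pedersen_ideal" for D
  proof -
    obtain s where s: "s > 0" "ball 0 s \<inter> D \<subseteq> U" using U D unfolding pedersen_nbhd_def by meson
    have "ball 0 (r * s) \<inter> D \<subseteq> (*\<^sub>R) r ` U"
    proof
      fix x assume x: "x \<in> ball 0 (r * s) \<inter> D"
      have "complex_subspace D" using D by (simp add: cstar_subalgebra_def)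
      then have "(1/r) *\<^sub>R x \<in> D" using x by (simp add: complex_subspaceD)
      then have "(1/r) *\<^sub>R x \<in> U" using x s r by (auto simp: divide_less_eq mult.commute)
      then show "x \<in> (*\<^sub>R) r ` U" using r by (intro image_eqI[of _ _ "(1/r) *\<^sub>R x"]) auto
    qed
    then show ?thesis using s r by (intro exI[of _ "r * s"]) auto
  qed
qed

lemma pedersen_nbhd_ball:
  assumes "0 < r"
  shows "pedersen_nbhd (ball 0 r \<inter> (pedersen_ideal :: 'a::cstar_algebra set))"
  unfolding pedersen_nbhd_def
proof (intro conjI allI impI ballI)
  have "convex (pedersen_ideal :: 'a set)" by (auto simp: convex_def)
  then show "convex (ball 0 r \<inter> (pedersen_ideal :: 'a set))" by (intro convex_Int) auto
  show "c *\<^sub>C x \<in> ball 0 r \<inter> pedersen_ideal" if "x \<in> ball 0 r \<inter> pedersen_ideal" "cmod c \<le> 1" for c and x :: 'a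
  proof -
    have "cmod c * norm x \<le> 1 * norm x" using that by (intro mult_right_mono) auto
    then show ?thesis using that by (simp add: norm_scaleC)
  qed
qed (use assms in auto)

lemma pedersen_nbhd_UNIV: "pedersen_nbhd pedersen_ideal"
  by (auto simp: pedersen_nbhd_def convex_def intro: exI[of _ 1])

lemma topspace_pedersen [simp]: "topspace pedersen_topology = (pedersen_ideal :: 'a::cstar_algebra set)"
proof (rule antisym)
  show "topspace pedersen_topology \<subseteq> (pedersen_ideal :: 'a set)"
    using openin_topspace[of "pedersen_topology :: 'a topology", unfolded openin_pedersen_topology] by blast
  have "openin pedersen_topology (pedersen_ideal :: 'a set)"
    unfolding openin_pedersen_topology using pedersen_nbhd_UNIV[where 'a='a]
    by (auto intro!: exI[of _ "pedersen_ideal :: 'a set"])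
  then show "(pedersen_ideal :: 'a set) \<subseteq> topspace pedersen_topology" by (rule openin_subset)
qed

lemma pedersen_traceD:
  assumes "pedersen_trace \<tau>"
  shows "\<tau> \<in> extensional pedersen_ideal"
    "x \<in> pedersen_ideal \<Longrightarrow> y \<in> pedersen_ideal \<Longrightarrow> \<tau> (x + y) = \<tau> x + \<tau> y"
    "x \<in> pedersen_ideal \<Longrightarrow> \<tau> (c *\<^sub>C x) = c * \<tau> x"
    "x \<in> pedersen_ideal \<Longrightarrow> y \<in> pedersen_ideal \<Longrightarrow> \<tau> (x * y) = \<tau> (y * x)"
    "\<tau> 0 = 0"
    "x \<in> pedersen_ideal \<Longrightarrow> \<tau> (r *\<^sub>R x) = of_real r * \<tau> x"
    "x \<in> pedersen_ideal \<Longrightarrow> y \<in> pedersen_ideal \<Longrightarrow> \<tau> (x - y) = \<tau> x - \<tau> y"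
proof -
  show *: "\<tau> \<in> extensional pedersen_ideal"
    "x \<in> pedersen_ideal \<Longrightarrow> y \<in> pedersen_ideal \<Longrightarrow> \<tau> (x + y) = \<tau> x + \<tau> y"
    "x \<in> pedersen_ideal \<Longrightarrow> \<tau> (c *\<^sub>C x) = c * \<tau> x"
    "x \<in> pedersen_ideal \<Longrightarrow> y \<in> pedersen_ideal \<Longrightarrow> \<tau> (x * y) = \<tau> (y * x)" for x y c
    using assms by (auto simp: pedersen_trace_def)
  show "\<tau> 0 = 0" using *(2)[of 0 0] by simp
  show r: "x \<in> pedersen_ideal \<Longrightarrow> \<tau> (r *\<^sub>R x) = of_real r * \<tau> x" for x r
    using *(3)[of x "of_real r"] by (simp add: scaleC_of_real)
  show "x \<in> pedersen_ideal \<Longrightarrow> y \<in> pedersen_ideal \<Longrightarrow> \<tau> (x - y) = \<tau> x - \<tau> y"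
    using *(2)[of x "- y"] r[of y "-1"] by simp
qed

lemma real_tracesD:
  assumes "\<tau> \<in> real_traces"
  shows "pedersen_trace \<tau>" "x \<in> pedersen_ideal \<Longrightarrow> \<tau> (adj x) = cnj (\<tau> x)"
  using assms by (auto simp: real_traces_def)

lemma real_trace_re_part:
  assumes "\<tau> \<in> real_traces" "x \<in> pedersen_ideal"
  shows "\<tau> (re_part x) = complex_of_real (Re (\<tau> x))"
proof -
  have "\<tau> (re_part x) = (1/2) * (\<tau> x + cnj (\<tau> x))"
    using assms real_tracesD[OF assms(1)] by (simp add: re_part_def pedersen_traceD)
  then show ?thesis by (simp add: complex_add_cnj)
qed

lemma real_trace_sa:
  "\<tau> \<in> real_traces \<Longrightarrow> x \<in> pedersen_sa \<Longrightarrow> \<tau> x = complex_of_real (Re (\<tau> x))"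
  using real_trace_re_part[of \<tau> x] by (simp add: pedersen_sa_def self_adjoint_elements_def re_part_sa)

lemma pedersen_sa_iff: "x \<in> pedersen_sa \<longleftrightarrow> x \<in> pedersen_ideal \<and> adj x = x"
  by (simp add: pedersen_sa_def self_adjoint_elements_def)

lemma subspace_pedersen_sa: "subspace (pedersen_sa :: 'a::cstar_algebra set)"
  by (auto simp: subspace_def pedersen_sa_iff adj_add)

lemma real_trace_bounded_on_nbhd:
  assumes "\<tau> \<in> real_traces"
  obtains U where "pedersen_nbhd U" "\<And>u. u \<in> U \<Longrightarrow> cmod (\<tau> u) < 1"
proof -
  have "openin pedersen_topology {x \<in> topspace pedersen_topology. \<tau> x \<in> ball 0 1}"
    using assms by (intro openin_continuous_map_preimage[where Y=euclidean]) (auto simp: real_traces_def)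
  moreover have "0 \<in> {x \<in> topspace pedersen_topology. \<tau> x \<in> ball 0 1}"
    using real_tracesD[OF assms] by (simp add: pedersen_traceD)
  ultimately obtain U where "pedersen_nbhd U" "(+) 0 ` U \<subseteq> {x \<in> topspace pedersen_topology. \<tau> x \<in> ball 0 1}"
    unfolding openin_pedersen_topology by meson
  then show ?thesis by (intro that[of U]) auto
qed

lemma real_tracesI:
  assumes \<tau>: "pedersen_trace \<tau>" "\<And>x. x \<in> pedersen_ideal \<Longrightarrow> \<tau> (adj x) = cnj (\<tau> x)"
    and U: "pedersen_nbhd U" "\<And>u. u \<in> U \<Longrightarrow> cmod (\<tau> u) \<le> M"
  shows "\<tau> \<in> real_traces"
proof -
  have "0 \<in> U" using U(1) by (rule pedersen_nbhd_0)
  then have M: "0 \<le> M" using U(2)[of 0] order_trans[OF norm_ge_zero] by blast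
  have "continuous_map pedersen_topology euclidean \<tau>"
    unfolding continuous_map_def
  proof (intro conjI allI impI)
    fix V :: "complex set" assume "openin euclidean V"
    then have V: "open V" by simp
    show "openin pedersen_topology {x \<in> topspace pedersen_topology. \<tau> x \<in> V}"
      unfolding openin_pedersen_topology
    proof (intro conjI ballI)
      fix x assume x: "x \<in> {x \<in> topspace pedersen_topology. \<tau> x \<in> V}"
      then obtain e where e: "e > 0" "ball (\<tau> x) e \<subseteq> V" using V by (auto simp: open_contains_ball)
      define r where "r = e / (M + 1)"
      have r: "r > 0" "r * M < e" using e M by (auto simp: r_def divide_less_eq)
      have "\<tau> (x + u) \<in> V \<and> x + u \<in> pedersen_ideal" if "u \<in> (*\<^sub>R) r ` U" for u
      proof -
        obtain v where v: "v \<in> U" "u = r *\<^sub>R v" using \<open>u \<in> (*\<^sub>R) r ` U\<close> by auto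
        have vP: "v \<in> pedersen_ideal" using v U by (auto simp: pedersen_nbhd_def)
        have "cmod (\<tau> u) = r * cmod (\<tau> v)"
          using vP r by (simp add: v pedersen_traceD[OF \<tau>(1)] norm_mult)
        also have "\<dots> \<le> r * M" using r U(2)[OF v(1)] by (intro mult_left_mono) auto
        finally have "cmod (\<tau> u) < e" using r by simp
        moreover have "\<tau> (x + u) = \<tau> x + \<tau> u" using x vP by (simp add: v pedersen_traceD[OF \<tau>(1)])
        ultimately show ?thesis using e(2) x vP by (auto simp: v dist_norm subset_iff)
      qed
      then show "\<exists>U. pedersen_nbhd U \<and> (+) x ` U \<subseteq> {x \<in> topspace pedersen_topology. \<tau> x \<in> V}"
        using pedersen_nbhd_scaleR[OF U(1) r(1)] by (intro exI[of _ "(*\<^sub>R) r ` U"]) auto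
    qed auto
  qed auto
  then show ?thesis using \<tau> by (auto simp: real_traces_def)
qed

lemma lincomb_real_traces:
  assumes "\<sigma> \<in> real_traces" "\<tau> \<in> real_traces"
  shows "lincomb_on pedersen_ideal s \<sigma> t \<tau> \<in> real_traces"
proof -
  obtain U where U: "pedersen_nbhd U" "\<And>u. u \<in> U \<Longrightarrow> cmod (\<sigma> u) < 1"
    using real_trace_bounded_on_nbhd[OF assms(1)] by blast
  obtain V where V: "pedersen_nbhd V" "\<And>u. u \<in> V \<Longrightarrow> cmod (\<tau> u) < 1"
    using real_trace_bounded_on_nbhd[OF assms(2)] by blast
  note \<sigma> = real_tracesD[OF assms(1)] and \<tau> = real_tracesD[OF assms(2)]
  show ?thesis
  proof (rule real_tracesI)
    show "pedersen_trace (lincomb_on pedersen_ideal s \<sigma> t \<tau>)"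
      unfolding pedersen_trace_def lincomb_on_def
      using pedersen_traceD[OF \<sigma>(1)] pedersen_traceD[OF \<tau>(1)] by (auto simp: scaleR_conv_of_real algebra_simps)
    show "lincomb_on pedersen_ideal s \<sigma> t \<tau> (adj x) = cnj (lincomb_on pedersen_ideal s \<sigma> t \<tau> x)"
      if "x \<in> pedersen_ideal" for x
      using that \<sigma>(2)[OF that] \<tau>(2)[OF that] by (simp add: lincomb_on_def)
    show "pedersen_nbhd (U \<inter> V)" using U(1) V(1) by (rule pedersen_nbhd_Int)
    show "cmod (lincomb_on pedersen_ideal s \<sigma> t \<tau> u) \<le> \<bar>s\<bar> * 1 + \<bar>t\<bar> * 1" if "u \<in> U \<inter> V" for u
    proof -
      have "u \<in> pedersen_ideal" using that U(1) by (auto simp: pedersen_nbhd_def)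
      then show ?thesis
        using that U(2)[of u] V(2)[of u]
        by (auto simp: lincomb_on_def intro!: norm_triangle_le add_mono mult_left_le)
    qed
  qed
qed

lemma topspace_weak_star [simp]: "topspace weak_star_topology = (real_traces :: ('a::cstar_algebra \<Rightarrow> complex) set)"
  by (auto simp: weak_star_topology_def real_traces_def pedersen_trace_def PiE_iff extensional_def)

lemma continuous_map_weak_star_eval:
  "x \<in> pedersen_ideal \<Longrightarrow> continuous_map weak_star_topology euclidean (\<lambda>\<tau>. \<tau> x)"
  unfolding weak_star_topology_def
  by (intro continuous_map_from_subtopology continuous_map_product_projection)

lemma trace_evaluation_in_dual:
  assumes "a \<in> pedersen_ideal"
  shows "trace_evaluation a \<in> traces_dual"
proof -
  have "continuous_map weak_star_topology euclideanreal (Re \<circ> (\<lambda>\<tau>. \<tau> a))"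
    by (rule continuous_map_compose[OF continuous_map_weak_star_eval[OF assms]])
       (auto intro: continuous_intros)
  then have "continuous_map weak_star_topology euclideanreal (trace_evaluation a)"
    by (rule continuous_map_eq) (simp add: trace_evaluation_def)
  then show ?thesis
    using assms by (auto simp: traces_dual_def trace_evaluation_def lincomb_real_traces[unfolded lincomb_on_def] lincomb_on_def)
qed

section \<open>Weak*-continuous functionals are evaluations\<close>

text \<open>Linear algebra of finitely many functionals, by induction on \<open>F\<close>. If some
  trace \<open>\<tau>0\<close> vanishes on \<open>F\<close> but not at \<open>a\<close>, it
  determines the coefficient \<open>c\<close> of \<open>a\<close>; then every
  \<open>\<sigma>\<close> vanishing on \<open>F\<close> can be corrected by a multiple of
  \<open>\<tau>0\<close> to vanish at \<open>a\<close> as well.\<close>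

lemma functional_in_span_of_evaluations:
  assumes "finite F" "F \<subseteq> pedersen_sa"
    and "\<And>\<sigma> \<tau> s t. \<sigma> \<in> real_traces \<Longrightarrow> \<tau> \<in> real_traces \<Longrightarrow>
      f (lincomb_on pedersen_ideal s \<sigma> t \<tau>) = s * f \<sigma> + t * f \<tau>"
    and "\<And>\<tau>. \<tau> \<in> real_traces \<Longrightarrow> (\<And>a. a \<in> F \<Longrightarrow> Re (\<tau> a) = 0) \<Longrightarrow> f \<tau> = 0"
  shows "\<exists>b\<in>(pedersen_sa :: 'a::cstar_algebra set). \<forall>\<tau>\<in>real_traces. f \<tau> = Re (\<tau> b)"
  using assms
proof (induction F arbitrary: f rule: finite_induct)
  case empty
  then show ?case
    by (intro bexI[of _ 0]) (auto simp: pedersen_sa_iff pedersen_traceD dest: real_tracesD)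
next
  case (insert a F)
  have a: "a \<in> pedersen_ideal" "adj a = a" using insert.prems(1) by (auto simp: pedersen_sa_iff)
  show ?case
  proof (cases "\<exists>\<tau>0\<in>real_traces. (\<forall>b\<in>F. Re (\<tau>0 b) = 0) \<and> Re (\<tau>0 a) \<noteq> 0")
    case False
    show ?thesis
    proof (rule insert.IH[of f])
      fix \<tau> assume "\<tau> \<in> real_traces" "\<And>a. a \<in> F \<Longrightarrow> Re (\<tau> a) = 0"
      with False insert.prems(3)[of \<tau>] show "f \<tau> = 0" by blast
    qed (use insert.prems in auto)
  next
    case True
    then obtain \<tau>0 where \<tau>0: "\<tau>0 \<in> real_traces" "\<And>b. b \<in> F \<Longrightarrow> Re (\<tau>0 b) = 0" "Re (\<tau>0 a) \<noteq> 0" by blast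
    define c where "c = f \<tau>0 / Re (\<tau>0 a)"
    have "\<exists>b\<in>pedersen_sa. \<forall>\<tau>\<in>real_traces. f \<tau> - c * Re (\<tau> a) = Re (\<tau> b)"
    proof (rule insert.IH)
      show "F \<subseteq> pedersen_sa" using insert.prems by simp
      show "f (lincomb_on pedersen_ideal s \<sigma> t \<tau>) - c * Re (lincomb_on pedersen_ideal s \<sigma> t \<tau> a) =
          s * (f \<sigma> - c * Re (\<sigma> a)) + t * (f \<tau> - c * Re (\<tau> a))"
        if "\<sigma> \<in> real_traces" "\<tau> \<in> real_traces" for \<sigma> \<tau> s t
        using a by (simp add: insert.prems(2)[OF that]) (simp add: lincomb_on_def algebra_simps)
      fix \<sigma> assume \<sigma>: "\<sigma> \<in> real_traces" "\<And>b. b \<in> F \<Longrightarrow> Re (\<sigma> b) = 0"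
      define k where "k = - (Re (\<sigma> a) / Re (\<tau>0 a))"
      have FP: "b \<in> pedersen_ideal" if "b \<in> F" for b using that insert.prems(1) by (auto simp: pedersen_sa_iff)
      have "f (lincomb_on pedersen_ideal 1 \<sigma> k \<tau>0) = 0"
      proof (rule insert.prems(3)[OF lincomb_real_traces[OF \<sigma>(1) \<tau>0(1)]])
        fix b assume "b \<in> insert a F"
        then show "Re (lincomb_on pedersen_ideal 1 \<sigma> k \<tau>0 b) = 0"
          using \<sigma>(2) \<tau>0(2,3) a FP by (auto simp: lincomb_on_def k_def)
      qed
      then show "f \<sigma> - c * Re (\<sigma> a) = 0"
        using \<sigma>(1) \<tau>0(1) by (simp add: insert.prems(2) c_def k_def)
    qed
    then obtain b where b: "b \<in> pedersen_sa" "\<And>\<tau>. \<tau> \<in> real_traces \<Longrightarrow> f \<tau> - c * Re (\<tau> a) = Re (\<tau> b)" by blast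
    have "f \<tau> = Re (\<tau> (b + c *\<^sub>R a))" if "\<tau> \<in> real_traces" for \<tau>
      using b(2)[OF that] b(1) a real_tracesD(1)[OF that] by (simp add: pedersen_traceD pedersen_sa_iff)
    moreover have "b + c *\<^sub>R a \<in> pedersen_sa" using b(1) a by (simp add: pedersen_sa_iff adj_add)
    ultimately show ?thesis by blast
  qed
qed

lemma zero_real_trace: "(\<lambda>x\<in>pedersen_ideal. 0) \<in> real_traces"
  by (rule real_tracesI[OF _ _ pedersen_nbhd_UNIV, of _ 0]) (auto simp: pedersen_trace_def)

lemma traces_dual_zero:
  fixes f :: "('a::cstar_algebra \<Rightarrow> complex) \<Rightarrow> real"
  assumes "f \<in> traces_dual"
  shows "f (\<lambda>x\<in>pedersen_ideal. 0) = 0"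
proof -
  let ?z = "\<lambda>x\<in>(pedersen_ideal :: 'a set). 0 :: complex"
  have "f (lincomb_on pedersen_ideal 0 ?z 0 ?z) = 0 * f ?z + 0 * f ?z"
    using assms zero_real_trace unfolding traces_dual_def by blast
  moreover have "lincomb_on pedersen_ideal 0 ?z 0 ?z = ?z"
    by (auto simp: lincomb_on_def)
  ultimately show ?thesis by simp
qed

text \<open>A weak*-neighbourhood of the zero trace restricts only finitely many coordinates. A
  trace vanishing at these has all its multiples in the neighbourhood, so \<open>f\<close> is
  bounded on a line and thus 0 there.\<close>

lemma traces_dual_eq_evaluation:
  assumes f: "f \<in> traces_dual"
  shows "\<exists>b\<in>(pedersen_sa :: 'a::cstar_algebra set). \<forall>\<tau>\<in>real_traces. f \<tau> = Re (\<tau> b)"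
proof -
  let ?X = "product_topology (\<lambda>_. euclidean) (pedersen_ideal :: 'a set) :: ('a \<Rightarrow> complex) topology"
  let ?z = "\<lambda>x\<in>(pedersen_ideal :: 'a set). 0 :: complex"
  have lin: "f (lincomb_on pedersen_ideal s \<sigma> t \<tau>) = s * f \<sigma> + t * f \<tau>"
    if "\<sigma> \<in> real_traces" "\<tau> \<in> real_traces" for \<sigma> \<tau> s t
    using f that by (simp add: traces_dual_def)
  have "openin weak_star_topology {\<tau> \<in> topspace weak_star_topology. f \<tau> \<in> ball 0 1}"
    using f by (intro openin_continuous_map_preimage[where Y=euclideanreal]) (auto simp: traces_dual_def)
  then obtain O1 where O1: "openin ?X O1" "{\<tau> \<in> real_traces. f \<tau> \<in> ball 0 1} = O1 \<inter> real_traces"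
    unfolding weak_star_topology_def openin_subtopology topspace_weak_star[unfolded weak_star_topology_def] by auto
  have "?z \<in> {\<tau> \<in> real_traces. f \<tau> \<in> ball 0 1}"
    using zero_real_trace[where 'a='a] traces_dual_zero[OF f] by simp
  then have zO1: "?z \<in> O1" unfolding O1(2) by blast
  then obtain W where W: "finite {i \<in> pedersen_ideal. W i \<noteq> (UNIV :: complex set)}"
    "\<And>i. i \<in> pedersen_ideal \<Longrightarrow> open (W i)" "?z \<in> Pi\<^sub>E pedersen_ideal W" "Pi\<^sub>E pedersen_ideal W \<subseteq> O1"
    using O1(1)[unfolded openin_product_topology_alt topspace_euclidean, rule_format, OF zO1]
    by (auto simp del: PiE_iff)
  define F where "F = {i \<in> pedersen_ideal. W i \<noteq> UNIV}"
  have F: "finite F" "F \<subseteq> pedersen_ideal" using W(1) by (auto simp: F_def)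
  have "f \<tau> = 0" if \<tau>: "\<tau> \<in> real_traces" "\<And>x. x \<in> F \<Longrightarrow> \<tau> x = 0" for \<tau>
  proof -
    have bound: "\<bar>k * f \<tau>\<bar> < 1" for k
    proof -
      define \<sigma> where "\<sigma> = lincomb_on pedersen_ideal k \<tau> 0 \<tau>"
      have \<sigma>: "\<sigma> \<in> real_traces" unfolding \<sigma>_def by (rule lincomb_real_traces[OF \<tau>(1) \<tau>(1)])
      have "\<sigma> i \<in> W i" if "i \<in> pedersen_ideal" for i
      proof (cases "i \<in> F")
        case True
        then have "\<sigma> i = 0" using \<tau>(2) that by (simp add: \<sigma>_def lincomb_on_def)
        moreover have "0 \<in> W i" using W(3) that by (auto simp: PiE_iff)
        ultimately show ?thesis by simp
      qed (use that in \<open>auto simp: F_def\<close>)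
      moreover have "\<sigma> \<in> extensional pedersen_ideal" by (simp add: \<sigma>_def lincomb_on_def)
      ultimately have "\<sigma> \<in> Pi\<^sub>E pedersen_ideal W" by (simp add: PiE_iff)
      then have "f \<sigma> \<in> ball 0 1" using W(4) O1(2) \<sigma> by blast
      then show ?thesis unfolding \<sigma>_def lin[OF \<tau>(1) \<tau>(1)] by simp
    qed
    show ?thesis
    proof (rule ccontr)
      assume "f \<tau> \<noteq> 0"
      then show False using bound[of "1 / f \<tau>"] by simp
    qed
  qed
  then have "f \<tau> = 0" if "\<tau> \<in> real_traces" "\<And>a. a \<in> re_part ` F \<union> im_part ` F \<Longrightarrow> Re (\<tau> a) = 0" for \<tau>
  proof -
    have "\<tau> x = 0" if "x \<in> F" for x
    proof -
      have x: "x \<in> pedersen_ideal" using that F by blast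
      then have "re_part x \<in> pedersen_sa" "im_part x \<in> pedersen_sa" by (auto simp: pedersen_sa_iff)
      then have "\<tau> (re_part x) = 0" "\<tau> (im_part x) = 0"
        using real_trace_sa[OF \<open>\<tau> \<in> real_traces\<close>] \<open>\<And>a. a \<in> re_part ` F \<union> im_part ` F \<Longrightarrow> Re (\<tau> a) = 0\<close> that
        by (metis Un_iff image_eqI of_real_0)+
      then have "\<tau> (re_part x + \<i> *\<^sub>C im_part x) = 0"
        using x real_tracesD(1)[OF \<open>\<tau> \<in> real_traces\<close>] by (simp add: pedersen_traceD del: re_im_part)
      then show ?thesis by (simp add: re_im_part)
    qed
    with \<open>\<And>\<tau>. \<tau> \<in> real_traces \<Longrightarrow> (\<And>x. x \<in> F \<Longrightarrow> \<tau> x = 0) \<Longrightarrow> f \<tau> = 0\<close> that(1) show ?thesis by blast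
  qed
  then show ?thesis
    using F by (intro functional_in_span_of_evaluations[where F="re_part ` F \<union> im_part ` F"] lin)
      (auto simp: pedersen_sa_iff)
qed

section \<open>Continuity of the canonical map\<close>

lemma real_trace_norm_bound_on_subalgebra:
  assumes \<tau>: "\<tau> \<in> real_traces" and D: "cstar_subalgebra D" "D \<subseteq> pedersen_ideal"
  obtains C where "C \<ge> 0" "\<And>x. x \<in> D \<Longrightarrow> cmod (\<tau> x) \<le> C * norm x"
proof -
  obtain U where U: "pedersen_nbhd U" "\<And>u. u \<in> U \<Longrightarrow> cmod (\<tau> u) < 1"
    using real_trace_bounded_on_nbhd[OF \<tau>] by blast
  obtain r where r: "r > 0" "ball 0 r \<inter> D \<subseteq> U" using U D unfolding pedersen_nbhd_def by meson
  have "cmod (\<tau> x) \<le> (2 / r) * norm x" if x: "x \<in> D" for x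
  proof (cases "x = 0")
    case False
    define c where "c = r / (2 * norm x)"
    have c: "c > 0" "norm (c *\<^sub>R x) < r" using False r by (auto simp: c_def)
    have "c *\<^sub>R x \<in> D" using D(1) x by (simp add: cstar_subalgebra_def complex_subspaceD)
    then have "cmod (\<tau> (c *\<^sub>R x)) < 1" using r c by (intro U(2)) auto
    moreover have "\<tau> (c *\<^sub>R x) = of_real c * \<tau> x"
      using D(2) x by (intro pedersen_traceD real_tracesD[OF \<tau>]) auto
    ultimately have "c * cmod (\<tau> x) < 1" using c(1) by (simp add: norm_mult)
    then show ?thesis using False r(1) by (simp add: c_def field_simps)
  qed (use real_tracesD[OF \<tau>] in \<open>simp add: pedersen_traceD\<close>)
  then show ?thesis using r by (intro that[of "2 / r"]) auto
qed

text \<open>Banach-Steinhaus on the complete space \<open>D\<close>: compactness of \<open>K\<close>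
  bounds each evaluation, so the closed sets \<open>F n\<close> cover \<open>D\<close>, and by Baire
  one of them has interior points.\<close>

lemma uniform_boundedness_on_subalgebra:
  fixes D :: "'a::cstar_algebra set"
  assumes K: "compactin weak_star_topology K" and D: "cstar_subalgebra D" "D \<subseteq> pedersen_ideal"
  shows "\<exists>r>0. \<forall>x\<in>ball 0 r \<inter> D. \<forall>\<tau>\<in>K. cmod (\<tau> x) \<le> 1"
proof -
  have KT: "K \<subseteq> real_traces" using compactin_subset_topspace[OF K] by simp
  have Ds: "complex_subspace D" "closed D" using D(1) by (auto simp: cstar_subalgebra_def)
  have tr: "pedersen_trace \<tau>" if "\<tau> \<in> K" for \<tau> using that KT real_tracesD by blast
  define F where "F = (\<lambda>n::nat. {x \<in> D. \<forall>\<tau>\<in>K. cmod (\<tau> x) \<le> real n})"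
  have cont: "continuous_on D \<tau>" if \<tau>: "\<tau> \<in> K" for \<tau>
  proof -
    obtain C where C: "C \<ge> 0" "\<And>x. x \<in> D \<Longrightarrow> cmod (\<tau> x) \<le> C * norm x"
      using real_trace_norm_bound_on_subalgebra[OF subsetD[OF KT \<tau>] D] by metis
    have "C-lipschitz_on D \<tau>"
    proof (rule lipschitz_onI)
      fix x y assume "x \<in> D" "y \<in> D"
      then have "x - y \<in> D" "\<tau> (x - y) = \<tau> x - \<tau> y"
        using D(2) Ds(1) pedersen_traceD(7)[OF tr[OF \<tau>]] by (auto simp: complex_subspaceD)
      then show "dist (\<tau> x) (\<tau> y) \<le> C * dist x y" using C(2)[of "x - y"] by (simp add: dist_norm)
    qed (rule C(1))
    then show ?thesis by (rule lipschitz_on_continuous_on)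
  qed
  have cF: "closedin (top_of_set D) (F n)" for n
  proof -
    have "closedin (top_of_set D) {x \<in> D. cmod (\<tau> x) \<le> real n}" if "\<tau> \<in> K" for \<tau>
    proof -
      have "closedin (top_of_set D) {x \<in> topspace (top_of_set D). cmod (\<tau> x) \<in> {..real n}}"
        using cont[OF that] by (intro closedin_continuous_map_preimage[where Y=euclideanreal]) (auto intro: continuous_intros)
      then show ?thesis by simp
    qed
    then have "closedin (top_of_set D) (D \<inter> (\<Inter>\<tau>\<in>K. {x \<in> D. cmod (\<tau> x) \<le> real n}))"
      by (cases "K = {}") (auto intro!: closedin_Int closedin_INT)
    moreover have "D \<inter> (\<Inter>\<tau>\<in>K. {x \<in> D. cmod (\<tau> x) \<le> real n}) = F n" by (auto simp: F_def)
    ultimately show ?thesis by simp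
  qed
  have cov: "(\<Union>n. F n) = D"
  proof -
    have "\<exists>n. x \<in> F n" if "x \<in> D" for x
    proof -
      have "compactin euclidean ((\<lambda>\<tau>. \<tau> x) ` K)"
        using D(2) that by (intro image_compactin[OF K] continuous_map_weak_star_eval) auto
      then have "bounded ((\<lambda>\<tau>. \<tau> x) ` K)" by (simp add: compact_imp_bounded)
      then obtain B where B: "\<forall>y\<in>(\<lambda>\<tau>. \<tau> x) ` K. cmod y \<le> B" unfolding bounded_iff by blast
      obtain n where "B \<le> real n" using real_arch_simple by blast
      then show ?thesis using B that by (intro exI[of _ n]) (auto simp: F_def intro: order_trans)
    qed
    then show ?thesis by (auto simp: F_def)
  qed
  have "\<exists>n. top_of_set D interior_of F n \<noteq> {}"
  proof (rule ccontr)
    assume no: "\<nexists>n. top_of_set D interior_of F n \<noteq> {}"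
    have "top_of_set D interior_of \<Union>(range F) = {}"
    proof (rule Baire_category_alt)
      show "completely_metrizable_space (top_of_set D) \<or> locally_compact_space (top_of_set D) \<and> regular_space (top_of_set D)"
        using completely_metrizable_space_closedin[OF completely_metrizable_space_euclidean] Ds(2) by auto
    qed (use cF no in auto)
    moreover have "top_of_set D interior_of D = D" using interior_of_topspace[of "top_of_set D"] by simp
    ultimately show False using cov complex_subspaceD(1)[OF Ds(1)] by auto
  qed
  then obtain n x0 where "x0 \<in> top_of_set D interior_of F n" by blast
  then obtain W where W: "openin (top_of_set D) W" "x0 \<in> W" "W \<subseteq> F n" unfolding interior_of_def by blast
  then obtain r where r: "r > 0" "ball x0 r \<inter> D \<subseteq> W"
    unfolding openin_contains_ball by blast
  have x0: "x0 \<in> F n" "x0 \<in> D" using W by (auto simp: F_def)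
  \<comment> \<open>The traces are at most \<open>n\<close> at \<open>x0 + v\<close> and at
    \<open>x0\<close>, hence at most \<open>2 * n\<close> at \<open>v\<close>; division by
    \<open>2 * n + 1\<close> brings this below 1. The extra 1 covers \<open>n = 0\<close>.\<close>
  define s where "s = r / (2 * real n + 1)"
  have s: "s > 0" using r by (simp add: s_def)
  have "cmod (\<tau> u) \<le> 1" if u: "u \<in> ball 0 s \<inter> D" and \<tau>: "\<tau> \<in> K" for u \<tau>
  proof -
    define v where "v = (2 * real n + 1) *\<^sub>R u"
    have v: "v \<in> D" using u Ds(1) by (simp add: v_def complex_subspaceD)
    have "norm v < r"
      using u by (simp add: v_def s_def less_divide_eq mult.commute add_pos_nonneg)
    then have "x0 + v \<in> ball x0 r \<inter> D"
      using v x0(2) Ds(1) by (simp add: dist_norm complex_subspaceD)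
    then have "x0 + v \<in> F n" using r W by blast
    then have "cmod (\<tau> (x0 + v)) \<le> real n" "cmod (\<tau> x0) \<le> real n" using x0 \<tau> by (auto simp: F_def)
    moreover have "\<tau> (x0 + v) = \<tau> x0 + \<tau> v" "\<tau> v = of_real (2 * real n + 1) * \<tau> u"
      using D(2) u x0(2) v unfolding v_def
      by (auto intro!: pedersen_traceD(2,6)[OF tr[OF \<tau>]] simp del: of_real_add of_real_mult)
    ultimately have v2: "cmod (\<tau> v) \<le> 2 * real n" "cmod (\<tau> v) = (2 * real n + 1) * cmod (\<tau> u)"
      using norm_triangle_ineq4[of "\<tau> x0 + \<tau> v" "\<tau> x0"] by (auto simp: norm_mult simp flip: of_real_add)
    have "(2 * real n + 1) * cmod (\<tau> u) \<le> (2 * real n + 1) * 1"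
      using v2(1) unfolding v2(2) by (rule order_trans) simp
    then show ?thesis by (rule mult_left_le_imp_le) simp
  qed
  then show ?thesis using s by blast
qed

text \<open>On each subalgebra this is uniform boundedness; it amounts to the continuity of the
  canonical map at zero.\<close>

lemma pedersen_nbhd_polar:
  assumes K: "compactin weak_star_topology K"
  shows "pedersen_nbhd {x \<in> (pedersen_ideal :: 'a::cstar_algebra set). \<forall>\<tau>\<in>K. cmod (\<tau> x) \<le> 1}"
  unfolding pedersen_nbhd_def
proof (intro conjI allI impI ballI)
  let ?U = "{x \<in> (pedersen_ideal :: 'a set). \<forall>\<tau>\<in>K. cmod (\<tau> x) \<le> 1}"
  have tr: "pedersen_trace \<tau>" if "\<tau> \<in> K" for \<tau>
    using that compactin_subset_topspace[OF K] real_tracesD by auto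
  show "convex ?U"
  proof (rule convexI)
    fix x y :: 'a and u v :: real
    assume *: "x \<in> ?U" "y \<in> ?U" "0 \<le> u" "0 \<le> v" "u + v = 1"
    have "cmod (\<tau> (u *\<^sub>R x + v *\<^sub>R y)) \<le> 1" if "\<tau> \<in> K" for \<tau>
    proof -
      have "\<tau> (u *\<^sub>R x + v *\<^sub>R y) = of_real u * \<tau> x + of_real v * \<tau> y"
        using * tr[OF that] by (simp add: pedersen_traceD)
      also have "cmod \<dots> \<le> u * 1 + v * 1"
        using * that by (intro norm_triangle_le add_mono) (auto simp: norm_mult intro!: mult_left_le)
      finally show ?thesis using * by simp
    qed
    then show "u *\<^sub>R x + v *\<^sub>R y \<in> ?U" using * by simp
  qed
  show "c *\<^sub>C x \<in> ?U" if "x \<in> ?U" "cmod c \<le> 1" for x c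
    using that tr by (auto simp: pedersen_traceD norm_mult intro!: mult_le_one)
  show "\<exists>r>0. ball 0 r \<inter> D \<subseteq> ?U" if D: "cstar_subalgebra D \<and> D \<subseteq> pedersen_ideal" for D
  proof -
    obtain r where "r > 0" "\<forall>x\<in>ball 0 r \<inter> D. \<forall>\<tau>\<in>K. cmod (\<tau> x) \<le> 1"
      using uniform_boundedness_on_subalgebra[OF K conjunct1[OF D] conjunct2[OF D]] by metis
    then show ?thesis using D by (intro exI[of _ r]) auto
  qed
qed auto

section \<open>The canonical map is a quotient map\<close>

text \<open>The complex linear functional with real part \<open>\<rho>\<close>.\<close>

definition trace_of_functional :: "('a::cstar_algebra \<Rightarrow> real) \<Rightarrow> 'a \<Rightarrow> complex" where
  "trace_of_functional \<rho> = (\<lambda>x\<in>pedersen_ideal. Complex (\<rho> x) (- \<rho> (\<i> *\<^sub>C x)))"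

lemma scaleC_Re_Im: "c *\<^sub>C (x::'a::cstar_algebra) = Re c *\<^sub>R x + Im c *\<^sub>R \<i> *\<^sub>C x"
  by (subst complex_eq[of c]) (simp add: scaleC_add_left scaleR_scaleC scaleC_of_real mult.commute flip: scaleC_scaleC)

lemma trace_of_functional:
  fixes \<rho> :: "'a::cstar_algebra \<Rightarrow> real"
  assumes \<rho>: "linear \<rho>" and adj: "\<And>x. x \<in> pedersen_ideal \<Longrightarrow> \<rho> (adj x) = \<rho> x"
    and tr: "\<And>x y. x \<in> pedersen_ideal \<Longrightarrow> y \<in> pedersen_ideal \<Longrightarrow> \<rho> (x * y) = \<rho> (y * x)"
  shows "pedersen_trace (trace_of_functional \<rho>)"
    "x \<in> pedersen_ideal \<Longrightarrow> trace_of_functional \<rho> (adj x) = cnj (trace_of_functional \<rho> x)"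
    "x \<in> pedersen_ideal \<Longrightarrow> \<exists>c. cmod c = 1 \<and> cmod (trace_of_functional \<rho> x) = \<rho> (c *\<^sub>C x)"
proof -
  let ?\<tau> = "trace_of_functional \<rho>"
  note lin = linear_add[OF \<rho>] linear_scale[OF \<rho>] linear_neg[OF \<rho>]
  have re: "Re (?\<tau> x) = \<rho> x" if "x \<in> pedersen_ideal" for x
    using that by (simp add: trace_of_functional_def)
  have sc: "?\<tau> (c *\<^sub>C x) = c * ?\<tau> x" if x: "x \<in> pedersen_ideal" for c x
  proof -
    have "\<rho> (c *\<^sub>C x) = Re c * \<rho> x + Im c * \<rho> (\<i> *\<^sub>C x)"
      by (subst scaleC_Re_Im) (simp add: lin)
    moreover have "\<rho> (\<i> *\<^sub>C c *\<^sub>C x) = Re c * \<rho> (\<i> *\<^sub>C x) - Im c * \<rho> x"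
      by (subst (2) scaleC_Re_Im) (simp add: scaleC_add_right scaleC_scaleR linear_diff[OF \<rho>] lin)
    ultimately show ?thesis
      using x by (simp add: trace_of_functional_def complex_eq_iff)
  qed
  show "pedersen_trace ?\<tau>"
    unfolding pedersen_trace_def
  proof (intro conjI allI ballI sc)
    fix x y :: 'a assume xy: "x \<in> pedersen_ideal" "y \<in> pedersen_ideal"
    show "?\<tau> (x + y) = ?\<tau> x + ?\<tau> y"
      using xy by (simp add: trace_of_functional_def scaleC_add_right lin complex_eq_iff)
    show "?\<tau> (x * y) = ?\<tau> (y * x)"
      using xy tr[OF xy] tr[of "\<i> *\<^sub>C x" y]
      by (simp add: trace_of_functional_def mult_scaleC_left mult_scaleC_right)
  qed (simp add: trace_of_functional_def)
  show "?\<tau> (adj x) = cnj (?\<tau> x)" if x: "x \<in> pedersen_ideal"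
  proof -
    have "\<i> *\<^sub>C adj x = adj ((- \<i>) *\<^sub>C x)" by (simp add: adj_scaleC)
    then have "\<rho> (\<i> *\<^sub>C adj x) = - \<rho> (\<i> *\<^sub>C x)"
      using adj[of "(- \<i>) *\<^sub>C x"] x by (simp add: scaleC_minus_left lin)
    then show ?thesis using x adj[OF x] by (simp add: trace_of_functional_def complex_eq_iff)
  qed
  show "\<exists>c. cmod c = 1 \<and> cmod (?\<tau> x) = \<rho> (c *\<^sub>C x)" if x: "x \<in> pedersen_ideal"
  proof -
    \<comment> \<open>The phase that rotates \<open>?\<tau> x\<close> to its modulus, so that bounds
      for the real part \<open>\<rho>\<close> on balanced sets become bounds for the
      modulus.\<close>
    define c where "c = (if ?\<tau> x = 0 then 1 else cnj (?\<tau> x) / of_real (cmod (?\<tau> x)))"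
    have "c * ?\<tau> x = of_real (cmod (?\<tau> x))"
      by (simp add: c_def complex_norm_square power2_eq_square[symmetric] mult.commute[of "cnj _"] flip: complex_norm_square)
         (simp add: power2_eq_square)
    then have "\<rho> (c *\<^sub>C x) = cmod (?\<tau> x)" using re[of "c *\<^sub>C x"] sc[OF x, of c] x by simp
    moreover have "cmod c = 1" by (simp add: c_def norm_divide)
    ultimately show ?thesis by metis
  qed
qed

lemma linear_compose_re_part:
  assumes "linear f"
  shows "linear (\<lambda>y. f (re_part (y::'a::cstar_algebra)) :: real)"
  by (rule linearI)
     (simp_all add: re_part_def adj_add linear_add[OF assms] linear_scale[OF assms] scaleR_add_right
        algebra_simps add_divide_distrib)

lemma re_part_adj: "re_part (adj x) = re_part x"
  by (simp add: re_part_def add.commute)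

lemma tracial_if_vanishing_on_trace_null:
  fixes f :: "'a::cstar_algebra \<Rightarrow> real"
  assumes f: "linear f"
    and null: "\<And>x. x \<in> pedersen_sa \<Longrightarrow> (\<And>\<tau>. \<tau> \<in> real_traces \<Longrightarrow> \<tau> x = 0) \<Longrightarrow> f x = 0"
    and yz: "y \<in> pedersen_ideal" "z \<in> pedersen_ideal"
  shows "f (re_part (y * z)) = f (re_part (z * y))"
proof -
  have "\<tau> (re_part (y * z - z * y)) = 0" if "\<tau> \<in> real_traces" for \<tau>
    using real_trace_re_part[OF that, of "y * z - z * y"] yz
      pedersen_traceD(4,7)[OF real_tracesD(1)[OF that]] by simp
  then have "f (re_part (y * z - z * y)) = 0"
    using yz by (intro null) (simp_all add: pedersen_sa_iff)
  then show ?thesis by (simp add: linear_diff[OF linear_compose_re_part[OF f]])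
qed

text \<open>Symmetry under the involution, together with convexity, makes \<open>re_part\<close> map
  a neighbourhood into itself.\<close>

lemma pedersen_nbhd_symmetric:
  assumes "pedersen_nbhd U"
  shows "pedersen_nbhd {u \<in> U. adj u \<in> (U :: 'a::cstar_algebra set)}"
  unfolding pedersen_nbhd_def
proof (intro conjI allI impI)
  show "{u \<in> U. adj u \<in> U} \<subseteq> pedersen_ideal" using assms by (auto simp: pedersen_nbhd_def)
  show "convex {u \<in> U. adj u \<in> U}"
    using assms by (auto simp: pedersen_nbhd_def convex_def adj_add)
  show "\<forall>x\<in>{u \<in> U. adj u \<in> U}. \<forall>c. cmod c \<le> 1 \<longrightarrow> c *\<^sub>C x \<in> {u \<in> U. adj u \<in> U}"
    using assms by (auto simp: pedersen_nbhd_def adj_scaleC)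
  fix D assume D: "cstar_subalgebra D \<and> D \<subseteq> (pedersen_ideal :: 'a set)"
  then obtain r where r: "r > 0" "ball 0 r \<inter> D \<subseteq> U" using assms unfolding pedersen_nbhd_def by meson
  have "ball 0 r \<inter> D \<subseteq> {u \<in> U. adj u \<in> U}"
    using r(2) D by (auto simp: cstar_subalgebra_def subset_iff)
  then show "\<exists>r>0. ball 0 r \<inter> D \<subseteq> {u \<in> U. adj u \<in> U}" using r(1) by blast
qed

section \<open>Compactness of polars and the bipolar argument\<close>

lemma closedin_Ball:
  assumes "\<And>i. i \<in> I \<Longrightarrow> closedin X {x \<in> topspace X. P i x}"
  shows "closedin X {x \<in> topspace X. \<forall>i\<in>I. P i x}"
proof -
  have "{x \<in> topspace X. \<forall>i\<in>I. P i x} = topspace X \<inter> (\<Inter>i\<in>I. {x \<in> topspace X. P i x})" by auto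
  then show ?thesis using assms by (cases "I = {}") (auto intro!: closedin_Int closedin_INT)
qed

text \<open>Banach-Alaoglu. Pointwise bounds come from \<open>absorbed_pedersen\<close>, whose
  trace-null summand is invisible to traces, and Tychonoff applies. Continuity is not itself a
  closed condition, but the bound on \<open>U\<close> is, and it implies continuity.\<close>

lemma compactin_trace_polar:
  assumes U: "pedersen_nbhd (U :: 'a::cstar_algebra set)"
  shows "compactin weak_star_topology {\<tau> \<in> real_traces. \<forall>u\<in>U. cmod (\<tau> u) \<le> 1}"
proof -
  let ?P = "pedersen_ideal :: 'a set"
  let ?X = "product_topology (\<lambda>_. euclidean) ?P :: ('a \<Rightarrow> complex) topology"
  let ?K = "{\<tau> \<in> real_traces. \<forall>u\<in>U. cmod (\<tau> u) \<le> 1}"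
  have UP: "U \<subseteq> ?P" using U by (simp add: pedersen_nbhd_def)
  have "\<exists>M. \<forall>\<tau>\<in>?K. cmod (\<tau> x) \<le> M" if x: "x \<in> ?P" for x
  proof -
    obtain y n where yn: "x = y + n" "y \<in> ?P" "n \<in> trace_null" "\<exists>t>0. t *\<^sub>R y \<in> U"
      using absorbed_pedersen[OF x] U unfolding absorbed_def by blast
    obtain t where t: "t > 0" "t *\<^sub>R y \<in> U" using yn(4) by blast
    have "cmod (\<tau> x) \<le> 1 / t" if \<tau>: "\<tau> \<in> ?K" for \<tau>
    proof -
      have p: "pedersen_trace \<tau>" using \<tau> real_tracesD by blast
      have "\<tau> n = 0" "n \<in> ?P" using yn(3) p by (auto simp: trace_null_def)
      then have "\<tau> x = \<tau> y" using yn(2) p by (simp add: yn(1) pedersen_traceD)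
      moreover have "cmod (\<tau> (t *\<^sub>R y)) \<le> 1" using \<tau> t by blast
      ultimately show ?thesis using t(1) yn(2) p by (simp add: pedersen_traceD norm_mult field_simps)
    qed
    then show ?thesis by blast
  qed
  then have "\<forall>x\<in>?P. \<exists>M. \<forall>\<tau>\<in>?K. cmod (\<tau> x) \<le> M" by (rule ballI)
  from bchoice[OF this] obtain M where "\<forall>x\<in>?P. \<forall>\<tau>\<in>?K. cmod (\<tau> x) \<le> M x" by (elim exE)
  then have M: "cmod (\<tau> x) \<le> M x" if "x \<in> ?P" "\<tau> \<in> ?K" for x \<tau>
    using that by blast
  have box: "compactin ?X (PiE ?P (\<lambda>x. cball 0 (M x)))" by (simp add: compactin_PiE)
  have ev: "continuous_map ?X euclidean (\<lambda>\<tau>. \<tau> x)" if "x \<in> ?P" for x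
    using that by (rule continuous_map_product_projection)
  have eq: "closedin ?X {\<tau> \<in> topspace ?X. f \<tau> = g \<tau>}"
    if "continuous_map ?X euclidean f" "continuous_map ?X euclidean g" for f g :: "('a \<Rightarrow> complex) \<Rightarrow> complex"
    using that by (intro closedin_continuous_maps_eq[where Y=euclidean]) auto
  have "closedin ?X ({\<tau> \<in> topspace ?X. \<forall>x\<in>?P. \<forall>y\<in>?P. \<tau> (x + y) = \<tau> x + \<tau> y} \<inter>
      {\<tau> \<in> topspace ?X. \<forall>c\<in>UNIV. \<forall>x\<in>?P. \<tau> (c *\<^sub>C x) = c * \<tau> x} \<inter>
      {\<tau> \<in> topspace ?X. \<forall>x\<in>?P. \<forall>y\<in>?P. \<tau> (x * y) = \<tau> (y * x)} \<inter>
      {\<tau> \<in> topspace ?X. \<forall>x\<in>?P. \<tau> (adj x) = cnj (\<tau> x)} \<inter>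
      {\<tau> \<in> topspace ?X. \<forall>u\<in>U. cmod (\<tau> u) \<le> 1})" (is "closedin _ ?L")
  proof (intro closedin_Int closedin_Ball eq)
    show "continuous_map ?X euclidean (\<lambda>\<tau>. \<tau> x + \<tau> y)" if "x \<in> ?P" "y \<in> ?P" for x y
      using that by (intro continuous_map_add ev)
    show "continuous_map ?X euclidean (\<lambda>\<tau>. c * \<tau> x)" if "x \<in> ?P" for x c
      using continuous_map_compose[OF ev[OF that], of euclidean "(*) c"] by (simp add: o_def continuous_intros)
    show "continuous_map ?X euclidean (\<lambda>\<tau>. cnj (\<tau> x))" if "x \<in> ?P" for x
      using continuous_map_compose[OF ev[OF that], of euclidean cnj] by (simp add: o_def continuous_intros)
    show "closedin ?X {\<tau> \<in> topspace ?X. cmod (\<tau> u) \<le> 1}" if "u \<in> U" for u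
    proof -
      have "closedin ?X {\<tau> \<in> topspace ?X. cmod (\<tau> u) \<in> {..1}}"
        using that UP by (intro closedin_continuous_map_preimage[where Y=euclideanreal] continuous_map_norm ev) auto
      then show ?thesis by simp
    qed
  qed (auto intro: ev)
  moreover have KL: "?K = ?L"
  proof (intro antisym subsetI)
    fix \<tau> assume "\<tau> \<in> ?L"
    then have "pedersen_trace \<tau>" "\<And>x. x \<in> ?P \<Longrightarrow> \<tau> (adj x) = cnj (\<tau> x)" "\<And>u. u \<in> U \<Longrightarrow> cmod (\<tau> u) \<le> 1"
      by (auto simp: pedersen_trace_def PiE_iff)
    with real_tracesI[OF _ _ U, of \<tau> 1] show "\<tau> \<in> ?K" by blast
  next
    fix \<tau> assume "\<tau> \<in> ?K"
    then show "\<tau> \<in> ?L" by (simp add: real_traces_def pedersen_trace_def PiE_iff)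
  qed
  moreover have "?K \<subseteq> PiE ?P (\<lambda>x. cball 0 (M x))"
  proof
    fix \<tau> assume \<tau>: "\<tau> \<in> ?K"
    then have "\<tau> \<in> extensional ?P" by (auto dest: real_tracesD pedersen_traceD(1))
    then show "\<tau> \<in> PiE ?P (\<lambda>x. cball 0 (M x))" using M[OF _ \<tau>] by (simp add: PiE_iff)
  qed
  ultimately have "compactin ?X ?K" using closed_compactin[OF box, of ?K] by simp
  then show ?thesis unfolding weak_star_topology_def compactin_subtopology by auto
qed

text \<open>The bipolar theorem for the convex set \<open>C\<close> of self-adjoint elements that agree on all traces
  with an element of \<open>U\<close>: the gauge of \<open>C\<close> is finite by \<open>absorbed_pedersen\<close>, and a
  functional dominated by it vanishes on the elements killed by all traces, hence is tracial.\<close>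

lemma trace_bipolar:
  assumes U: "pedersen_nbhd (U :: 'a::cstar_algebra set)" and sym: "\<And>u. u \<in> U \<Longrightarrow> adj u \<in> U"
    and x: "x \<in> pedersen_sa"
    and polar: "\<And>\<tau>. \<tau> \<in> real_traces \<Longrightarrow> (\<And>u. u \<in> U \<Longrightarrow> cmod (\<tau> u) \<le> 1) \<Longrightarrow> Re (\<tau> x) < 1"
  shows "\<exists>u\<in>U \<inter> pedersen_sa. \<forall>\<tau>\<in>real_traces. \<tau> u = \<tau> x"
proof (rule ccontr)
  define C where "C = {y \<in> pedersen_sa. \<exists>u\<in>U \<inter> pedersen_sa. \<forall>\<tau>\<in>real_traces. \<tau> u = \<tau> y}"
  assume "\<not> ?thesis"
  then have xC: "x \<notin> C" using x by (auto simp: C_def)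
  have conv: "convex U" and bal: "\<And>u c. u \<in> U \<Longrightarrow> cmod c \<le> 1 \<Longrightarrow> c *\<^sub>C u \<in> U"
    using U by (auto simp: pedersen_nbhd_def)
  have reU: "re_part u \<in> U \<inter> pedersen_sa" if "u \<in> U" for u
  proof -
    have "(1/2) *\<^sub>R u + (1/2) *\<^sub>R adj u \<in> U" using that sym[OF that] by (intro convexD[OF conv]) auto
    moreover have "u \<in> pedersen_ideal" using U that by (auto simp: pedersen_nbhd_def)
    ultimately show ?thesis by (simp add: pedersen_sa_iff re_part_def[of u, symmetric] flip: scaleR_add_right)
  qed
  have tr: "pedersen_trace \<tau>" if "\<tau> \<in> real_traces" for \<tau> using that by (rule real_tracesD)
  have convC: "u *\<^sub>R y + v *\<^sub>R z \<in> C" if yz: "y \<in> C" "z \<in> C" and uv: "0 \<le> u" "0 \<le> v" "u + v = 1" for y z u v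
  proof -
    obtain y' z' where y': "y' \<in> U" "y' \<in> pedersen_sa" "\<And>\<tau>. \<tau> \<in> real_traces \<Longrightarrow> \<tau> y' = \<tau> y"
      and z': "z' \<in> U" "z' \<in> pedersen_sa" "\<And>\<tau>. \<tau> \<in> real_traces \<Longrightarrow> \<tau> z' = \<tau> z"
      using yz by (auto simp: C_def)
    have "u *\<^sub>R y' + v *\<^sub>R z' \<in> U" using y' z' uv by (intro convexD[OF conv])
    moreover have "\<tau> (u *\<^sub>R y' + v *\<^sub>R z') = \<tau> (u *\<^sub>R y + v *\<^sub>R z)" if "\<tau> \<in> real_traces" for \<tau>
      using y'(2) z'(2) y'(3)[OF that] z'(3)[OF that] yz tr[OF that] by (simp add: pedersen_traceD pedersen_sa_iff C_def)
    moreover have "u *\<^sub>R y' + v *\<^sub>R z' \<in> pedersen_sa" "u *\<^sub>R y + v *\<^sub>R z \<in> pedersen_sa"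
      using y'(2) z'(2) yz by (auto simp: C_def pedersen_sa_iff adj_add)
    ultimately show ?thesis unfolding C_def by blast
  qed
  define G where "G = (\<lambda>y. {t. t > 0 \<and> (1/t) *\<^sub>R y \<in> C})"
  define p where "p = (\<lambda>y. Inf (G y))"
  have nullC: "y \<in> C" if ysa: "y \<in> pedersen_sa" and null: "\<And>\<tau>. \<tau> \<in> real_traces \<Longrightarrow> \<tau> y = 0" for y
  proof -
    have "\<tau> 0 = \<tau> y" if "\<tau> \<in> real_traces" for \<tau>
      using null[OF that] pedersen_traceD(5)[OF tr[OF that]] by simp
    moreover have "0 \<in> U \<inter> pedersen_sa" using pedersen_nbhd_0[OF U] by (simp add: pedersen_sa_iff)
    ultimately show ?thesis using ysa unfolding C_def by blast
  qed
  have G_ne: "G y \<noteq> {}" if y: "y \<in> pedersen_sa" for y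
  proof -
    have "absorbed y" using y by (intro absorbed_pedersen) (simp add: pedersen_sa_iff)
    then obtain z n where zn: "y = z + n" "z \<in> pedersen_ideal" "n \<in> trace_null" "\<exists>t>0. t *\<^sub>R z \<in> U"
      using U unfolding absorbed_def by blast
    obtain t where t: "t > 0" "t *\<^sub>R z \<in> U" using zn(4) by blast
    have "\<tau> (re_part (t *\<^sub>R z)) = \<tau> (t *\<^sub>R y)" if \<tau>: "\<tau> \<in> real_traces" for \<tau>
    proof -
      have "\<tau> n = 0" "n \<in> pedersen_ideal" using zn(3) tr[OF \<tau>] by (auto simp: trace_null_def)
      then have "\<tau> (t *\<^sub>R y) = \<tau> (t *\<^sub>R z)" using zn(2) tr[OF \<tau>] by (simp add: zn(1) pedersen_traceD)
      moreover have "t *\<^sub>R y \<in> pedersen_sa" using y by (simp add: pedersen_sa_iff)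
      ultimately show ?thesis
        using real_trace_re_part[OF \<tau>, of "t *\<^sub>R z"] real_trace_sa[OF \<tau>, of "t *\<^sub>R y"] zn(2) by simp
    qed
    moreover have "t *\<^sub>R y \<in> pedersen_sa" using y by (simp add: pedersen_sa_iff)
    ultimately have "t *\<^sub>R y \<in> C" using reU[OF t(2)] unfolding C_def by blast
    then have "1/t \<in> G y" using t(1) by (simp add: G_def)
    then show ?thesis by blast
  qed
  have p_le: "p y \<le> t" if "t \<in> G y" for y t
    unfolding p_def using that by (intro cInf_lower) (auto simp: G_def intro!: bdd_belowI[of _ 0])
  have le_p: "s \<le> p y" if "y \<in> pedersen_sa" "\<And>t. t \<in> G y \<Longrightarrow> s \<le> t" for y s
    unfolding p_def using that G_ne by (intro cInf_greatest) auto
  \<comment> \<open>All positive multiples of such an element lie in \<open>C\<close>, so its gauge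
    falls below every \<open>e\<close>; this is what passing from \<open>U\<close> to
    \<open>C\<close> achieves.\<close>
  have p_null: "p y \<le> 0" if ysa: "y \<in> pedersen_sa" and null: "\<And>\<tau>. \<tau> \<in> real_traces \<Longrightarrow> \<tau> y = 0" for y
  proof (rule field_le_epsilon)
    fix e :: real assume e: "e > 0"
    have "\<tau> ((1/e) *\<^sub>R y) = 0" if "\<tau> \<in> real_traces" for \<tau>
      using null[OF that] ysa pedersen_traceD(6)[OF tr[OF that], of y "1/e"] by (simp add: pedersen_sa_iff)
    then have "(1/e) *\<^sub>R y \<in> C" using ysa by (intro nullC) (simp_all add: pedersen_sa_iff)
    then show "p y \<le> 0 + e" using e by (intro p_le) (simp add: G_def)
  qed
  have zero_sa: "(0::'a) \<in> pedersen_sa" by (simp add: pedersen_sa_iff)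
  have zeroC: "0 \<in> C" by (rule nullC[OF zero_sa]) (rule pedersen_traceD(5)[OF tr])
  have p0: "p 0 = 0"
  proof (rule antisym)
    show "p 0 \<le> 0" by (rule p_null[OF zero_sa]) (rule pedersen_traceD(5)[OF tr])
    show "0 \<le> p 0" by (rule le_p[OF zero_sa]) (simp add: G_def)
  qed
  have p_add: "p (y + z) \<le> p y + p z" if yz: "y \<in> pedersen_sa" "z \<in> pedersen_sa" for y z
  proof -
    have *: "p (y + z) \<le> s + t" if st: "s \<in> G y" "t \<in> G z" for s t
    proof (rule p_le)
      have s: "s > 0" "t > 0" using st by (auto simp: G_def)
      have "(s/(s+t)) *\<^sub>R ((1/s) *\<^sub>R y) + (t/(s+t)) *\<^sub>R ((1/t) *\<^sub>R z) \<in> C"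
        using st s by (intro convC) (auto simp: G_def simp flip: add_divide_distrib)
      then show "s + t \<in> G (y + z)" using s by (simp add: G_def scaleR_add_right)
    qed
    have "p (y + z) - s \<le> p z" if "s \<in> G y" for s
      by (rule le_p[OF yz(2)]) (use *[OF that] in \<open>simp add: algebra_simps\<close>)
    then have "p (y + z) - p z \<le> s" if "s \<in> G y" for s using that by (simp add: algebra_simps)
    then have "p (y + z) - p z \<le> p y" by (intro le_p[OF yz(1)])
    then show ?thesis by simp
  qed
  have p_scale: "p (c *\<^sub>R y) \<le> c * p y" if c: "c > 0" and y: "y \<in> pedersen_sa" for c y
  proof -
    have "p (c *\<^sub>R y) / c \<le> p y"
    proof (rule le_p[OF y])
      fix t assume "t \<in> G y"
      then have "c * t \<in> G (c *\<^sub>R y)" using c by (simp add: G_def)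
      then show "p (c *\<^sub>R y) / c \<le> t" using p_le c by (simp add: divide_le_eq mult.commute)
    qed
    then show ?thesis using c by (simp add: divide_le_eq mult.commute)
  qed
  obtain f where f: "linear f" "\<And>y. y \<in> pedersen_sa \<Longrightarrow> f y \<le> p y" "f x = p x"
    using Hahn_Banach_sublinear_on[OF subspace_pedersen_sa x p0 p_add p_scale] by blast
  \<comment> \<open>If \<open>(1/t) *\<^sub>R x\<close> were in \<open>C\<close> for some
    \<open>t < 1\<close>, convexity and \<open>0\<close> in \<open>C\<close> would put
    \<open>x\<close> into \<open>C\<close>.\<close>
  have "1 \<le> p x"
  proof (rule le_p[OF x])
    fix t assume t: "t \<in> G x"
    show "1 \<le> t"
    proof (rule ccontr)
      assume "\<not> 1 \<le> t"
      then have "t *\<^sub>R ((1/t) *\<^sub>R x) + (1 - t) *\<^sub>R 0 \<in> C"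
        using t zeroC by (intro convC) (auto simp: G_def)
      then show False using t xC by (simp add: G_def)
    qed
  qed
  have f_null: "f y = 0" if "y \<in> pedersen_sa" "\<And>\<tau>. \<tau> \<in> real_traces \<Longrightarrow> \<tau> y = 0" for y
  proof -
    have "p y \<le> 0" using that by (rule p_null)
    moreover have "\<tau> (- y) = 0" if "\<tau> \<in> real_traces" for \<tau>
      using pedersen_traceD(6)[OF tr[OF that], of y "-1"] \<open>y \<in> pedersen_sa\<close>
        \<open>\<And>\<tau>. \<tau> \<in> real_traces \<Longrightarrow> \<tau> y = 0\<close>[OF that] by (simp add: pedersen_sa_iff)
    then have "p (- y) \<le> 0" using that(1) by (intro p_null) (auto simp: pedersen_sa_iff)
    moreover have "- y \<in> pedersen_sa" using that(1) by (simp add: pedersen_sa_iff)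
    ultimately show ?thesis
      using f(2)[OF that(1)] f(2)[of "- y"] by (simp add: linear_neg[OF f(1)])
  qed
  define \<rho> where "\<rho> = (\<lambda>y. f (re_part y))"
  have \<rho>_lin: "linear \<rho>" unfolding \<rho>_def by (rule linear_compose_re_part[OF f(1)])
  have \<rho>_adj: "\<rho> (adj y) = \<rho> y" for y by (simp add: \<rho>_def re_part_adj)
  have \<rho>_tr: "\<rho> (y * z) = \<rho> (z * y)" if "y \<in> pedersen_ideal" "z \<in> pedersen_ideal" for y z
    unfolding \<rho>_def using f(1) f_null that by (rule tracial_if_vanishing_on_trace_null)
  note \<tau> = trace_of_functional[OF \<rho>_lin \<rho>_adj \<rho>_tr]
  have bound: "cmod (trace_of_functional \<rho> u) \<le> 1" if u: "u \<in> U" for u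
  proof -
    obtain c where c: "cmod c = 1" "cmod (trace_of_functional \<rho> u) = \<rho> (c *\<^sub>C u)"
      using \<tau>(3)[of u] u U by (auto simp: pedersen_nbhd_def)
    have "re_part (c *\<^sub>C u) \<in> U \<inter> pedersen_sa" using c u by (intro reU bal) auto
    then have "re_part (c *\<^sub>C u) \<in> C" by (auto simp: C_def)
    then have "1 \<in> G (re_part (c *\<^sub>C u))" "re_part (c *\<^sub>C u) \<in> pedersen_sa" by (auto simp: G_def C_def)
    then have "\<rho> (c *\<^sub>C u) \<le> 1" unfolding \<rho>_def using f(2) p_le by (meson order_trans)
    then show ?thesis using c by simp
  qed
  have "trace_of_functional \<rho> \<in> real_traces"
    by (rule real_tracesI[OF \<tau>(1,2) U bound])
  then have "Re (trace_of_functional \<rho> x) < 1" using bound by (rule polar)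
  moreover have "Re (trace_of_functional \<rho> x) = f x"
    using x by (simp add: trace_of_functional_def pedersen_sa_iff \<rho>_def re_part_sa)
  ultimately show False using \<open>1 \<le> p x\<close> f(3) by simp
qed

lemma topspace_traces_dual [simp]:
  "topspace traces_dual_topology = (traces_dual :: (('a::cstar_algebra \<Rightarrow> complex) \<Rightarrow> real) set)"
proof (rule antisym)
  show "topspace traces_dual_topology \<subseteq> (traces_dual :: (('a \<Rightarrow> complex) \<Rightarrow> real) set)"
    using openin_topspace[of "traces_dual_topology :: (('a \<Rightarrow> complex) \<Rightarrow> real) topology", unfolded openin_traces_dual_topology] by blast
  have "openin traces_dual_topology (traces_dual :: (('a \<Rightarrow> complex) \<Rightarrow> real) set)"
    unfolding openin_traces_dual_topology by (auto intro!: exI[of _ "{}"] exI[of _ 1])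
  then show "(traces_dual :: (('a \<Rightarrow> complex) \<Rightarrow> real) set) \<subseteq> topspace traces_dual_topology" by (rule openin_subset)
qed

lemma trace_evaluation_cong:
  "(\<And>\<tau>. \<tau> \<in> real_traces \<Longrightarrow> \<tau> a = \<tau> b) \<Longrightarrow> trace_evaluation a = trace_evaluation b"
  unfolding trace_evaluation_def by (rule restrict_ext) metis

lemma traces_dual_obtain:
  fixes f :: "('a::cstar_algebra \<Rightarrow> complex) \<Rightarrow> real"
  assumes "f \<in> traces_dual"
  obtains a where "a \<in> pedersen_sa" "f = trace_evaluation a"
proof -
  obtain a where a: "a \<in> pedersen_sa" "\<And>\<tau>. \<tau> \<in> real_traces \<Longrightarrow> f \<tau> = Re (\<tau> a)"
    using traces_dual_eq_evaluation[OF assms] by blast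
  have "f = trace_evaluation a"
    using a(2) assms by (intro extensionalityI[of _ real_traces]) (auto simp: traces_dual_def trace_evaluation_def)
  then show ?thesis using a(1) that by blast
qed

lemma openin_vimage_trace_evaluation:
  assumes W: "openin traces_dual_topology W"
  shows "openin pedersen_topology {x \<in> (pedersen_ideal :: 'a::cstar_algebra set). trace_evaluation x \<in> W}"
  unfolding openin_pedersen_topology
proof (intro conjI ballI)
  fix x :: 'a assume x: "x \<in> {x \<in> pedersen_ideal. trace_evaluation x \<in> W}"
  then obtain K e where K: "compactin weak_star_topology K" "e > 0"
    "{g \<in> traces_dual. \<forall>\<tau>\<in>K. \<bar>g \<tau> - trace_evaluation x \<tau>\<bar> < e} \<subseteq> W"
    using W unfolding openin_traces_dual_topology by blast
  have KT: "K \<subseteq> real_traces" using compactin_subset_topspace[OF K(1)] by simp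
  let ?V = "{x \<in> pedersen_ideal. \<forall>\<tau>\<in>K. cmod (\<tau> x) \<le> 1}"
  \<comment> \<open>Half of \<open>e\<close>, so that the bound 1 on the polar yields a strict
    inequality.\<close>
  let ?U = "(*\<^sub>R) (e/2) ` ?V"
  have "pedersen_nbhd ?U" using K(2) by (intro pedersen_nbhd_scaleR pedersen_nbhd_polar K(1)) auto
  moreover have "x + u \<in> {x \<in> pedersen_ideal. trace_evaluation x \<in> W}" if u: "u \<in> ?U" for u
  proof -
    obtain v where v: "v \<in> pedersen_ideal" "u = (e/2) *\<^sub>R v" "\<And>\<tau>. \<tau> \<in> K \<Longrightarrow> cmod (\<tau> v) \<le> 1" using u by auto
    have "\<bar>trace_evaluation (x + u) \<tau> - trace_evaluation x \<tau>\<bar> < e" if \<tau>: "\<tau> \<in> K" for \<tau>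
    proof -
      have T: "\<tau> \<in> real_traces" using \<tau> KT by blast
      have "\<tau> (x + u) = \<tau> x + of_real (e/2) * \<tau> v"
        using x v(1) real_tracesD(1)[OF T] unfolding v(2) by (simp add: pedersen_traceD del: of_real_divide)
      then have eq: "trace_evaluation (x + u) \<tau> - trace_evaluation x \<tau> = (e/2) * Re (\<tau> v)"
        using T by (simp add: trace_evaluation_def)
      have "\<bar>Re (\<tau> v)\<bar> \<le> 1" using abs_Re_le_cmod[of "\<tau> v"] v(3)[OF \<tau>] by linarith
      then have "(e/2) * \<bar>Re (\<tau> v)\<bar> \<le> (e/2) * 1" using K(2) by (intro mult_left_mono) auto
      then show ?thesis unfolding eq abs_mult using K(2) by simp
    qed
    moreover have "x + u \<in> pedersen_ideal" using x v by simp
    ultimately show ?thesis using K(3) trace_evaluation_in_dual[of "x + u"] by blast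
  qed
  ultimately show "\<exists>U. pedersen_nbhd U \<and> (+) x ` U \<subseteq> {x \<in> pedersen_ideal. trace_evaluation x \<in> W}"
    by blast
qed auto

text \<open>For openness, an evaluation \<open>g\<close> within 1 of \<open>f\<close> on the polar
  \<open>K\<close> of \<open>V\<close> differs from \<open>f\<close> by the evaluation at some
  \<open>u\<close> in \<open>V\<close>. Then \<open>a + u\<close> is a preimage of \<open>g\<close>
  in the given open set, whose self-adjoint part is the full preimage of \<open>W\<close>, and so
  \<open>g\<close> lies in \<open>W\<close>.\<close>

lemma quotient_map_trace_evaluation:
  "quotient_map (subtopology pedersen_topology (pedersen_sa :: 'a::cstar_algebra set))
     traces_dual_topology trace_evaluation"
proof -
  have sub: "pedersen_sa \<subseteq> (pedersen_ideal :: 'a set)" by (auto simp: pedersen_sa_iff)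
  then have top: "topspace (subtopology pedersen_topology pedersen_sa) = (pedersen_sa :: 'a set)" by auto
  have "openin (subtopology pedersen_topology pedersen_sa) {x \<in> pedersen_sa :: 'a set. trace_evaluation x \<in> W}"
    if "openin traces_dual_topology W" for W
    unfolding openin_subtopology using openin_vimage_trace_evaluation[OF that] sub
    by (intro exI[of _ "{x \<in> pedersen_ideal. trace_evaluation x \<in> W}"]) auto
  moreover have "openin traces_dual_topology W"
    if W: "W \<subseteq> traces_dual" and op: "openin (subtopology pedersen_topology pedersen_sa) {x \<in> pedersen_sa :: 'a set. trace_evaluation x \<in> W}" for W
    unfolding openin_traces_dual_topology
  proof (intro conjI ballI W)
    fix f assume f: "f \<in> W"
    then obtain a :: 'a where a: "a \<in> pedersen_sa" "f = trace_evaluation a" using W by (metis traces_dual_obtain subsetD)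
    obtain O1 where O1: "openin pedersen_topology O1" "{x \<in> pedersen_sa :: 'a set. trace_evaluation x \<in> W} = O1 \<inter> pedersen_sa"
      using op unfolding openin_subtopology by blast
    have "a \<in> O1" using a f O1(2) by blast
    then obtain U where U: "pedersen_nbhd U" "(+) a ` U \<subseteq> O1" using O1(1) unfolding openin_pedersen_topology by blast
    define V where "V = {u \<in> U. adj u \<in> U}"
    have V: "pedersen_nbhd V" "\<And>u. u \<in> V \<Longrightarrow> adj u \<in> V"
      using pedersen_nbhd_symmetric[OF U(1)] by (auto simp: V_def)
    define K where "K = {\<tau> \<in> real_traces. \<forall>u\<in>V. cmod (\<tau> u) \<le> 1}"
    have "compactin weak_star_topology K" unfolding K_def by (rule compactin_trace_polar[OF V(1)])
    moreover have "g \<in> W" if g: "g \<in> traces_dual" "\<And>\<tau>. \<tau> \<in> K \<Longrightarrow> \<bar>g \<tau> - f \<tau>\<bar> < 1" for g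
    proof -
      obtain b where b: "b \<in> pedersen_sa" "g = trace_evaluation b" using g(1) by (rule traces_dual_obtain)
      have ba: "b - a \<in> pedersen_sa" using a b by (simp add: pedersen_sa_iff adj_diff)
      have \<tau>ba: "\<tau> (b - a) = \<tau> b - \<tau> a" if "\<tau> \<in> real_traces" for \<tau>
        using a b pedersen_traceD(7)[OF real_tracesD(1)[OF that]] by (simp add: pedersen_sa_iff)
      have "\<exists>u\<in>V \<inter> pedersen_sa. \<forall>\<tau>\<in>real_traces. \<tau> u = \<tau> (b - a)"
      proof (rule trace_bipolar[OF V ba])
        fix \<tau> assume \<tau>: "\<tau> \<in> real_traces" "\<And>u. u \<in> V \<Longrightarrow> cmod (\<tau> u) \<le> 1"
        then have "\<bar>g \<tau> - f \<tau>\<bar> < 1" by (intro g(2)) (simp add: K_def)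
        then show "Re (\<tau> (b - a)) < 1" using \<tau>(1) by (simp add: a b \<tau>ba trace_evaluation_def)
      qed
      then obtain u where u: "u \<in> V" "u \<in> pedersen_sa" "\<And>\<tau>. \<tau> \<in> real_traces \<Longrightarrow> \<tau> u = \<tau> (b - a)" by blast
      have "a + u \<in> pedersen_sa" using a u by (simp add: pedersen_sa_iff adj_add)
      moreover have "a + u \<in> O1" using u(1) U(2) by (auto simp: V_def)
      ultimately have "trace_evaluation (a + u) \<in> W" using O1(2) by blast
      moreover have "trace_evaluation (a + u) = trace_evaluation b"
      proof (rule trace_evaluation_cong)
        fix \<tau> assume T: "\<tau> \<in> (real_traces :: ('a \<Rightarrow> complex) set)"
        then have "\<tau> (a + u) = \<tau> a + \<tau> u"
          using a u pedersen_traceD(2)[OF real_tracesD(1)[OF T]] by (simp add: pedersen_sa_iff)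
        then show "\<tau> (a + u) = \<tau> b" using u(3)[OF T] \<tau>ba[OF T] by simp
      qed
      ultimately show ?thesis by (simp add: b)
    qed
    ultimately show "\<exists>K e. compactin weak_star_topology K \<and> e > 0 \<and> {g \<in> traces_dual. \<forall>\<tau>\<in>K. \<bar>g \<tau> - f \<tau>\<bar> < e} \<subseteq> W"
      by (intro exI[of _ K] exI[of _ 1]) auto
  qed
  moreover have "trace_evaluation ` (pedersen_sa :: 'a set) = traces_dual"
    using trace_evaluation_in_dual sub by (auto elim!: traces_dual_obtain)
  ultimately show ?thesis unfolding quotient_map_def top topspace_traces_dual by blast
qed

section \<open>Jordan decomposition of bounded traces\<close>

lemma sa_square_conj:
  assumes "sa_square c"
  shows "sa_square (z * c * adj (z::'a::cstar_algebra))"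
proof -
  obtain e where "adj e = e" "c = e * e" using assms by (auto simp: sa_square_def)
  then have "z * c * adj z = adj (e * adj z) * (e * adj z)" by (simp add: adj_mult mult.assoc)
  then show ?thesis by (simp only: sa_square_adj_mult)
qed

lemma sa_square_mult_adj: "sa_square (x * adj (x::'a::cstar_algebra))"
  using sa_square_adj_mult[of "adj x"] by simp

lemma sa_square_0: "sa_square (0::'a::cstar_algebra)"
  by (auto simp: sa_square_def intro: exI[of _ 0])

lemma norm_mono_sa_square:
  assumes "sa_square c" "sa_square (a - c)"
  shows "norm c \<le> norm (a::'a::cstar_algebra)"
proof (rule norm_le_if_between[OF assms(2)])
  have "a + c = (a - c) + 2 *\<^sub>R c" by (simp add: scaleR_2)
  then show "sa_square (a + c)" using assms by (simp only: sa_square_add sa_square_scaleR zero_le_numeral)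
qed

text \<open>The difference is \<open>(y - y n)(y - y n)\<^sup>*\<close> with \<open>n = 1 - (1 - e)\<^sup>1\<^sup>/\<^sup>2\<close>.\<close>

lemma sa_square_defect:
  fixes e y :: "'a::cstar_algebra"
  assumes e: "sa_square e" "norm e \<le> 1"
  shows "sa_square (y * adj y - y * e * adj y)"
proof -
  define f where "f = (\<lambda>t. 1 - sqrt (max 0 (1 - t)))"
  have f: "null_continuous f" by (auto simp: f_def null_continuous_def intro!: continuous_intros)
  have sa: "adj e = e" using e(1) by (rule sa_square_sa)
  define n where "n = fun_calc f e"
  have n: "adj n = n" unfolding n_def by (rule adj_fun_calc[OF sa f])
  note ff = null_continuous_mult[OF f f] null_continuous_scale[OF f, of 2]
  have "2 *\<^sub>R n - n * n = fun_calc (\<lambda>t. 2 * f t - f t * f t) e"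
    by (simp only: n_def fun_calc_diff[OF sa ff(2,1)] fun_calc_mult[OF sa f f] fun_calc_scale[OF sa f])
  also have "\<dots> = fun_calc (\<lambda>t. t) e"
  proof (rule fun_calc_cong[OF sa null_continuous_diff[OF ff(2,1)] null_continuous_id])
    fix t assume "\<bar>t\<bar> \<le> norm e"
    then have "0 \<le> 1 - t" using e(2) by linarith
    then have "sqrt (max 0 (1 - t)) * sqrt (max 0 (1 - t)) = 1 - t" by simp
    then show "2 * f t - f t * f t = t" by (simp add: f_def algebra_simps)
  qed
  also have "\<dots> = e" by (rule fun_calc_id[OF sa])
  finally have nn: "n * n = 2 *\<^sub>R n - e" by (simp add: algebra_simps)
  have "(y - y * n) * adj (y - y * n) = y * adj y - 2 *\<^sub>R (y * n * adj y) + y * (n * n) * adj y"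
    by (simp add: adj_diff adj_mult n algebra_simps scaleR_2)
  also have "\<dots> = y * adj y - y * e * adj y" unfolding nn by (simp add: algebra_simps)
  finally show ?thesis using sa_square_mult_adj[of "y - y * n"] by simp
qed

text \<open>Here \<open>g\<close> plays the role of \<open>a\<^sup>-\<^sup>1\<^sup>/\<^sup>2\<close>, and \<open>m\<close> that of an approximate unit for \<open>a\<close>.\<close>

lemma ex_approximate_inverse_root:
  fixes a :: "'a::cstar_algebra"
  assumes a: "sa_square a" and \<delta>: "0 < \<delta>"
  obtains g m where "adj g = g" "adj m = m" "norm m \<le> 1" "g * a * g = m * m"
    "\<And>c. sa_square c \<Longrightarrow> sa_square (a - c) \<Longrightarrow> norm (c - c * (m * m)) \<le> \<delta>"
proof -
  \<comment> \<open>For \<open>c = e * e\<close> and \<open>k = m * m\<close> the squared error is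
    at most \<open>(norm e)^2 * (norm (e - e * k))^2\<close>, hence at most
    \<open>norm a * d\<close>; this choice of \<open>d\<close> makes that at most
    \<open>\<delta>^2\<close>.\<close>
  define d where "d = \<delta>\<^sup>2 / (norm a + 1)"
  have d: "d > 0" "norm a * d \<le> \<delta>\<^sup>2"
  proof -
    have "norm a + 1 > 0" by (simp add: add_nonneg_pos)
    then show "d > 0" "norm a * d \<le> \<delta>\<^sup>2" using \<delta> by (auto simp: d_def field_simps)
  qed
  have sa: "adj a = a" using a by (rule sa_square_sa)
  define r where "r = (\<lambda>t. sqrt \<bar>t\<bar> / max \<bar>t\<bar> d)"
  have mx: "max \<bar>t\<bar> d \<noteq> 0" for t using d by (metis less_max_iff_disj less_irrefl)
  have r: "null_continuous r" using mx by (auto simp: r_def null_continuous_def intro!: continuous_intros)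
  note p = null_continuous_plateau[OF d(1)]
  define g where "g = fun_calc r a"
  define m where "m = fun_calc (plateau d) a"
  have g: "adj g = g" unfolding g_def by (rule adj_fun_calc[OF sa r])
  have m: "adj m = m" unfolding m_def by (rule adj_fun_calc[OF sa p])
  have "norm m \<le> 1" unfolding m_def
    by (rule norm_fun_calc_le[OF sa p]) (use d mx in \<open>auto simp: plateau_def divide_le_eq\<close>)
  moreover have "g * a * g = m * m"
  proof -
    have "g * a * g = fun_calc (\<lambda>t. r t * t * r t) a"
      by (simp only: g_def fun_calc_mult[OF sa null_continuous_mult[OF r null_continuous_id] r]
          fun_calc_mult[OF sa r null_continuous_id] fun_calc_id[OF sa])
    also have "\<dots> = fun_calc (\<lambda>t. plateau d t * plateau d t) a"
    proof (rule fun_calc_cong_pos[OF a null_continuous_mult[OF null_continuous_mult[OF r null_continuous_id] r] null_continuous_mult[OF p p]])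
      fix t :: real assume "0 \<le> t"
      then have "sqrt \<bar>t\<bar> * t * sqrt \<bar>t\<bar> = \<bar>t\<bar> * \<bar>t\<bar>" by (simp add: mult.commute mult.left_commute flip: real_sqrt_mult)
      then show "r t * t * r t = plateau d t * plateau d t" by (simp add: r_def plateau_def)
    qed
    also have "\<dots> = m * m" unfolding m_def by (rule fun_calc_mult[OF sa p p])
    finally show ?thesis .
  qed
  moreover have "norm (c - c * (m * m)) \<le> \<delta>" if c: "sa_square c" "sa_square (a - c)" for c
  proof -
    define k where "k = m * m"
    have k: "adj k = k" by (simp add: k_def adj_mult m)
    obtain e where e: "adj e = e" "c = e * e" using c(1) by (auto simp: sa_square_def)
    obtain h where h: "adj h = h" "a - c = h * h" using c(2) by (auto simp: sa_square_def)
    \<comment> \<open>This is \<open>(1 - k) z (1 - k)\<close> expanded. It preserves positivity, so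
      \<open>sand c\<close> lies below \<open>sand a\<close>, whose norm is controlled by the
      function \<open>(1 - q t)^2 * t\<close>.\<close>
    define sand where "sand = (\<lambda>z. z - k * z - z * k + k * z * k)"
    have sand_sq: "sand (z * z) = adj (z - z * k) * (z - z * k)" if "adj z = z" for z
      by (simp add: sand_def adj_diff adj_mult that k algebra_simps)
    have 1: "sa_square (sand c)" unfolding e(2) sand_sq[OF e(1)] by (rule sa_square_adj_mult)
    have "sa_square (sand (a - c))" unfolding h(2) sand_sq[OF h(1)] by (rule sa_square_adj_mult)
    then have 2: "sa_square (sand a - sand c)" by (simp add: sand_def algebra_simps)
    define q where "q = (\<lambda>t. plateau d t * plateau d t)"
    have q: "null_continuous q" unfolding q_def by (rule null_continuous_mult[OF p p])
    have kq: "k = fun_calc q a" by (simp only: k_def m_def q_def fun_calc_mult[OF sa p p])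
    note nq = null_continuous_mult[OF q null_continuous_id] null_continuous_mult[OF null_continuous_id q]
    note nq3 = null_continuous_mult[OF nq(1) q]
    note nd = null_continuous_diff[OF null_continuous_diff[OF null_continuous_id nq(1)] nq(2)]
    have "sand a = fun_calc (\<lambda>t. t - q t * t - t * q t + q t * t * q t) a"
      by (simp only: sand_def kq fun_calc_add[OF sa nd nq3] fun_calc_diff[OF sa null_continuous_diff[OF null_continuous_id nq(1)] nq(2)]
          fun_calc_diff[OF sa null_continuous_id nq(1)] fun_calc_mult[OF sa nq(1) q] fun_calc_mult[OF sa q null_continuous_id]
          fun_calc_mult[OF sa null_continuous_id q] fun_calc_id[OF sa])
    also have "norm \<dots> \<le> d"
    proof (rule norm_fun_calc_le[OF sa null_continuous_add[OF nd nq3]])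
      fix t :: real
      have eq: "t - q t * t - t * q t + q t * t * q t = (1 - q t)\<^sup>2 * t" by (simp add: power2_eq_square algebra_simps)
      show "\<bar>t - q t * t - t * q t + q t * t * q t\<bar> \<le> d"
      proof (cases "d \<le> \<bar>t\<bar>")
        case True
        then have "q t = 1" using d by (simp add: q_def plateau_eq_1)
        then show ?thesis unfolding eq using d by simp
      next
        case False
        have "0 \<le> plateau d t" "plateau d t \<le> 1" using d mx[of t] by (auto simp: plateau_def divide_le_eq)
        then have "0 \<le> q t" "q t \<le> 1" by (auto simp: q_def mult_le_one)
        then have "(1 - q t)\<^sup>2 \<le> 1" by (simp add: power_le_one)
        then have "(1 - q t)\<^sup>2 * \<bar>t\<bar> \<le> 1 * d" using False d by (intro mult_mono) auto
        then show ?thesis unfolding eq by (simp add: abs_mult)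
      qed
    qed
    finally have "norm (sand c) \<le> d" using norm_mono_sa_square[OF 1 2] by simp
    then have ek: "(norm (e - e * k))\<^sup>2 \<le> d"
      unfolding e(2) sand_sq[OF e(1)] by (simp only: cstar_identity)
    have ee: "(norm e)\<^sup>2 \<le> norm a"
      using norm_mono_sa_square[OF c] norm_sa_square[OF e(1)] by (simp add: e(2))
    have "c - c * k = e * (e - e * k)" by (simp add: e(2) algebra_simps)
    then have "norm (c - c * k) \<le> norm e * norm (e - e * k)" by (simp add: norm_mult_ineq)
    then have "(norm (c - c * k))\<^sup>2 \<le> (norm e * norm (e - e * k))\<^sup>2" by (intro power_mono) auto
    also have "\<dots> = (norm e)\<^sup>2 * (norm (e - e * k))\<^sup>2" by (simp add: power_mult_distrib)
    also have "\<dots> \<le> norm a * d" using ek ee by (intro mult_mono) auto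
    also have "\<dots> \<le> \<delta>\<^sup>2" by (rule d(2))
    finally show ?thesis using \<delta> unfolding k_def by (simp add: power2_le_iff_abs_le)
  qed
  ultimately show ?thesis using that[OF g m] by blast
qed

section \<open>Real functionals determined by their values on positive elements\<close>

text \<open>If \<open>u - v = u' - v'\<close> then \<open>u + v' = u' + v\<close>, so additivity
  makes the value independent of how the real part is written as a difference of positive elements.
  Linearity follows by choosing convenient decompositions.\<close>

lemma linear_extension_from_positive:
  fixes q :: "'a::cstar_algebra \<Rightarrow> real"
  assumes add: "\<And>x y. sa_square x \<Longrightarrow> sa_square y \<Longrightarrow> q (x + y) = q x + q y"
    and scale: "\<And>x r. sa_square x \<Longrightarrow> 0 < r \<Longrightarrow> q (r *\<^sub>R x) = r * q x"
  obtains L where "linear L" "\<And>x. sa_square x \<Longrightarrow> L x = q x" "\<And>x. L (adj x) = L x"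
proof -
  have "\<exists>u v. sa_square u \<and> sa_square v \<and> re_part x = u - v" for x :: 'a
    using sa_pos_neg_decomposition[of "re_part x"] by (metis adj_re_part)
  then obtain P N where PN: "\<And>x. sa_square (P x)" "\<And>x. sa_square (N x)" "\<And>x::'a. re_part x = P x - N x" by metis
  define L where "L = (\<lambda>x. q (P x) - q (N x))"
  have L: "L x = q u - q v" if "sa_square u" "sa_square v" "re_part x = u - v" for x u v
  proof -
    have "P x + v = u + N x" using that(3) PN(3)[of x] by (simp add: algebra_simps)
    then have "q (P x) + q v = q u + q (N x)" using add that PN by metis
    then show ?thesis by (simp add: L_def)
  qed
  have q0: "q 0 = 0" using add[OF sa_square_0 sa_square_0] by simp
  have scale0: "q (r *\<^sub>R x) = r * q x" if "sa_square x" "0 \<le> r" for x r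
    using scale[of x r] that q0 by (cases "r = 0") auto
  have "L (x + y) = L x + L y" for x y
  proof -
    have "re_part (x + y) = re_part x + re_part y" by (simp add: re_part_def adj_add algebra_simps)
    also have "\<dots> = (P x + P y) - (N x + N y)" by (simp add: PN(3))
    finally have "re_part (x + y) = (P x + P y) - (N x + N y)" .
    then have "L (x + y) = q (P x + P y) - q (N x + N y)" by (intro L sa_square_add PN)
    then show ?thesis by (simp add: add PN L_def)
  qed
  moreover have "L (r *\<^sub>R x) = r *\<^sub>R L x" for r x
  proof -
    have re: "re_part (r *\<^sub>R x) = r *\<^sub>R (P x - N x)"
      unfolding PN(3)[of x, symmetric] by (simp add: re_part_def scaleR_add_right mult.commute)
    show ?thesis
    proof (cases "0 \<le> r")
      case True
      have "L (r *\<^sub>R x) = q (r *\<^sub>R P x) - q (r *\<^sub>R N x)"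
        using True by (intro L sa_square_scaleR PN) (simp_all add: re scaleR_diff_right)
      then show ?thesis using True PN by (simp add: scale0 L_def algebra_simps)
    next
      case False
      have "L (r *\<^sub>R x) = q ((- r) *\<^sub>R N x) - q ((- r) *\<^sub>R P x)"
        using False by (intro L sa_square_scaleR PN) (simp_all add: re scaleR_diff_right)
      then show ?thesis using False PN by (simp add: scale0[of _ "- r", simplified] L_def algebra_simps)
    qed
  qed
  ultimately have "linear L" by (rule linearI)
  moreover have "L x = q x" if "sa_square x" for x
    using L[OF that sa_square_0, of x] q0 sa_square_sa[OF that] by (simp add: re_part_sa)
  moreover have "L (adj x) = L x" for x
    using L[OF PN(1,2), of "adj x" x x] PN(3)[of x] by (simp add: L_def re_part_def add.commute)
  ultimately show ?thesis by (rule that)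
qed

text \<open>Both parts of \<open>re_part x\<close> have norm at most \<open>norm x\<close>, so
  \<open>L\<close> takes values between 0 and \<open>c * norm x\<close> on them; the difference of
  two such values gains no factor 2.\<close>

lemma positive_functional_bound:
  fixes L :: "'a::cstar_algebra \<Rightarrow> real"
  assumes L: "linear L" "\<And>x. L (adj x) = L x" and pos: "\<And>x. sa_square x \<Longrightarrow> 0 \<le> L x"
    and c: "\<And>e. sa_square e \<Longrightarrow> norm e \<le> 1 \<Longrightarrow> L e \<le> c"
  shows "\<bar>L x\<bar> \<le> c * norm x"
proof -
  have c0: "0 \<le> c" using c[OF sa_square_0] by (simp add: linear_0[OF L(1)])
  have le: "L u \<le> c * norm u" if u: "sa_square u" for u
  proof (cases "u = 0")
    case False
    have "L ((1 / norm u) *\<^sub>R u) \<le> c" using u False by (intro c sa_square_scaleR) auto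
    then show ?thesis using False by (simp add: linear_scale[OF L(1)] field_simps)
  qed (simp add: linear_0[OF L(1)])
  have "L x = L (re_part x)"
    by (simp add: re_part_def linear_add[OF L(1)] linear_scale[OF L(1)] L(2))
  moreover obtain u v where uv: "sa_square u" "sa_square v" "re_part x = u - v"
    "norm u \<le> norm (re_part x)" "norm v \<le> norm (re_part x)"
    using sa_pos_neg_decomposition[OF adj_re_part] by metis
  moreover have "norm u \<le> norm x" "norm v \<le> norm x" using uv norm_re_part_le[of x] by linarith+
  then have "c * norm u \<le> c * norm x" "c * norm v \<le> c * norm x" using c0 by (auto intro: mult_left_mono)
  ultimately show ?thesis
    using le[OF uv(1)] le[OF uv(2)] pos[OF uv(1)] pos[OF uv(2)] by (simp add: linear_diff[OF L(1)])
qed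

text \<open>Polarisation. Its real form is enough, since invariance under \<open>adj\<close>
  identifies \<open>L (adj y * x)\<close> with \<open>L (adj x * y)\<close>.\<close>

lemma tracial_if_tracial_on_squares:
  fixes L :: "'a::cstar_algebra \<Rightarrow> real"
  assumes L: "linear L" "\<And>x. L (adj x) = L x" and sq: "\<And>x. L (adj x * x) = L (x * adj x)"
  shows "L (x * y) = L (y * x)"
proof -
  have *: "L (adj x * y) = L (y * adj x)" for x y
  proof -
    have "L (adj (x + y) * (x + y)) = L ((x + y) * adj (x + y))" by (rule sq)
    then have "L (adj x * y) + L (adj y * x) = L (x * adj y) + L (y * adj x)"
      using sq[of x] sq[of y] by (simp add: adj_add distrib_left distrib_right linear_add[OF L(1)])
    moreover have "L (adj y * x) = L (adj x * y)" using L(2)[of "adj x * y"] by (simp add: adj_mult)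
    moreover have "L (x * adj y) = L (y * adj x)" using L(2)[of "y * adj x"] by (simp add: adj_mult)
    ultimately show ?thesis by simp
  qed
  show ?thesis using *[of "adj x" y] by simp
qed

section \<open>The positive and negative parts of a bounded trace\<close>

text \<open>The real part of a contractive self-adjoint trace on the whole algebra, as produced by
  separation. The one-sided bound yields the two-sided one by passing to \<open>- x\<close>.\<close>

locale bounded_trace =
  fixes \<rho> :: "'a::cstar_algebra \<Rightarrow> real"
  assumes lin: "linear \<rho>" and adj_inv: "\<rho> (adj x) = \<rho> x"
    and tracial: "\<rho> (x * y) = \<rho> (y * x)" and bound: "\<rho> x \<le> norm x"
begin

definition upper :: "'a \<Rightarrow> real" where
  "upper x = Sup {\<rho> c |c. sa_square c \<and> sa_square (x - c)}"

lemma upper_ge: "sa_square c \<Longrightarrow> sa_square (x - c) \<Longrightarrow> \<rho> c \<le> upper x"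
  unfolding upper_def
proof (rule cSup_upper)
  show "bdd_above {\<rho> c |c. sa_square c \<and> sa_square (x - c)}"
    by (rule bdd_aboveI[of _ "norm x"]) (auto intro: order_trans[OF bound norm_mono_sa_square])
qed blast

lemma upper_le:
  assumes "sa_square x" "\<And>c. sa_square c \<Longrightarrow> sa_square (x - c) \<Longrightarrow> \<rho> c \<le> M"
  shows "upper x \<le> M"
  unfolding upper_def by (rule cSup_least) (use assms sa_square_0 in \<open>auto intro!: exI[of _ 0]\<close>)

lemma upper_nonneg: "sa_square x \<Longrightarrow> 0 \<le> upper x"
  using upper_ge[of 0 x] by (simp add: sa_square_0 linear_0[OF lin])

lemma upper_ge_self: "sa_square x \<Longrightarrow> \<rho> x \<le> upper x"
  using upper_ge[of x x] by (simp add: sa_square_0)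

text \<open>For \<open>c\<close> between 0 and \<open>x\<close> the element
  \<open>2 *\<^sub>R c - x\<close> lies between \<open>- x\<close> and \<open>x\<close>, so its norm
  is at most \<open>norm x\<close>. The left-hand side is the sum of the positive and the negative
  part of \<open>\<rho>\<close> at \<open>x\<close>: this is the source of the additivity of
  norms.\<close>

lemma upper_norm:
  assumes "sa_square x"
  shows "2 * upper x - \<rho> x \<le> norm x"
proof -
  have "\<rho> c \<le> (norm x + \<rho> x) / 2" if c: "sa_square c" "sa_square (x - c)" for c
  proof -
    have eq: "x - (2 *\<^sub>R c - x) = 2 *\<^sub>R (x - c)" "x + (2 *\<^sub>R c - x) = 2 *\<^sub>R c"
      by (simp_all add: algebra_simps scaleR_2)
    have "norm (2 *\<^sub>R c - x) \<le> norm x"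
      by (rule norm_le_if_between; unfold eq; intro sa_square_scaleR c; simp)
    then have "\<rho> (2 *\<^sub>R c - x) \<le> norm x" using bound[of "2 *\<^sub>R c - x"] by linarith
    then show ?thesis by (simp add: linear_diff[OF lin] linear_scale[OF lin])
  qed
  then have "upper x \<le> (norm x + \<rho> x) / 2" by (rule upper_le[OF assms])
  then show ?thesis by simp
qed

lemma upper_le_norm: "sa_square x \<Longrightarrow> upper x \<le> norm x"
  using upper_norm[of x] upper_ge_self[of x] bound[of x] by linarith

lemma upper_minus_le_norm: "sa_square x \<Longrightarrow> upper x - \<rho> x \<le> norm x"
  using upper_norm[of x] upper_nonneg[of x] by linarith

text \<open>Riesz decomposition up to trace equivalence: a \<open>c \<le> a\<close> with \<open>a = \<Sum> y\<^sup>* y\<close> has almost the trace of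
  \<open>\<Sum> y g c g y\<^sup>*\<close>, whose terms lie below \<open>y y\<^sup>*\<close>.\<close>

lemma ex_compression:
  assumes a: "sa_square a" and c: "sa_square c" "sa_square (a - c)" and \<delta>: "0 < \<delta>"
  obtains b where "\<And>y. sa_square (y * b * adj y)" "\<And>y. sa_square (y * adj y - y * b * adj y)"
    "\<rho> c \<le> \<rho> (b * a) + \<delta>"
proof -
  obtain g m where g: "adj g = g" and m: "adj m = m" "norm m \<le> 1" and gm: "g * a * g = m * m"
    and app: "\<And>c. sa_square c \<Longrightarrow> sa_square (a - c) \<Longrightarrow> norm (c - c * (m * m)) \<le> \<delta>"
    using ex_approximate_inverse_root[OF a \<delta>] by metis
  have mm: "sa_square (m * m)" "norm (m * m) \<le> 1"
    using m norm_mult_ineq[of m m] mult_le_one[of "norm m" "norm m"] by (auto simp: sa_square_def)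
  have conj: "y * (g * z * g) * adj y = (y * g) * z * adj (y * g)" for y z
    by (simp add: adj_mult g mult.assoc)
  have 1: "sa_square (y * (g * c * g) * adj y)" for y
    unfolding conj by (rule sa_square_conj[OF c(1)])
  have 2: "sa_square (y * adj y - y * (g * c * g) * adj y)" for y
  proof -
    have "y * adj y - y * (g * c * g) * adj y =
        (y * adj y - y * (m * m) * adj y) + y * (g * (a - c) * g) * adj y"
      unfolding gm[symmetric] by (simp add: algebra_simps)
    then show ?thesis
      unfolding conj using sa_square_add[OF sa_square_defect[OF mm] sa_square_conj[OF c(2)], of y "y * g"]
      by (simp only:)
  qed
  have "\<rho> (g * c * g * a) = \<rho> (c * g * a * g)" using tracial[of g "c * g * a"] by (simp add: mult.assoc)
  also have "c * g * a * g = c * (m * m)" unfolding gm[symmetric] by (simp add: mult.assoc)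
  finally have "\<rho> c - \<rho> (g * c * g * a) = \<rho> (c - c * (m * m))" by (simp add: linear_diff[OF lin])
  also have "\<dots> \<le> \<delta>" using bound app[OF c] by (rule order_trans)
  finally show ?thesis using that[OF 1 2] by simp
qed

text \<open>Subadditivity is the difficult half. For \<open>c\<close> below \<open>x + y\<close> the
  value \<open>\<rho> c\<close> exceeds that at \<open>b * x + b * y\<close> by at most
  \<open>\<delta>\<close>, and with \<open>x = e * e\<close> traciality turns \<open>b * x\<close>
  into \<open>e * b * e\<close>, which lies between 0 and \<open>x\<close>; likewise for
  \<open>y\<close>.\<close>

lemma upper_add:
  assumes x: "sa_square x" and y: "sa_square y"
  shows "upper (x + y) = upper x + upper y"
proof (rule antisym)
  show "upper (x + y) \<le> upper x + upper y"
  proof (rule upper_le[OF sa_square_add[OF x y]], rule field_le_epsilon)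
    fix c and \<delta> :: real assume c: "sa_square c" "sa_square (x + y - c)" and \<delta>: "0 < \<delta>"
    obtain b where b: "\<And>z. sa_square (z * b * adj z)" "\<And>z. sa_square (z * adj z - z * b * adj z)"
      "\<rho> c \<le> \<rho> (b * (x + y)) + \<delta>"
      using ex_compression[OF sa_square_add[OF x y] c \<delta>] by metis
    have *: "\<rho> (b * z) \<le> upper z" if z: "sa_square z" for z
    proof -
      obtain e where e: "adj e = e" "z = e * e" using z by (auto simp: sa_square_def)
      have "\<rho> (b * z) = \<rho> (e * b * adj e)" using tracial[of "b * e" e] by (simp add: e mult.assoc)
      also have "\<dots> \<le> upper z" using b(1,2)[of e] by (intro upper_ge) (simp_all add: e)
      finally show ?thesis .
    qed
    have "\<rho> (b * (x + y)) = \<rho> (b * x) + \<rho> (b * y)" by (simp add: distrib_left linear_add[OF lin])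
    then show "\<rho> c \<le> upper x + upper y + \<delta>" using b(3) *[OF x] *[OF y] by simp
  qed
  have sum: "\<rho> c + \<rho> d \<le> upper (x + y)" if c: "sa_square c" "sa_square (x - c)" and d: "sa_square d" "sa_square (y - d)" for c d
  proof -
    have eq: "x + y - (c + d) = (x - c) + (y - d)" by simp
    have "\<rho> (c + d) \<le> upper (x + y)"
      by (rule upper_ge) (unfold eq, intro sa_square_add c d, intro sa_square_add c d)
    then show ?thesis by (simp add: linear_add[OF lin])
  qed
  have *: "upper y \<le> upper (x + y) - \<rho> c" if c: "sa_square c" "sa_square (x - c)" for c
  proof (rule upper_le[OF y])
    fix d assume "sa_square d" "sa_square (y - d)"
    from sum[OF c this] show "\<rho> d \<le> upper (x + y) - \<rho> c" by simp
  qed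
  have "upper x \<le> upper (x + y) - upper y"
  proof (rule upper_le[OF x])
    fix c assume "sa_square c" "sa_square (x - c)"
    from *[OF this] show "\<rho> c \<le> upper (x + y) - upper y" by simp
  qed
  then show "upper x + upper y \<le> upper (x + y)" by simp
qed

lemma upper_scale:
  assumes x: "sa_square x" and r: "0 < r"
  shows "upper (r *\<^sub>R x) = r * upper x"
proof -
  have *: "upper (r *\<^sub>R x) \<le> r * upper x" if x: "sa_square x" and r: "0 < r" for x r
  proof (rule upper_le[OF sa_square_scaleR[OF x]])
    fix c assume c: "sa_square c" "sa_square (r *\<^sub>R x - c)"
    have "x - (1/r) *\<^sub>R c = (1/r) *\<^sub>R (r *\<^sub>R x - c)" using r by (simp add: scaleR_diff_right)
    then have "sa_square (x - (1/r) *\<^sub>R c)" using c r by (simp only:) (intro sa_square_scaleR; simp)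
    then have "\<rho> ((1/r) *\<^sub>R c) \<le> upper x" using c r by (intro upper_ge sa_square_scaleR) auto
    then show "\<rho> c \<le> r * upper x" using r by (simp add: linear_scale[OF lin] field_simps)
  qed (use r in simp)
  have "upper ((1/r) *\<^sub>R (r *\<^sub>R x)) \<le> (1/r) * upper (r *\<^sub>R x)"
    using r by (intro * sa_square_scaleR x) auto
  then have "r * upper x \<le> upper (r *\<^sub>R x)" using r by (simp add: field_simps)
  with *[OF x r] show ?thesis by simp
qed

text \<open>For \<open>c\<close> below \<open>adj x * x\<close>, traciality moves
  \<open>b * (adj x * x)\<close> to \<open>x * b * adj x\<close>, which lies below
  \<open>x * adj x\<close>.\<close>

lemma upper_tracial: "upper (adj x * x) = upper (x * adj x)"
proof -
  have *: "upper (adj x * x) \<le> upper (x * adj x)" for x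
  proof (rule upper_le[OF sa_square_adj_mult], rule field_le_epsilon)
    fix c and \<delta> :: real assume c: "sa_square c" "sa_square (adj x * x - c)" and \<delta>: "0 < \<delta>"
    obtain b where b: "\<And>z. sa_square (z * b * adj z)" "\<And>z. sa_square (z * adj z - z * b * adj z)"
      "\<rho> c \<le> \<rho> (b * (adj x * x)) + \<delta>"
      using ex_compression[OF sa_square_adj_mult c \<delta>] by metis
    have "\<rho> (b * (adj x * x)) = \<rho> (x * b * adj x)" using tracial[of "b * adj x" x] by (simp add: mult.assoc)
    also have "\<dots> \<le> upper (x * adj x)" using b(1,2)[of x] by (intro upper_ge)
    finally show "\<rho> c \<le> upper (x * adj x) + \<delta>" using b(3) by simp
  qed
  show ?thesis using *[of x] *[of "adj x"] by simp
qed

text \<open>The parts are \<open>upper\<close> and \<open>upper - \<rho>\<close>, extended linearly.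
  In the last clause \<open>d\<close> and \<open>e\<close> may differ, so \<open>upper_norm\<close>
  does not apply directly; with an approximate unit \<open>m\<close> for \<open>d + e\<close>, both
  values are compared, up to \<open>\<delta> / 2\<close> each, with those at the common element
  \<open>m * m\<close>, where it does.\<close>

theorem jordan_decomposition:
  obtains L1 L2 where "linear L1" "linear L2" "\<And>x. \<rho> x = L1 x - L2 x"
    "\<And>x. L1 (adj x) = L1 x" "\<And>x. L2 (adj x) = L2 x"
    "\<And>x y. L1 (x * y) = L1 (y * x)" "\<And>x y. L2 (x * y) = L2 (y * x)"
    "\<And>x. sa_square x \<Longrightarrow> 0 \<le> L1 x" "\<And>x. sa_square x \<Longrightarrow> 0 \<le> L2 x"
    "\<And>d e. sa_square d \<Longrightarrow> norm d \<le> 1 \<Longrightarrow> sa_square e \<Longrightarrow> norm e \<le> 1 \<Longrightarrow> L1 d + L2 e \<le> 1"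
proof -
  obtain L1 where L1: "linear L1" "\<And>x. sa_square x \<Longrightarrow> L1 x = upper x" "\<And>x. L1 (adj x) = L1 x"
    using linear_extension_from_positive[of upper] upper_add upper_scale by metis
  define L2 where "L2 = (\<lambda>x. L1 x - \<rho> x)"
  have L2: "linear L2" unfolding L2_def by (rule linear_compose_sub[OF L1(1) lin])
  have adj2: "L2 (adj x) = L2 x" for x by (simp add: L2_def L1 adj_inv)
  have tr1: "L1 (x * y) = L1 (y * x)" for x y
    by (rule tracial_if_tracial_on_squares[OF L1(1,3)])
       (simp add: L1(2) sa_square_adj_mult sa_square_mult_adj upper_tracial)
  have tr2: "L2 (x * y) = L2 (y * x)" for x y unfolding L2_def tr1[of x y] tracial[of x y] ..
  have pos1: "0 \<le> L1 x" if "sa_square x" for x using that by (simp add: L1(2) upper_nonneg)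
  have pos2: "0 \<le> L2 x" if "sa_square x" for x using that upper_ge_self by (simp add: L2_def L1(2))
  have b1: "\<bar>L1 x\<bar> \<le> 1 * norm x" for x
    by (rule positive_functional_bound[OF L1(1,3) pos1]) (use upper_le_norm L1(2) in force)+
  have b2: "\<bar>L2 x\<bar> \<le> 1 * norm x" for x
    by (rule positive_functional_bound[OF L2 adj2 pos2]) (use upper_minus_le_norm L1(2) in \<open>force simp: L2_def\<close>)+
  have "L1 d + L2 e \<le> 1" if d: "sa_square d" "norm d \<le> 1" and e: "sa_square e" "norm e \<le> 1" for d e
  proof (rule field_le_epsilon)
    fix \<delta> :: real assume "0 < \<delta>"
    then have \<delta>: "0 < \<delta> / 2" by simp
    have de: "sa_square (d + e)" using d e by (intro sa_square_add)
    obtain g m where m: "adj m = m" "norm m \<le> 1"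
      and app: "\<And>c. sa_square c \<Longrightarrow> sa_square (d + e - c) \<Longrightarrow> norm (c - c * (m * m)) \<le> \<delta> / 2"
      using ex_approximate_inverse_root[OF de \<delta>] by metis
    have *: "L z \<le> L (m * m) + \<delta> / 2"
      if L: "linear L" "\<And>x y. L (x * y) = L (y * x)" "\<And>x. sa_square x \<Longrightarrow> 0 \<le> L x" "\<And>x. \<bar>L x\<bar> \<le> 1 * norm x"
        and z: "sa_square z" "norm z \<le> 1" "sa_square (d + e - z)" for L :: "'a \<Rightarrow> real" and z
    proof -
      have "L z - L (z * (m * m)) = L (z - z * (m * m))" by (simp add: linear_diff[OF L(1)])
      also have "\<dots> \<le> \<delta> / 2" using L(4)[of "z - z * (m * m)"] app[OF z(1,3)] by linarith
      finally have "L z \<le> L (z * (m * m)) + \<delta> / 2" by simp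
      moreover have "L (z * (m * m)) = L (m * z * m)" using L(2)[of "z * m" m] by (simp add: mult.assoc)
      moreover have "0 \<le> L (m * m - m * z * m)" using L(3) sa_square_defect[OF z(1,2), of m] by (simp add: m)
      ultimately show ?thesis by (simp add: linear_diff[OF L(1)])
    qed
    have "L1 d \<le> L1 (m * m) + \<delta> / 2" using d e by (intro * L1(1) tr1 pos1 b1) auto
    moreover have "L2 e \<le> L2 (m * m) + \<delta> / 2" using d e by (intro * L2 tr2 pos2 b2) auto
    moreover have "L1 (m * m) + L2 (m * m) \<le> 1"
    proof -
      have mm: "sa_square (m * m)" using m by (auto simp: sa_square_def)
      have "L1 (m * m) + L2 (m * m) \<le> norm (m * m)"
        using upper_norm[OF mm] by (simp add: L2_def L1(2)[OF mm])
      also have "\<dots> \<le> norm m * norm m" by (rule norm_mult_ineq)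
      also have "\<dots> \<le> 1" using m by (simp add: mult_le_one)
      finally show ?thesis .
    qed
    ultimately show "L1 d + L2 e \<le> 1 + \<delta>" by simp
  qed
  with L1 L2 adj2 tr1 tr2 pos1 pos2 show ?thesis by (intro that[of L1 L2]) (auto simp: L2_def)
qed

end

section \<open>The norm estimate\<close>

lemma contractive_positive_trace_of_functional:
  fixes L :: "'a::cstar_algebra \<Rightarrow> real"
  assumes L: "linear L" "\<And>x. L (adj x) = L x" "\<And>x y. L (x * y) = L (y * x)"
    and pos: "\<And>x. sa_square x \<Longrightarrow> 0 \<le> L x" and bound: "\<And>x. \<bar>L x\<bar> \<le> norm x"
  shows "trace_of_functional L \<in> contractive_positive_traces"
proof -
  note \<tau> = trace_of_functional[OF L(1,2,3)]
  have b: "cmod (trace_of_functional L x) \<le> norm x" if x: "x \<in> pedersen_ideal" for x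
  proof -
    obtain c where c: "cmod c = 1" "cmod (trace_of_functional L x) = L (c *\<^sub>C x)" using \<tau>(3)[OF x] by blast
    then show ?thesis using bound[of "c *\<^sub>C x"] by (simp add: norm_scaleC)
  qed
  have "trace_of_functional L \<in> real_traces"
  proof (rule real_tracesI[OF \<tau>(1,2) pedersen_nbhd_ball[of 1]])
    show "cmod (trace_of_functional L u) \<le> 1" if "u \<in> ball 0 1 \<inter> pedersen_ideal" for u
      using that b[of u] by auto
  qed auto
  moreover have "trace_of_functional L a \<in> \<real>\<^sub>\<ge>\<^sub>0" if "a \<in> pedersen_pos" for a
  proof -
    have a: "a \<in> pedersen_ideal" "sa_square a" using that by (auto simp: pedersen_pos_def positive_iff)
    have "L (\<i> *\<^sub>C a) = L (- (\<i> *\<^sub>C a))"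
      using L(2)[of "\<i> *\<^sub>C a"] sa_square_sa[OF a(2)] by (simp add: adj_scaleC scaleC_minus_left)
    then have "L (\<i> *\<^sub>C a) = 0" by (simp add: linear_neg[OF L(1)])
    then show ?thesis using a pos[OF a(2)] by (simp add: trace_of_functional_def complex_nonneg_Reals_iff)
  qed
  ultimately show ?thesis using b by (auto simp: contractive_positive_traces_def)
qed

text \<open>Up to an arbitrarily small \<open>\<eta>\<close>, \<open>L1\<close> and
  \<open>L2\<close> are \<open>c1\<close> and \<open>1 - c1\<close> times contractive positive
  traces. Their values at \<open>a\<close> are therefore at most \<open>c1 * s\<close> and
  \<open>(1 - c1) * s\<close> in modulus, which sum to \<open>s\<close>.\<close>

lemma (in bounded_trace) le_if_contractive_traces_le:
  assumes a: "a \<in> pedersen_ideal" and s: "\<And>\<tau>. \<tau> \<in> contractive_positive_traces \<Longrightarrow> \<bar>Re (\<tau> a)\<bar> \<le> s"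
  shows "\<rho> a \<le> s"
proof -
  obtain L1 L2 where L: "linear L1" "linear L2" "\<And>x. \<rho> x = L1 x - L2 x"
    "\<And>x. L1 (adj x) = L1 x" "\<And>x. L2 (adj x) = L2 x"
    "\<And>x y. L1 (x * y) = L1 (y * x)" "\<And>x y. L2 (x * y) = L2 (y * x)"
    "\<And>x. sa_square x \<Longrightarrow> 0 \<le> L1 x" "\<And>x. sa_square x \<Longrightarrow> 0 \<le> L2 x"
    "\<And>d e. sa_square d \<Longrightarrow> norm d \<le> 1 \<Longrightarrow> sa_square e \<Longrightarrow> norm e \<le> 1 \<Longrightarrow> L1 d + L2 e \<le> 1"
    by (rule jordan_decomposition) (rule that)
  have scaled: "\<bar>M a\<bar> \<le> c * s"
    if M: "linear M" "\<And>x. M (adj x) = M x" "\<And>x y. M (x * y) = M (y * x)" "\<And>x. sa_square x \<Longrightarrow> 0 \<le> M x"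
      and c: "c > 0" "\<And>e. sa_square e \<Longrightarrow> norm e \<le> 1 \<Longrightarrow> M e \<le> c" for M :: "'a \<Rightarrow> real" and c
  proof -
    define N where "N = (\<lambda>x. M x / c)"
    have N: "linear N" unfolding N_def using linear_compose_scale_right[OF M(1), of "1/c"] by simp
    have "\<bar>N x\<bar> \<le> norm x" for x
      using positive_functional_bound[OF M(1,2,4) c(2), of x] c(1) by (simp add: N_def divide_le_eq mult.commute)
    then have "trace_of_functional N \<in> contractive_positive_traces"
      using N M c by (intro contractive_positive_trace_of_functional) (auto simp: N_def)
    then have "\<bar>Re (trace_of_functional N a)\<bar> \<le> s" by (rule s)
    then show ?thesis using a c(1) by (simp add: trace_of_functional_def N_def divide_le_eq mult.commute)
  qed
  define E where "E = {e::'a. sa_square e \<and> norm e \<le> 1}"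
  have E: "0 \<in> E" by (simp add: E_def sa_square_0)
  define c1 where "c1 = (SUP e\<in>E. L1 e)"
  have bdd: "bdd_above (L1 ` E)"
    by (rule bdd_aboveI2[of _ _ 1]) (use L(10)[of _ 0] E linear_0[OF L(2)] in \<open>auto simp: E_def\<close>)
  have le1: "L1 e \<le> c1" if "e \<in> E" for e unfolding c1_def using that bdd by (rule cSUP_upper)
  have le2: "L2 e \<le> 1 - c1" if e: "e \<in> E" for e
  proof -
    have "c1 \<le> 1 - L2 e"
      unfolding c1_def
    proof (rule cSUP_least)
      fix d assume "d \<in> E"
      then show "L1 d \<le> 1 - L2 e" using L(10)[of d e] e by (simp add: E_def)
    qed (use E in blast)
    then show ?thesis by simp
  qed
  have c1: "0 \<le> c1" "0 \<le> 1 - c1"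
    using le1[OF E] le2[OF E] by (simp_all add: linear_0[OF L(1)] linear_0[OF L(2)])
  \<comment> \<open>The zero trace is positive and contractive, which shows that \<open>s\<close> is
    nonnegative.\<close>
  have "trace_of_functional (\<lambda>x. 0) \<in> (contractive_positive_traces :: ('a \<Rightarrow> complex) set)"
    by (rule contractive_positive_trace_of_functional) (auto intro: linear_zero)
  then have s0: "0 \<le> s" using s[of "trace_of_functional (\<lambda>x. 0)"] by (meson abs_ge_zero order_trans)
  \<comment> \<open>The slack \<open>\<eta>\<close> keeps the scaling factors positive when
    \<open>c1\<close> is 0 or 1.\<close>
  have main: "\<rho> a \<le> (1 + 2 * \<eta>) * s" if \<eta>: "\<eta> > 0" for \<eta>
  proof -
    have "L1 e \<le> c1 + \<eta>" "L2 e \<le> 1 - c1 + \<eta>" if "sa_square e" "norm e \<le> 1" for e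
      using le1[of e] le2[of e] that \<eta> by (simp_all add: E_def)
    then have "\<bar>L1 a\<bar> \<le> (c1 + \<eta>) * s" "\<bar>L2 a\<bar> \<le> (1 - c1 + \<eta>) * s"
      using c1 \<eta> by (intro scaled[OF L(1,4,6,8)] scaled[OF L(2,5,7,9)]; simp)+
    then have "L1 a - L2 a \<le> (c1 + \<eta>) * s + (1 - c1 + \<eta>) * s" by linarith
    then show ?thesis unfolding L(3) by (simp add: algebra_simps)
  qed
  show ?thesis
  proof (rule le_mult_right_if_greater[of 1 "\<rho> a" s, simplified])
    show "\<rho> a \<le> C * s" if "1 < C" for C using main[of "(C - 1) / 2"] that by (simp add: diff_divide_distrib)
  qed (rule s0)
qed

text \<open>Density of the Pedersen ideal and norm continuity, one variable at a time.\<close>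

lemma tracial_if_tracial_on_pedersen:
  fixes \<rho> :: "'a::cstar_algebra \<Rightarrow> real"
  assumes \<rho>: "linear \<rho>" "\<And>x. \<bar>\<rho> x\<bar> \<le> norm x"
    and tr: "\<And>x y. x \<in> pedersen_ideal \<Longrightarrow> y \<in> pedersen_ideal \<Longrightarrow> \<rho> (x * y) = \<rho> (y * x)"
  shows "\<rho> (x * y) = \<rho> (y * x)"
proof -
  have "bounded_linear \<rho>"
    using \<rho> by (intro bounded_linear_intro[where K=1]) (auto simp: linear_add linear_scale)
  then have cont: "continuous_on UNIV (\<lambda>z. \<rho> (h z))" if "continuous_on UNIV h" for h :: "'a \<Rightarrow> 'a"
    using that by (rule bounded_linear.continuous_on)
  have *: "\<forall>z. P z" if "closed {z::'a. P z}" "\<And>z. z \<in> pedersen_ideal \<Longrightarrow> P z" for P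
    using closure_minimal[of pedersen_ideal "{z. P z}"] that closure_pedersen[where 'a='a] by auto
  have cl: "closed {z. \<rho> (z * w) = \<rho> (w * z)}" for w :: 'a
    by (intro closed_Collect_eq cont continuous_intros)
  have "\<forall>z. \<rho> (z * w) = \<rho> (w * z)" if "w \<in> pedersen_ideal" for w
    using that by (intro *[OF cl] tr)
  then have "\<forall>w. \<rho> (w * x) = \<rho> (x * w)" by (intro *[OF cl]) metis
  then show ?thesis by metis
qed

text \<open>If \<open>a\<close> had distance \<open>> s\<close> from the elements killed by all traces, Hahn--Banach would give a
  contractive trace with value \<open>> s\<close> at \<open>a\<close>, contrary to the Jordan decomposition.\<close>

lemma ex_small_representative:
  fixes a :: "'a::cstar_algebra"
  assumes a: "a \<in> pedersen_sa" and s: "\<And>\<tau>. \<tau> \<in> contractive_positive_traces \<Longrightarrow> \<bar>Re (\<tau> a)\<bar> \<le> s" and e: "0 < e"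
  shows "\<exists>b\<in>pedersen_sa. (\<forall>\<tau>\<in>real_traces. \<tau> b = \<tau> a) \<and> norm b \<le> s + e"
proof -
  define N where "N = {x \<in> (pedersen_sa :: 'a set). \<forall>\<tau>\<in>real_traces. \<tau> x = 0}"
  have tr: "pedersen_trace \<tau>" if "\<tau> \<in> (real_traces :: ('a \<Rightarrow> complex) set)" for \<tau> using that by (rule real_tracesD)
  have N0: "0 \<in> N" using pedersen_traceD(5)[OF tr] by (auto simp: N_def pedersen_sa_iff)
  have NP: "n \<in> pedersen_ideal" "adj n = n" and Nz: "\<And>\<tau>. \<tau> \<in> real_traces \<Longrightarrow> \<tau> n = 0" if "n \<in> N" for n
    using that by (auto simp: N_def pedersen_sa_iff)
  have NI: "n \<in> N" if "n \<in> pedersen_ideal" "adj n = n" "\<And>\<tau>. \<tau> \<in> real_traces \<Longrightarrow> \<tau> n = 0" for n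
    using that by (auto simp: N_def pedersen_sa_iff)
  have Nadd: "m + n \<in> N" if mn: "m \<in> N" "n \<in> N" for m n
  proof -
    have "\<tau> (m + n) = 0" if "\<tau> \<in> real_traces" for \<tau>
      using pedersen_traceD(2)[OF tr[OF that], of m n] NP mn Nz[OF mn(1) that] Nz[OF mn(2) that] by simp
    then show ?thesis using mn by (intro NI) (simp_all add: NP adj_add)
  qed
  have Nscale: "r *\<^sub>R n \<in> N" if n: "n \<in> N" for n r
  proof -
    have "\<tau> (r *\<^sub>R n) = 0" if "\<tau> \<in> real_traces" for \<tau>
      using pedersen_traceD(6)[OF tr[OF that], of n r] NP[OF n] Nz[OF n that] by simp
    then show ?thesis using n by (intro NI) (simp_all add: NP)
  qed
  \<comment> \<open>The quotient seminorm modulo \<open>N\<close>; a linear functional below it is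
    contractive and vanishes on \<open>N\<close>.\<close>
  define p where "p = (\<lambda>x. INF n\<in>N. norm (x - n))"
  have p_le: "p x \<le> norm (x - n)" if "n \<in> N" for x n
    unfolding p_def using that by (intro cINF_lower bdd_belowI2[where m=0]) auto
  have le_p: "c \<le> p x" if "\<And>n. n \<in> N \<Longrightarrow> c \<le> norm (x - n)" for x c
    unfolding p_def using that N0 by (intro cINF_greatest) auto
  have "sublinear p"
    unfolding sublinear_def
  proof (intro conjI allI impI)
    show "p 0 = 0" using p_le[OF N0, of 0] le_p[of 0 0] by simp
    fix x y :: 'a
    have *: "p (x + y) \<le> norm (x - m) + norm (y - n)" if "m \<in> N" "n \<in> N" for m n
    proof -
      have eq: "x + y - (m + n) = (x - m) + (y - n)" by simp
      show ?thesis
        using p_le[OF Nadd[OF that], of "x + y"] norm_triangle_ineq[of "x - m" "y - n"]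
        unfolding eq by (rule order_trans)
    qed
    have "p (x + y) - norm (x - m) \<le> p y" if m: "m \<in> N" for m
    proof (rule le_p)
      fix n assume "n \<in> N"
      from *[OF m this] show "p (x + y) - norm (x - m) \<le> norm (y - n)" by simp
    qed
    then have "p (x + y) - p y \<le> p x" by (intro le_p) (simp add: algebra_simps)
    then show "p (x + y) \<le> p x + p y" by simp
  next
    fix c :: real and x :: 'a assume c: "0 < c"
    have "p (c *\<^sub>R x) / c \<le> p x"
    proof (rule le_p)
      fix n assume "n \<in> N"
      then have "p (c *\<^sub>R x) \<le> norm (c *\<^sub>R (x - n))" using p_le[OF Nscale, of n "c *\<^sub>R x" c] by (simp add: scaleR_diff_right)
      then show "p (c *\<^sub>R x) / c \<le> norm (x - n)" using c by (simp add: divide_le_eq mult.commute)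
    qed
    then show "p (c *\<^sub>R x) \<le> c * p x" using c by (simp add: divide_le_eq mult.commute)
  qed
  then obtain f where f: "linear f" "\<And>x. f x \<le> p x" "f a = p a" 
    by (rule Hahn_Banach_sublinear) (rule that)
  have f_norm: "f x \<le> norm x" for x using f(2)[of x] p_le[OF N0, of x] by simp
  have f_null: "f n = 0" if "n \<in> N" for n
    using f(2)[of n] f(2)[of "- n"] p_le[OF that, of n] p_le[OF Nscale[OF that], of "- n" "-1"]
    by (simp add: linear_neg[OF f(1)])
  define \<rho> where "\<rho> = (\<lambda>x. f (re_part x))"
  have \<rho>_lin: "linear \<rho>" unfolding \<rho>_def by (rule linear_compose_re_part[OF f(1)])
  have \<rho>_adj: "\<rho> (adj x) = \<rho> x" for x by (simp add: \<rho>_def re_part_adj)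
  have \<rho>_le: "\<rho> x \<le> norm x" for x
    unfolding \<rho>_def using f_norm norm_re_part_le by (rule order_trans)
  have \<rho>_abs: "\<bar>\<rho> x\<bar> \<le> norm x" for x
    using \<rho>_le[of x] \<rho>_le[of "- x"] by (simp add: linear_neg[OF \<rho>_lin])
  have \<rho>_tr: "\<rho> (x * y) = \<rho> (y * x)" if "x \<in> pedersen_ideal" "y \<in> pedersen_ideal" for x y
    unfolding \<rho>_def
  proof (rule tracial_if_vanishing_on_trace_null[OF f(1) _ that])
    fix z :: 'a assume "z \<in> pedersen_sa" "\<And>\<tau>. \<tau> \<in> real_traces \<Longrightarrow> \<tau> z = 0"
    then show "f z = 0" by (intro f_null) (simp add: N_def)
  qed
  interpret bounded_trace \<rho>
    by (rule bounded_trace.intro)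
      (rule \<rho>_lin \<rho>_adj tracial_if_tracial_on_pedersen[OF \<rho>_lin \<rho>_abs \<rho>_tr] \<rho>_le; assumption)+
  have "\<rho> a \<le> s" using a s by (intro le_if_contractive_traces_le) (auto simp: pedersen_sa_iff)
  then have "p a < s + e" using a f(3) e by (simp add: \<rho>_def re_part_sa pedersen_sa_iff)
  then obtain n where n: "n \<in> N" "norm (a - n) < s + e" using le_p[of "s + e" a] by force
  have "\<tau> (a - n) = \<tau> a" if "\<tau> \<in> real_traces" for \<tau>
    using pedersen_traceD(7)[OF tr[OF that], of a n] a NP[OF n(1)] Nz[OF n(1) that] by (simp add: pedersen_sa_iff)
  moreover have "a - n \<in> pedersen_sa" using a NP[OF n(1)] by (simp add: pedersen_sa_iff adj_diff)
  ultimately show ?thesis using n(2) by (intro bexI[of _ "a - n"]) auto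
qed

lemma traces_dual_norm_representative:
  fixes f :: "('a::cstar_algebra \<Rightarrow> complex) \<Rightarrow> real"
  assumes f: "f \<in> traces_dual" and e: "e > 0"
  shows "\<exists>a\<in>pedersen_sa. (\<forall>\<tau>\<in>real_traces. complex_of_real (f \<tau>) = \<tau> a) \<and>
    norm a \<le> (SUP \<tau>\<in>contractive_positive_traces. \<bar>f \<tau>\<bar>) + e"
proof -
  obtain a where a: "a \<in> pedersen_sa" "f = trace_evaluation a" using f by (rule traces_dual_obtain)
  have fa: "f \<tau> = Re (\<tau> a)" if "\<tau> \<in> real_traces" for \<tau> using that a by (simp add: trace_evaluation_def)
  have CT: "\<tau> \<in> real_traces" if "\<tau> \<in> contractive_positive_traces" for \<tau> :: "'a \<Rightarrow> complex"
    using that by (simp add: contractive_positive_traces_def)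
  let ?s = "SUP \<tau>\<in>contractive_positive_traces. \<bar>f \<tau>\<bar>"
  \<comment> \<open>A real supremum is known to dominate its family only when the family is bounded;
    contractivity provides the bound \<open>norm a\<close>.\<close>
  have "bdd_above ((\<lambda>\<tau>. \<bar>f \<tau>\<bar>) ` contractive_positive_traces)"
  proof (rule bdd_aboveI2)
    fix \<tau> :: "'a \<Rightarrow> complex" assume \<tau>: "\<tau> \<in> contractive_positive_traces"
    have "\<bar>f \<tau>\<bar> \<le> cmod (\<tau> a)" using fa[OF CT[OF \<tau>]] abs_Re_le_cmod by simp
    also have "\<dots> \<le> norm a" using \<tau> a by (simp add: contractive_positive_traces_def pedersen_sa_iff)
    finally show "\<bar>f \<tau>\<bar> \<le> norm a" .
  qed
  then have le: "\<bar>Re (\<tau> a)\<bar> \<le> ?s" if "\<tau> \<in> contractive_positive_traces" for \<tau>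
    using cSUP_upper[OF that, of "\<lambda>\<tau>. \<bar>f \<tau>\<bar>"] fa[OF CT[OF that]] by simp
  have "\<exists>b\<in>pedersen_sa. (\<forall>\<tau>\<in>real_traces. \<tau> b = \<tau> a) \<and> norm b \<le> ?s + e"
    by (rule ex_small_representative[OF a(1) _ e]) (rule le)
  then obtain b where b: "b \<in> pedersen_sa" "\<forall>\<tau>\<in>real_traces. \<tau> b = \<tau> a" "norm b \<le> ?s + e" by blast
  have "complex_of_real (f \<tau>) = \<tau> b" if "\<tau> \<in> real_traces" for \<tau>
    using real_trace_sa[OF that a(1)] fa[OF that] bspec[OF b(2) that] by simp
  with b show ?thesis by blast
qed

theorem theorem3:
  shows "(\<forall>a\<in>(pedersen_sa :: 'a::cstar_algebra set). \<forall>b\<in>pedersen_sa. \<forall>s t.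
            trace_evaluation (s *\<^sub>R a + t *\<^sub>R b) =
              lincomb_on real_traces s (trace_evaluation a) t (trace_evaluation b)) \<and>
         quotient_map
           (subtopology pedersen_topology (pedersen_sa :: 'a set))
           traces_dual_topology trace_evaluation \<and>
         (\<forall>f\<in>traces_dual. \<forall>\<epsilon>>0. \<exists>a\<in>(pedersen_sa :: 'a set).
            (\<forall>\<tau>\<in>real_traces. complex_of_real (f \<tau>) = \<tau> a) \<and>
            norm a \<le> (SUP \<tau>\<in>contractive_positive_traces. \<bar>f \<tau>\<bar>) + \<epsilon>)"
proof (intro conjI ballI allI impI)
  fix a b :: 'a and s t :: real
  assume a: "a \<in> pedersen_sa" and b: "b \<in> pedersen_sa"
  have "Re (\<tau> (s *\<^sub>R a + t *\<^sub>R b)) = s * Re (\<tau> a) + t * Re (\<tau> b)" if "\<tau> \<in> real_traces" for \<tau>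
    using a b pedersen_traceD(2,6)[OF real_tracesD(1)[OF that]] by (simp add: pedersen_sa_iff)
  then show "trace_evaluation (s *\<^sub>R a + t *\<^sub>R b) =
      lincomb_on real_traces s (trace_evaluation a) t (trace_evaluation b)"
    unfolding trace_evaluation_def lincomb_on_def by (intro restrict_ext) simp
next
  show "quotient_map (subtopology pedersen_topology (pedersen_sa :: 'a set)) traces_dual_topology trace_evaluation"
    by (rule quotient_map_trace_evaluation)
next
  fix f :: "('a \<Rightarrow> complex) \<Rightarrow> real" and \<epsilon> :: real
  assume "f \<in> traces_dual" "\<epsilon> > 0"
  then show "\<exists>a\<in>pedersen_sa. (\<forall>\<tau>\<in>real_traces. complex_of_real (f \<tau>) = \<tau> a) \<and>
      norm a \<le> (SUP \<tau>\<in>contractive_positive_traces. \<bar>f \<tau>\<bar>) + \<epsilon>"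
    by (rule traces_dual_norm_representative)
qed

end
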